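(* Let $H_0$ be a fixed connected ordered core. Consider the problem: given an ordered graph $G$ and an ordered graph $H$ that is a disjoint union of copies of $H_0$, decide whether there exists an ordered homomorphism $G\to H$. This problem is fixed-parameter tractable when parameterized by $|V(H)|$.
   Context: An ordered graph is a finite simple graph whose vertex set is equipped with a total (linear) order. For ordered graphs $G,H$, an ordered homomorphism $f:G\to H$ is a map $f:V(G)\to V(H)$ such that $uv\in E(G)$ implies $f(u)f(v)\in E(H)$, and $u\le v$ implies $f(u)\le f(v)$. An ordered subgraph of $G$ is a subgraph of $G$ with the induced order. An ordered retraction of $G$ to an ordered subgraph $H$ is an ordered homomorphism $f:G\to H$ with $f(v)=v$ for all $v\in V(H)$. An ordered core is an ordered graph that admits no ordered retraction to a proper ordered subgraph. An ordered graph $H$ is a disjoint union of copies of $H_0$ (an ordered $H_0$-factor) if its vertex set is partitioned into parts, each inducing an ordered graph isomorphic (as an ordered graph) to $H_0$, with no edges between different parts. *)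

theory Defs
  imports Main "HOL-Library.Disjoint_Sets"
begin

section \<open>Ordered graphs\<close>

text \<open>The linear order on the vertex set is the one of the vertex type, so that subgraphs
  automatically carry the induced order.\<close>

record 'a ograph =
  verts :: "'a set"
  edges :: "'a set set"

definition ordered_graph :: "'a::linorder ograph \<Rightarrow> bool" where
  "ordered_graph G \<longleftrightarrow> finite (verts G) \<and>
     (\<forall>e \<in> edges G. \<exists>u \<in> verts G. \<exists>v \<in> verts G. u \<noteq> v \<and> e = {u, v})"

definition ordered_hom :: "'a::linorder ograph \<Rightarrow> 'b::linorder ograph \<Rightarrow> ('a \<Rightarrow> 'b) \<Rightarrow> bool" where
  "ordered_hom G H f \<longleftrightarrow> f ` verts G \<subseteq> verts H \<and>
     (\<forall>u v. {u, v} \<in> edges G \<longrightarrow> {f u, f v} \<in> edges H) \<and>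
     mono_on (verts G) f"

definition ordered_subgraph :: "'a::linorder ograph \<Rightarrow> 'a ograph \<Rightarrow> bool" where
  "ordered_subgraph H G \<longleftrightarrow> ordered_graph H \<and> verts H \<subseteq> verts G \<and> edges H \<subseteq> edges G"

definition ordered_retraction :: "'a::linorder ograph \<Rightarrow> 'a ograph \<Rightarrow> ('a \<Rightarrow> 'a) \<Rightarrow> bool" where
  "ordered_retraction G H f \<longleftrightarrow>
     ordered_subgraph H G \<and> ordered_hom G H f \<and> (\<forall>v \<in> verts H. f v = v)"

definition ordered_core :: "'a::linorder ograph \<Rightarrow> bool" where
  "ordered_core G \<longleftrightarrow> ordered_graph G \<and>
     \<not> (\<exists>H f. ordered_subgraph H G \<and> H \<noteq> G \<and> ordered_retraction G H f)"

definition connected_graph :: "'a ograph \<Rightarrow> bool" where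
  "connected_graph G \<longleftrightarrow> verts G \<noteq> {} \<and>
     (\<forall>u \<in> verts G. \<forall>v \<in> verts G. (u, v) \<in> {(x, y). {x, y} \<in> edges G}\<^sup>*)"

definition induced_subgraph :: "'a ograph \<Rightarrow> 'a set \<Rightarrow> 'a ograph" where
  "induced_subgraph G S = \<lparr>verts = S, edges = {e \<in> edges G. e \<subseteq> S}\<rparr>"

definition ordered_iso :: "'a::linorder ograph \<Rightarrow> 'b::linorder ograph \<Rightarrow> bool" where
  "ordered_iso G H \<longleftrightarrow> (\<exists>f. bij_betw f (verts G) (verts H) \<and> mono_on (verts G) f \<and>
     (\<forall>u \<in> verts G. \<forall>v \<in> verts G. {u, v} \<in> edges G \<longleftrightarrow> {f u, f v} \<in> edges H))"

text \<open>\<open>ordered_factor H\<^sub>0 H\<close>: \<open>H\<close> is a disjoint union of copies of \<open>H\<^sub>0\<close>.  The copies may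
  interleave in the order of \<open>H\<close>.\<close>

definition ordered_factor :: "'a::linorder ograph \<Rightarrow> 'b::linorder ograph \<Rightarrow> bool" where
  "ordered_factor H\<^sub>0 H \<longleftrightarrow> ordered_graph H \<and>
     (\<exists>P. partition_on (verts H) P \<and>
          (\<forall>S \<in> P. ordered_iso (induced_subgraph H S) H\<^sub>0) \<and>
          (\<forall>e \<in> edges H. \<exists>S \<in> P. e \<subseteq> S))"


section \<open>Random access machines\<close>

text \<open>Structured programs for a random access machine with uniform cost, with addition and
  truncated subtraction as the only arithmetic.  As there is no multiplication, the bit length of
  the numbers grows by at most a constant (depending on the program) per step, so running times
  agree with those of Turing machines up to a polynomial.  Evaluating an expression is charged
  as part of the command containing it; this changes the running time of a program by a constant
  factor only.\<close>

datatype exp = Num nat | Reg nat | Load exp | Plus exp exp | Minus exp exp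

datatype com =
    Skip
  | Assign nat exp
  | Store exp exp
  | Seq com com
  | If exp com com
  | While exp com

record state =
  reg :: "nat \<Rightarrow> nat"
  mem :: "nat \<Rightarrow> nat"

primrec eval_exp :: "exp \<Rightarrow> state \<Rightarrow> nat" where
  "eval_exp (Num n) s = n"
| "eval_exp (Reg i) s = reg s i"
| "eval_exp (Load a) s = mem s (eval_exp a s)"
| "eval_exp (Plus a b) s = eval_exp a s + eval_exp b s"
| "eval_exp (Minus a b) s = eval_exp a s - eval_exp b s"

text \<open>\<open>exec c s t s'\<close>: started in state \<open>s\<close>, the program \<open>c\<close> halts after \<open>t\<close> steps in state \<open>s'\<close>.
  A test succeeds iff its value is nonzero.\<close>

inductive exec :: "com \<Rightarrow> state \<Rightarrow> nat \<Rightarrow> state \<Rightarrow> bool" where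
  Skip: "exec Skip s 1 s"
| Assign: "exec (Assign i a) s 1 (s\<lparr>reg := (reg s)(i := eval_exp a s)\<rparr>)"
| Store: "exec (Store a b) s 1 (s\<lparr>mem := (mem s)(eval_exp a s := eval_exp b s)\<rparr>)"
| Seq: "exec c s t s' \<Longrightarrow> exec d s' t' s'' \<Longrightarrow> exec (Seq c d) s (t + t') s''"
| IfTrue: "eval_exp a s \<noteq> 0 \<Longrightarrow> exec c s t s' \<Longrightarrow> exec (If a c d) s (Suc t) s'"
| IfFalse: "eval_exp a s = 0 \<Longrightarrow> exec d s t s' \<Longrightarrow> exec (If a c d) s (Suc t) s'"
| WhileFalse: "eval_exp a s = 0 \<Longrightarrow> exec (While a c) s 1 s"
| WhileTrue: "eval_exp a s \<noteq> 0 \<Longrightarrow> exec c s t s' \<Longrightarrow> exec (While a c) s' t' s'' \<Longrightarrow>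
    exec (While a c) s (Suc (t + t')) s''"

text \<open>On input \<open>(x, k)\<close> the word \<open>x\<close> is stored in memory, one bit per cell, its length is in
  register 0 and \<open>k\<close> is in register 1.  Results are returned in register 0.\<close>

definition input_state :: "bool list \<Rightarrow> nat \<Rightarrow> state" where
  "input_state x k = \<lparr>reg = (\<lambda>_. 0)(0 := length x, 1 := k),
     mem = (\<lambda>i. if i < length x \<and> x ! i then 1 else 0)\<rparr>"

definition computable :: "(nat \<Rightarrow> nat) \<Rightarrow> bool" where
  "computable f \<longleftrightarrow> (\<exists>p. \<forall>k. \<exists>t s. exec p (input_state [] k) t s \<and> reg s 0 = f k)"


section \<open>Fixed-parameter tractability\<close>

text \<open>A parameterized problem is a set of pairs of a word and a parameter.  The size of the input
  \<open>(x, k)\<close> is the length of \<open>x\<close> followed by a separator and \<open>k\<close> in unary.\<close>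

definition fixed_parameter_tractable :: "(bool list \<times> nat) set \<Rightarrow> bool" where
  "fixed_parameter_tractable L \<longleftrightarrow> (\<exists>p f c. computable f \<and>
     (\<forall>x k. \<exists>t s. exec p (input_state x k) t s \<and>
        t \<le> f k * (length x + 1 + k) ^ c \<and>
        (reg s 0 \<noteq> 0 \<longleftrightarrow> (x, k) \<in> L)))"


section \<open>Ordered homomorphisms to disjoint unions of copies of a fixed graph\<close>

text \<open>An ordered graph is encoded by its number of vertices in unary, a separator, and its adjacency
  matrix, row by row, with the vertices listed in increasing order.\<close>

definition encode_ograph :: "'a::linorder ograph \<Rightarrow> bool list" where
  "encode_ograph G = (let vs = sorted_list_of_set (verts G) in
     replicate (length vs) True @ False #
     concat (map (\<lambda>u. map (\<lambda>v. {u, v} \<in> edges G) vs) vs))"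

definition ordered_hom_factor_problem :: "'a::linorder ograph \<Rightarrow> (bool list \<times> nat) set" where
  "ordered_hom_factor_problem H\<^sub>0 =
     {(encode_ograph G @ encode_ograph H, card (verts H)) | (G :: nat ograph) (H :: nat ograph).
        ordered_graph G \<and> ordered_factor H\<^sub>0 H \<and> (\<exists>f. ordered_hom G H f)}"

end

theory Submission
  imports Defs "HOL-Library.Nat_Bijection"
begin

section \<open>Combining partial homomorphisms\<close>

text \<open>Write the vertices of \<open>G\<close> as positions \<open>0, \<dots>, n-1\<close> and those of \<open>H\<close> as letters \<open>0, \<dots>, k-1\<close>,
  and add the edges of \<open>G\<close> one at a time. A homomorphism \<open>f\<close> for the edges seen so far cuts the
  positions into blocks on which \<open>f\<close> is constant; only the blocks next to the ends of a new edge are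
  cut further. A homomorphism \<open>f'\<close> respecting the new edge is searched for by guessing, for each
  block, the least and the greatest letter it uses; this is a number of guesses bounded in \<open>k\<close>. Positions
  that \<open>f\<close> sends to different copies are joined by no old edge, so after the guess the copies \<open>s\<close> of the
  values of \<open>f\<close> are independent subproblems. In the subproblem of \<open>s\<close> there are at most \<open>5 m\<close> blocks,
  where \<open>m\<close> is the size of a copy. Let \<open>A\<close> consist of \<open>s\<close> and the copies of the guessed bounds of
  these blocks, at most \<open>1 + 10 m\<close> many. A letter in a copy of \<open>A\<close> is used on an interval of positions
  in each block, so boundedly many intervals fix \<open>f'\<close> there, at polynomial cost. The remaining positions
  form an instance with the strictly smaller set of allowed copies \<open>S - A\<close>. Hence a table over sets
  \<open>S\<close> of copies, numbers \<open>j\<close> of edges and lists \<open>z\<close> of boundedly many zones has size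
  \<open>f(k)\<close> times a polynomial. It is filled in increasing order by bounded searches, which are
  programmable on the machine.\<close>

text \<open>A monotone map into \<open>k\<close> letters is fixed by \<open>k\<close> cut points, so
  trying all of them takes time about n^k. The whole difficulty is to keep \<open>k\<close> out of
  the exponent of \<open>n\<close>. Letters are cheap to guess, since their number depends on
  \<open>k\<close> only; positions are expensive, so only boundedly many of them, in terms of
  \<open>m\<close>, may be guessed at once. The old homomorphism pays for this: it splits the
  instance into one subproblem per copy, each with its own guess, tried independently. The bounds
  guessed for the blocks keep the separate answers in order, and an end of the new edge, being a
  block by itself, is pinned to its letter. The number of zones does not grow along the recursion. A
  subproblem inherits no zone of its parent: its zones are indexed by pairs of a block and a letter
  of a copy in \<open>A\<close>, and the number of these pairs is again bounded in terms of
  \<open>m\<close>. The ends of every block range are letters of copies in \<open>A\<close>, which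
  is why the letters left over fall into gaps that no two blocks share.\<close>

definition part :: "nat \<Rightarrow> nat \<Rightarrow> nat \<Rightarrow> nat" where
  "part u v w = (if w < min u v then 0 else if w = min u v then 1
     else if w < max u v then 2 else if w = max u v then 3 else 4)"

lemma part_le: "part u v w < 5" by (simp add: part_def)
lemma part_mono: "w \<le> w' \<Longrightarrow> part u v w \<le> part u v w'" by (auto simp: part_def)
text \<open>Parts 1 and 3 are single positions, the ends of the edge \<open>uv\<close>; this makes
  each end a block of its own.\<close>

lemma part_u: "part u v w = part u v u \<Longrightarrow> w = u" 
  by (auto simp: part_def min_def max_def split: if_splits)
lemma part_v: "part u v w = part u v v \<Longrightarrow> w = v"
  by (auto simp: part_def min_def max_def split: if_splits)

text \<open>A guess \<open>c\<close> is a flat list of \<open>Q\<close> triples: first position,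
  position after the last, letter. Outside the listed intervals the smaller subproblem
  \<open>g\<close> decides. The intervals built in \<open>split\<close> are disjoint; taking the
  least index only makes the function total.\<close>

definition merge :: "nat \<Rightarrow> (nat \<Rightarrow> nat) \<Rightarrow> (nat \<Rightarrow> nat) \<Rightarrow> nat \<Rightarrow> nat" where
  "merge Q c g w = (if \<exists>i<Q. c (3*i) \<le> w \<and> w < c (3*i+1)
     then c (3 * (LEAST i. i < Q \<and> c (3*i) \<le> w \<and> w < c (3*i+1)) + 2) else g w)"

definition lft :: "nat set \<Rightarrow> nat" where "lft W = (if W = {} then 0 else Min W)"
definition rgt :: "nat set \<Rightarrow> nat" where "rgt W = (if W = {} then 0 else Suc (Max W))"

text \<open>Zones and guessed intervals store two endpoints only, so a set of positions can be
  handed on once it is known to be convex.\<close>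

lemma convex_iff:
  assumes "finite W" "\<And>a b w. a \<in> W \<Longrightarrow> b \<in> W \<Longrightarrow> a \<le> w \<Longrightarrow> w \<le> b \<Longrightarrow> w \<in> W"
  shows "lft W \<le> w \<and> w < rgt W \<longleftrightarrow> w \<in> W"
proof (cases "W = {}")
  case False
  then show ?thesis using assms(1) assms(2)[OF Min_in Max_in, of w]
    by (auto simp: lft_def rgt_def less_Suc_eq_le)
qed (simp add: lft_def rgt_def)

lemma lft_rgt_le: "W \<subseteq> {..<n} \<Longrightarrow> lft W \<le> n \<and> rgt W \<le> n"
proof (cases "W = {}")
  case False
  assume "W \<subseteq> {..<n}"
  then have "finite W" by (rule finite_subset) simp
  then have "Min W \<in> W" "Max W \<in> W" using False by auto
  then show ?thesis using False \<open>W \<subseteq> {..<n}\<close> by (auto simp: lft_def rgt_def less_Suc_eq_le Suc_le_eq)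
qed (simp add: lft_def rgt_def)

section \<open>Subinstances cut out by zones of positions and letters\<close>

locale instances =
  fixes n k :: nat and eG eH :: "nat \<Rightarrow> nat \<Rightarrow> bool" and cp :: "nat \<Rightarrow> nat" and Q :: nat
begin

text \<open>Zone \<open>i\<close> of \<open>z\<close> allows the letters \<open>z (4i+2), \<dots>, z (4i+3)\<close> at the positions
  \<open>z (4i), \<dots>, z (4i+1) - 1\<close>. The letter \<open>h\<close> lies in the copy \<open>cp h\<close>; a pair \<open>w, w'\<close> of positions
  has number \<open>w * n + w'\<close>, and only edges with number below \<open>j\<close> count.\<close>

definition inz :: "(nat \<Rightarrow> nat) \<Rightarrow> nat \<Rightarrow> nat \<Rightarrow> bool" where
  "inz z i w \<longleftrightarrow> z (4*i) \<le> w \<and> w < z (4*i+1)"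
definition inr :: "(nat \<Rightarrow> nat) \<Rightarrow> nat \<Rightarrow> nat \<Rightarrow> bool" where
  "inr z i h \<longleftrightarrow> z (4*i+2) \<le> h \<and> h \<le> z (4*i+3)"
definition dom :: "(nat \<Rightarrow> nat) \<Rightarrow> nat \<Rightarrow> bool" where
  "dom z w \<longleftrightarrow> w < n \<and> (\<exists>i<Q. inz z i w)"
definition alw :: "nat set \<Rightarrow> (nat \<Rightarrow> nat) \<Rightarrow> nat \<Rightarrow> nat \<Rightarrow> bool" where
  "alw S z w h \<longleftrightarrow> h < k \<and> cp h \<in> S \<and> (\<exists>i<Q. inz z i w \<and> inr z i h)"
definition valid :: "nat \<Rightarrow> nat set \<Rightarrow> (nat \<Rightarrow> nat) \<Rightarrow> (nat \<Rightarrow> nat) \<Rightarrow> bool" where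
  "valid j S z f \<longleftrightarrow> (\<forall>w<n. dom z w \<longrightarrow> alw S z w (f w) \<and>
     (\<forall>w'<n. dom z w' \<longrightarrow> (w \<le> w' \<longrightarrow> f w \<le> f w') \<and> (eG w w' \<and> w*n+w' < j \<longrightarrow> eH (f w) (f w'))))"
text \<open>The subproblem of the copy \<open>s\<close>: the positions are those with old value in
  \<open>s\<close>, and new letters must respect the bounds guessed for their block. Only edges
  below \<open>j\<close> are checked; edge number \<open>j\<close> is taken care of in
  \<open>combine\<close> by the bounds at its ends.\<close>

definition okP :: "nat \<Rightarrow> nat set \<Rightarrow> (nat \<Rightarrow> nat) \<Rightarrow> (nat \<Rightarrow> nat) \<Rightarrow> nat \<Rightarrow> nat \<Rightarrow>
    (nat \<Rightarrow> nat \<Rightarrow> nat) \<Rightarrow> (nat \<Rightarrow> nat \<Rightarrow> nat) \<Rightarrow> nat \<Rightarrow> (nat \<Rightarrow> nat) \<Rightarrow> bool" where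
  "okP j S z f u v lo hi s g \<longleftrightarrow> (\<forall>w<n. dom z w \<and> cp (f w) = s \<longrightarrow> alw S z w (g w) \<and>
     lo (f w) (part u v w) \<le> g w \<and> g w \<le> hi (f w) (part u v w) \<and>
     (\<forall>w'<n. dom z w' \<and> cp (f w') = s \<longrightarrow>
        (w \<le> w' \<longrightarrow> g w \<le> g w') \<and> (eG w w' \<and> w*n+w' < j \<longrightarrow> eH (g w) (g w'))))"
text \<open>Disjoint letter ranges let a letter determine its zone, which ties positions of equal
  value to one zone. Zones without positions are exempt, because idle slots of the list all hold
  zeros and would share the letter 0.\<close>

definition good :: "nat set \<Rightarrow> (nat \<Rightarrow> nat) \<Rightarrow> bool" where
  "good S z \<longleftrightarrow> (\<forall>i<Q. \<forall>i'<Q. z (4*i) < z (4*i+1) \<longrightarrow> z (4*i') < z (4*i'+1) \<longrightarrow>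
     (\<forall>h<k. cp h \<in> S \<longrightarrow> inr z i h \<longrightarrow> inr z i' h \<longrightarrow> i = i') \<and>
     (\<forall>w. inz z i w \<longrightarrow> inz z i' w \<longrightarrow> i = i'))"

end

text \<open>\<open>Q\<close> must hold one zone and one guessed interval per pair of a block and a
  letter: at most \<open>5 * m\<close> blocks, times at most \<open>m\<close> letters in each of the
  at most \<open>1 + 10 * m\<close> copies in \<open>A\<close>.\<close>

locale colouring = instances +
  fixes m :: nat
  assumes cross: "\<And>h h'. h < k \<Longrightarrow> h' < k \<Longrightarrow> eH h h' \<Longrightarrow> cp h = cp h'"
    and copy_size: "\<And>s. card {h. h < k \<and> cp h = s} \<le> m"
    and Q: "5 * m * ((1 + 10 * m) * m) \<le> Q"
begin

lemma inz_act: "inz z i w \<Longrightarrow> z (4*i) < z (4*i+1)" by (simp add: inz_def)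

lemma good_r:
  assumes "good S z" "i < Q" "i' < Q" "inz z i w" "inz z i' w'" "h < k" "cp h \<in> S" "inr z i h" "inr z i' h"
  shows "i = i'"
  using assms(1)[unfolded good_def, rule_format, OF assms(2,3) inz_act inz_act, OF assms(4,5)] assms(6-) by blast

lemma good_z:
  assumes "good S z" "i < Q" "i' < Q" "inz z i w" "inz z i' w"
  shows "i = i'"
  using assms(1)[unfolded good_def, rule_format, OF assms(2,3) inz_act inz_act, OF assms(4,5)] assms(4-) by blast

text \<open>Without edges, choosing the least allowed letter everywhere is monotone.\<close>

lemma valid_0:
  assumes g: "good S z" and f': "valid j S z f'"
  shows "valid 0 S z (\<lambda>w. LEAST h. alw S z w h)"
proof -
  have A: "alw S z w (LEAST h. alw S z w h)" if "w < n" "dom z w" for w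
    by (rule LeastI[of "alw S z w" "f' w"]) (use f' that in \<open>simp add: valid_def\<close>)
  have M: "(LEAST h. alw S z w h) \<le> (LEAST h. alw S z w' h)"
    if w: "w < n" "dom z w" "w' < n" "dom z w'" "w \<le> w'" for w w'
  proof -
    let ?a = "LEAST h. alw S z w h" and ?b = "LEAST h. alw S z w' h"
    obtain i where i: "i < Q" "inz z i w" "inr z i ?a" "?a < k" "cp ?a \<in> S" using A[OF w(1,2), unfolded alw_def[of _ _ _ ?a]] by blast
    obtain i' where i': "i' < Q" "inz z i' w'" "inr z i' ?b" "?b < k" "cp ?b \<in> S" using A[OF w(3,4), unfolded alw_def[of _ _ _ ?b]] by blast
    have fw: "alw S z w (f' w)" "alw S z w' (f' w')" "f' w \<le> f' w'" using f'[unfolded valid_def] w by blast+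
    obtain a where a: "a < Q" "inz z a w" "inr z a (f' w)" using fw(1) by (auto simp: alw_def)
    obtain b where b: "b < Q" "inz z b w'" "inr z b (f' w')" using fw(2) by (auto simp: alw_def)
    have r: "inr z i (f' w)" "inr z i' (f' w')"
      using a b good_z[OF g a(1) i(1) a(2) i(2)] good_z[OF g b(1) i'(1) b(2) i'(2)] by simp_all
    show ?thesis
    proof (rule ccontr)
      assume c: "\<not> ?thesis"
      \<comment> \<open>Letter ranges are intervals. If \<open>?b < ?a\<close>, then either
        \<open>f' w'\<close> is at least \<open>?a\<close>, which puts \<open>?a\<close> into the
        second range, or it lies between \<open>f' w\<close> and \<open>?a\<close>, hence in the
        first range. A common letter makes the zones equal, and then \<open>?b\<close> contradicts
        the minimality of \<open>?a\<close>.\<close>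
      have "inr z i' ?a \<or> inr z i ?b \<or> inr z i (f' w')"
        using r fw(3) c i(3) i'(3) by (auto simp: inr_def)
      moreover have "f' w' < k" "cp (f' w') \<in> S" using fw(2) by (simp_all add: alw_def)
      ultimately have "i = i'"
        using good_r[OF g i(1) i'(1) i(2) i'(2)] i i' r by blast
      then have "alw S z w ?b" using i i' by (auto simp: alw_def)
      then show False using c Least_le[of "alw S z w"] by auto
    qed
  qed
  show ?thesis unfolding valid_def using A M by simp
qed

text \<open>The blocks are the maximal intervals on which the old homomorphism is constant, cut at the
  ends of the new edge. Letters that can be shared by two blocks belong to a copy in \<open>A\<close>;
  so once the copies in \<open>A\<close> are removed, the remaining zones are again good.\<close>

context
  fixes j S z f f' u v
  assumes g: "good S z" and f: "valid j S z f" and f': "valid (Suc j) S z f'"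
    and u: "u < n" and v: "v < n" and j: "j = u * n + v"
begin

definition blk :: "nat \<Rightarrow> nat \<times> nat" where "blk w = (f w, part u v w)"
definition X :: "nat set" where "X = {w. w < n \<and> dom z w}"
text \<open>The bounds are read off the sought \<open>f'\<close>. The algorithm can only guess them,
  and the point of what follows is that this particular guess succeeds.\<close>

definition LO :: "nat \<Rightarrow> nat \<Rightarrow> nat" where "LO y p = Min (f' ` {w \<in> X. blk w = (y, p)})"
definition HI :: "nat \<Rightarrow> nat \<Rightarrow> nat" where "HI y p = Max (f' ` {w \<in> X. blk w = (y, p)})"

lemma finX: "finite X" by (simp add: X_def)

lemma LO_le: "w \<in> X \<Longrightarrow> LO (f w) (part u v w) \<le> f' w"
  unfolding LO_def blk_def by (rule Min_le) (auto simp: finX)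
lemma HI_ge: "w \<in> X \<Longrightarrow> f' w \<le> HI (f w) (part u v w)"
  unfolding HI_def blk_def by (rule Max_ge) (auto simp: finX)
lemma LO_in: assumes "w \<in> X" obtains w' where "w' \<in> X" "blk w' = blk w" "f' w' = LO (f w) (part u v w)"
proof -
  have "LO (f w) (part u v w) \<in> f' ` {w' \<in> X. blk w' = blk w}"
    unfolding LO_def blk_def using assms by (intro Min_in) (auto simp: finX)
  then show ?thesis using that by auto
qed
lemma HI_in: assumes "w \<in> X" obtains w' where "w' \<in> X" "blk w' = blk w" "f' w' = HI (f w) (part u v w)"
proof -
  have "HI (f w) (part u v w) \<in> f' ` {w' \<in> X. blk w' = blk w}"
    unfolding HI_def blk_def using assms by (intro Max_in) (auto simp: finX)
  then show ?thesis using that by auto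
qed

lemma f_mono: "w \<in> X \<Longrightarrow> w' \<in> X \<Longrightarrow> w \<le> w' \<Longrightarrow> f w \<le> f w'" using f by (auto simp: valid_def X_def)
lemma f'_mono: "w \<in> X \<Longrightarrow> w' \<in> X \<Longrightarrow> w \<le> w' \<Longrightarrow> f' w \<le> f' w'" using f' by (auto simp: valid_def X_def)
lemma f_alw: "w \<in> X \<Longrightarrow> alw S z w (f w)" using f by (auto simp: valid_def X_def)
lemma f'_alw: "w \<in> X \<Longrightarrow> alw S z w (f' w)" using f' by (auto simp: valid_def X_def)

lemma f_edge: "w \<in> X \<Longrightarrow> w' \<in> X \<Longrightarrow> eG w w' \<Longrightarrow> w*n+w' < j \<Longrightarrow> eH (f w) (f w')"
  using f unfolding valid_def X_def by blast
lemma f'_edge: "w \<in> X \<Longrightarrow> w' \<in> X \<Longrightarrow> eG w w' \<Longrightarrow> w*n+w' < Suc j \<Longrightarrow> eH (f' w) (f' w')"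
  using f' unfolding valid_def X_def by blast
lemma okP_D:
  assumes "okP j S z f u v lo hi s g" "w \<in> X" "cp (f w) = s"
  shows "alw S z w (g w)" "lo (f w) (part u v w) \<le> g w" "g w \<le> hi (f w) (part u v w)"
    "\<And>w'. w' \<in> X \<Longrightarrow> cp (f w') = s \<Longrightarrow> w \<le> w' \<Longrightarrow> g w \<le> g w'"
    "\<And>w'. w' \<in> X \<Longrightarrow> cp (f w') = s \<Longrightarrow> eG w w' \<Longrightarrow> w*n+w' < j \<Longrightarrow> eH (g w) (g w')"
proof -
  have w: "w < n" "dom z w \<and> cp (f w) = s" using assms by (simp_all add: X_def)
  note * = assms(1)[unfolded okP_def, rule_format, OF w]
  show "alw S z w (g w)" "lo (f w) (part u v w) \<le> g w" "g w \<le> hi (f w) (part u v w)"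
    using * by iprover+
  fix w' assume "w' \<in> X" "cp (f w') = s"
  then have w': "w' < n" "dom z w' \<and> cp (f w') = s" by (simp_all add: X_def)
  show "w \<le> w' \<Longrightarrow> g w \<le> g w'" "eG w w' \<Longrightarrow> w*n+w' < j \<Longrightarrow> eH (g w) (g w')"
    using conjunct2[OF conjunct2[OF conjunct2[OF *]], rule_format, OF w'] by iprover+
qed

text \<open>A common value of \<open>f\<close> lies in the letter ranges of both zones, and
  different zones of a good instance share no letter.\<close>

lemma same_zone:
  assumes "w \<in> X" "w' \<in> X" "f w = f w'" "i < Q" "inz z i w"
  shows "inz z i w'"
proof -
  obtain a where a: "a < Q" "inz z a w" "inr z a (f w)" "f w < k" "cp (f w) \<in> S"
    using f_alw[OF assms(1)] by (auto simp: alw_def)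
  then have "inr z i (f w)" using good_z[OF g a(1) assms(4) a(2) assms(5)] by simp
  moreover obtain i' where "i' < Q" "inz z i' w'" "inr z i' (f w')" using f_alw[OF assms(2)] by (auto simp: alw_def)
  ultimately have "i = i'" using good_r[OF g assms(4) _ assms(5) _ a(4,5)] assms(3) by simp
  then show ?thesis using \<open>inz z i' w'\<close> by simp
qed

text \<open>By \<open>same_zone\<close> both ends lie in one zone, so nothing between them is
  outside the domain; monotonicity of \<open>f\<close> and of \<open>part\<close> then squeezes both
  components of \<open>blk\<close>.\<close>

lemma block_interval:
  assumes "w1 \<in> X" "w2 \<in> X" "blk w1 = blk w2" "w1 \<le> w" "w \<le> w2"
  shows "w \<in> X" "blk w = blk w1"
proof -
  obtain i where i: "i < Q" "inz z i w1" using assms(1) by (auto simp: X_def dom_def)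
  have eq: "f w1 = f w2" "part u v w1 = part u v w2" using assms(3) by (simp_all add: blk_def)
  have "inz z i w2" by (rule same_zone[OF assms(1,2) eq(1) i])
  then have "inz z i w" "w < n" using i assms(2,4,5) by (auto simp: inz_def X_def)
  then show wX: "w \<in> X" using i(1) by (auto simp: X_def dom_def)
  have "f w1 \<le> f w" "f w \<le> f w2" using f_mono[OF assms(1) wX assms(4)] f_mono[OF wX assms(2,5)] .
  moreover have "part u v w1 \<le> part u v w" "part u v w \<le> part u v w2"
    using part_mono[OF assms(4)] part_mono[OF assms(5)] .
  ultimately show "blk w = blk w1" using eq by (simp add: blk_def)
qed

text \<open>Blocks are intervals, so the earlier one lies entirely to the left and \<open>f'\<close>
  is monotone. Respecting these bounds is all that different subproblems need in order to fit
  together.\<close>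

lemma blocks_sep:
  assumes "w \<in> X" "w' \<in> X" "w \<le> w'" "blk w \<noteq> blk w'"
  shows "HI (f w) (part u v w) \<le> LO (f w') (part u v w')"
proof -
  obtain a where a: "a \<in> X" "blk a = blk w" "f' a = HI (f w) (part u v w)" by (rule HI_in[OF assms(1)])
  obtain b where b: "b \<in> X" "blk b = blk w'" "f' b = LO (f w') (part u v w')" by (rule LO_in[OF assms(2)])
  have "a \<le> b"
  proof (rule ccontr)
    assume "\<not> a \<le> b"
    show False
    proof (cases "w' \<le> a")
      case True then show False using block_interval(2)[OF assms(1) a(1) a(2)[symmetric] assms(3) True] assms(4) by simp
    next
      case False
      then have l: "b \<le> a" "a \<le> w'" using \<open>\<not> a \<le> b\<close> by simp_all
      show False using block_interval(2)[OF b(1) assms(2) b(2) l] a(2) b(2) assms(4) by simp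
    qed
  qed
  then show ?thesis using f'_mono[OF a(1) b(1)] a(3) b(3) by simp
qed

text \<open>Order within a block concerns a single subproblem, order between blocks follows from
  \<open>blocks_sep\<close>. An old edge joins positions whose old letters are adjacent, hence in
  one copy, so it too lies within one subproblem.\<close>

lemma combine:
  assumes G: "\<And>s. s \<in> S \<Longrightarrow> okP j S z f u v LO HI s (G s)"
  shows "valid (Suc j) S z (\<lambda>w. G (cp (f w)) w)"
proof -
  have cS: "cp (f w) \<in> S" if "w \<in> X" for w using f_alw[OF that] by (simp add: alw_def)
  have ok: "alw S z w (G (cp (f w)) w)" "LO (f w) (part u v w) \<le> G (cp (f w)) w"
      "G (cp (f w)) w \<le> HI (f w) (part u v w)" if "w \<in> X" for w
    using okP_D[OF G[OF cS[OF that]] that] by simp_all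
  have ok2: "w \<le> w' \<Longrightarrow> G (cp (f w)) w \<le> G (cp (f w)) w'"
     "eG w w' \<Longrightarrow> w*n+w' < j \<Longrightarrow> eH (G (cp (f w)) w) (G (cp (f w)) w')"
    if "w \<in> X" "w' \<in> X" "cp (f w) = cp (f w')" for w w'
    using okP_D(4,5)[OF G[OF cS[OF that(1)]] that(1) refl that(2) that(3)[symmetric]] by simp_all
  \<comment> \<open>An end of the new edge is alone in its block, so its two bounds coincide with
    the value of \<open>f'\<close>; hence the new edge is respected because \<open>f'\<close>
    respects it.\<close>
  have pinned: "G (cp (f w)) w = f' w" if "w \<in> X" "w = u \<or> w = v" for w
  proof -
    have "blk w' = blk w \<Longrightarrow> w' = w" for w' using that part_u part_v unfolding blk_def by blast
    then have "LO (f w) (part u v w) = f' w" "HI (f w) (part u v w) = f' w"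
      by (metis LO_in[OF that(1)], metis HI_in[OF that(1)])
    then show ?thesis using ok[OF that(1)] by auto
  qed
  have M: "G (cp (f w)) w \<le> G (cp (f w')) w'" if w: "w \<in> X" "w' \<in> X" "w \<le> w'" for w w'
  proof (cases "blk w = blk w'")
    case True then show ?thesis using ok2(1)[OF w(1,2)] w by (auto simp: blk_def)
  next
    case False then show ?thesis using blocks_sep[OF w False] ok(3)[OF w(1)] ok(2)[OF w(2)] by linarith
  qed
  have E: "eH (G (cp (f w)) w) (G (cp (f w')) w')"
    if w: "w \<in> X" "w' \<in> X" and e: "eG w w'" "w*n+w' < Suc j" for w w'
  proof (cases "w*n+w' = j")
    case True
    have "w' < n" "n > 0" using w by (auto simp: X_def)
    then have "(w*n+w') div n = w" "(w*n+w') mod n = w'" by auto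
    moreover have "(u*n+v) div n = u" "(u*n+v) mod n = v" using u v by auto
    ultimately have "w = u" "w' = v" using True j by simp_all
    then show ?thesis using pinned[OF w(1)] pinned[OF w(2)] f'_edge[OF w e] by simp
  next
    case False
    then have l: "w*n+w' < j" using e by auto
    then have "eH (f w) (f w')" using f_edge w e by blast
    moreover have "f w < k" "f w' < k" using f_alw[OF w(1)] f_alw[OF w(2)] by (simp_all add: alw_def)
    ultimately have "cp (f w) = cp (f w')" using cross by blast
    then show ?thesis using ok2(2)[OF w _ e(1) l] by auto
  qed
  show ?thesis unfolding valid_def using ok(1) M E by (simp add: X_def)
qed

text \<open>For each pair of a block and a letter \<open>a\<close> of \<open>AL\<close> there is a
  guessed interval, where \<open>f'\<close> equals \<open>a\<close>, and a zone, where
  \<open>f'\<close> lies strictly between \<open>a\<close> and the next letter of \<open>AL\<close>.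
  Any solution on the zones stays in the same gaps as \<open>f'\<close>, so it compares with the
  letters of \<open>AL\<close> exactly as \<open>f'\<close> does, and merging preserves order and
  bounds.\<close>

lemma split:
  assumes s: "s \<in> S"
  obtains S' z' c where "S' \<subset> S" "good S' z'" "valid j S' z' f'"
    "\<And>x. z' x \<le> n + k" "\<And>x. c x \<le> n + k"
    "\<And>g. valid j S' z' g \<Longrightarrow> okP j S z f u v LO HI s (merge Q c g)"
proof -
  define Xs where "Xs = {w \<in> X. cp (f w) = s}"
  define Bs where "Bs = blk ` Xs"
  \<comment> \<open>The element \<open>s\<close> makes \<open>S - A\<close> strictly smaller. The
    copies of the bounds put every \<open>LO\<close> and \<open>HI\<close> into \<open>AL\<close>,
    so that no gap between letters of \<open>AL\<close> reaches past the end of a block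
    range.\<close>
  define A where "A = insert s ((\<lambda>(y,p). cp (LO y p)) ` Bs \<union> (\<lambda>(y,p). cp (HI y p)) ` Bs)"
  define AL where "AL = {h. h < k \<and> cp h \<in> A}"
  define I where "I = Bs \<times> AL"
  have finXs: "finite Xs" using finX by (auto simp: Xs_def)
  have XsX: "w \<in> X" if "w \<in> Xs" for w using that by (auto simp: Xs_def)
  have finBs: "finite Bs" using finXs by (auto simp: Bs_def)
  have "Bs \<subseteq> {h. h < k \<and> cp h = s} \<times> {..<5}"
    using f_alw part_le by (auto simp: Bs_def Xs_def blk_def alw_def)
  then have "card Bs \<le> card ({h. h < k \<and> cp h = s} \<times> {..<5::nat})" by (intro card_mono) auto
  then have cB: "card Bs \<le> 5 * m" using copy_size[of s] by (simp add: card_cartesian_product)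
  have "card A \<le> Suc (card ((\<lambda>(y,p). cp (LO y p)) ` Bs \<union> (\<lambda>(y,p). cp (HI y p)) ` Bs))"
    unfolding A_def by (rule card_insert_le_m1) auto
  also have "\<dots> \<le> Suc (card ((\<lambda>(y,p). cp (LO y p)) ` Bs) + card ((\<lambda>(y,p). cp (HI y p)) ` Bs))"
    using card_Un_le by auto
  also have "\<dots> \<le> Suc (card Bs + card Bs)" using card_image_le[OF finBs] by (meson Suc_le_mono add_mono)
  finally have cA: "card A \<le> 1 + 10 * m" using cB by simp
  have finA: "finite A" using finBs by (auto simp: A_def)
  have "AL = (\<Union>s\<in>A. {h. h < k \<and> cp h = s})" by (auto simp: AL_def)
  then have "card AL \<le> (\<Sum>s\<in>A. card {h. h < k \<and> cp h = s})" using card_UN_le[OF finA] by metis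
  also have "\<dots> \<le> card A * m" using sum_bounded_above[of A "\<lambda>s. card {h. h < k \<and> cp h = s}" m] copy_size by simp
  also have "\<dots> \<le> (1 + 10 * m) * m" by (rule mult_le_mono1[OF cA])
  finally have cAL: "card AL \<le> (1 + 10 * m) * m" .
  have finAL: "finite AL" by (auto simp: AL_def)
  have "card I \<le> Q" unfolding I_def card_cartesian_product using mult_le_mono[OF cB cAL] Q by linarith
  moreover obtain e where e: "bij_betw e {..<card I} I"
    using ex_bij_betw_nat_finite[of I] finBs finAL by (auto simp: I_def lessThan_atLeast0)
  ultimately have IQ: "i < card I \<Longrightarrow> i < Q" for i by simp
  have e_in: "e i \<in> I" if "i < card I" for i using e that by (auto simp: bij_betw_def)
  have e_AL: "snd (e i) \<in> AL" if "i < card I" for i using e_in[OF that] by (auto simp: I_def)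
  have e_inj: "i = i'" if "i < card I" "i' < card I" "e i = e i'" for i i'
    using e that by (auto simp: bij_betw_def inj_on_def)
  have e_ex: "\<exists>i<card I. e i = x" if "x \<in> I" for x
  proof -
    have "x \<in> e ` {..<card I}" using e that by (simp add: bij_betw_def)
    then show ?thesis by blast
  qed

  \<comment> \<open>An index \<open>x\<close> is a pair of a block and a letter of
    \<open>AL\<close>; \<open>C x\<close> becomes a guessed interval and \<open>W x\<close> the
    positions of a zone.\<close>
  define C where "C x = {w \<in> Xs. blk w = fst x \<and> f' w = snd x}" for x
  define W where "W x = {w \<in> Xs. blk w = fst x \<and> snd x < f' w \<and> cp (f' w) \<notin> A \<and>
      (\<forall>h\<in>AL. \<not> (snd x < h \<and> h < f' w))}" for x
  \<comment> \<open>The default 0 makes the letter range empty when no letter of \<open>AL\<close>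
    follows. Then the zone has no positions either, since each position of a zone has its
    \<open>HI\<close> in \<open>AL\<close> above.\<close>
  define nx where "nx h = (if \<exists>h'\<in>AL. h < h' then (LEAST h'. h' \<in> AL \<and> h < h') - 1 else 0)" for h
  define c where "c x = (let i = x div 3 in if i < card I then
      (if x mod 3 = 0 then lft (C (e i)) else if x mod 3 = 1 then rgt (C (e i)) else snd (e i)) else 0)" for x
  define z' where "z' x = (let i = x div 4 in if i < card I then
      (if x mod 4 = 0 then lft (W (e i)) else if x mod 4 = 1 then rgt (W (e i))
       else if x mod 4 = 2 then Suc (snd (e i)) else nx (snd (e i))) else 0)" for x
  define S' where "S' = S - A"

  have Xs_int: "w \<in> Xs" "blk w = blk a" "f' a \<le> f' w" "f' w \<le> f' b"
    if "a \<in> Xs" "b \<in> Xs" "blk a = blk b" "a \<le> w" "w \<le> b" for a b w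
  proof -
    have *: "w \<in> X" "blk w = blk a" using block_interval[of a b w] that XsX by auto
    then show "w \<in> Xs" "blk w = blk a" using that by (auto simp: Xs_def blk_def)
    show "f' a \<le> f' w" "f' w \<le> f' b" using f'_mono * that XsX by auto
  qed
  have Cconv: "lft (C x) \<le> w \<and> w < rgt (C x) \<longleftrightarrow> w \<in> C x" for x w
  proof (rule convex_iff)
    show "finite (C x)" using finXs by (auto simp: C_def)
    fix a b w assume "a \<in> C x" "b \<in> C x" "a \<le> w" "w \<le> b"
    then show "w \<in> C x" using Xs_int[of a b w] by (auto simp: C_def)
  qed
  have f'k: "f' w < k" "cp (f' w) \<in> S" if "w \<in> Xs" for w using f'_alw[OF XsX[OF that]] by (auto simp: alw_def)
  have Wconv: "lft (W x) \<le> w \<and> w < rgt (W x) \<longleftrightarrow> w \<in> W x" for x w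
  proof (rule convex_iff)
    show "finite (W x)" using finXs by (auto simp: W_def)
    fix a b w assume w: "a \<in> W x" "b \<in> W x" "a \<le> w" "w \<le> b"
    have i: "w \<in> Xs" "blk w = blk a" "f' a \<le> f' w" "f' w \<le> f' b"
      using Xs_int[of a b w] w by (auto simp: W_def)
    have "f' w \<notin> AL" using w i by (cases "f' w = f' b") (auto simp: W_def AL_def)
    then have "cp (f' w) \<notin> A" using f'k[OF i(1)] by (auto simp: AL_def)
    then show "w \<in> W x" using i w unfolding W_def by auto
  qed
  have d3: "Suc (3*i) div 3 = i" "Suc (3*i) mod 3 = 1" "Suc (Suc (3*i)) div 3 = i" "Suc (Suc (3*i)) mod 3 = 2" for i :: nat
    by presburger+
  have d4: "Suc (4*i) div 4 = i" "Suc (4*i) mod 4 = 1" "Suc (Suc (4*i)) div 4 = i" "Suc (Suc (4*i)) mod 4 = 2"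
    "(4*i+3) div 4 = i" "(4*i+3) mod 4 = 3" for i :: nat
    by presburger+
  have cell: "c (3*i) \<le> w \<and> w < c (3*i+1) \<longleftrightarrow> i < card I \<and> w \<in> C (e i)" for i w
    using Cconv[of "e i" w] by (auto simp: c_def Let_def d3)
  have zone: "inz z' i w \<longleftrightarrow> i < card I \<and> w \<in> W (e i)" for i w
    using Wconv[of "e i" w] by (auto simp: z'_def inz_def Let_def d4)
  have range: "inr z' i h \<longleftrightarrow> snd (e i) < h \<and> h \<le> nx (snd (e i))" if "i < card I" for i h
    using that by (auto simp: z'_def inr_def Let_def d4)
  have nx: "h \<le> nx a \<longleftrightarrow> (\<forall>h'\<in>AL. \<not> (a < h' \<and> h' \<le> h))" if "h'' \<in> AL" "a < h''" "a < h" for h h'' a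
  proof -
    have ex: "\<exists>h'. h' \<in> AL \<and> a < h'" using that by blast
    then have L: "(LEAST h'. h' \<in> AL \<and> a < h') \<in> AL" "a < (LEAST h'. h' \<in> AL \<and> a < h')"
      using LeastI_ex[OF ex] by auto
    have L2: "h' \<in> AL \<Longrightarrow> a < h' \<Longrightarrow> (LEAST h'. h' \<in> AL \<and> a < h') \<le> h'" for h'
      using Least_le[of "\<lambda>h'. h' \<in> AL \<and> a < h'" h'] by auto
    have e: "nx a = (LEAST h'. h' \<in> AL \<and> a < h') - 1" using ex by (auto simp: nx_def)
    show ?thesis
    proof
      assume "h \<le> nx a" then show "\<forall>h'\<in>AL. \<not> (a < h' \<and> h' \<le> h)" using e L L2 by fastforce
    next
      assume "\<forall>h'\<in>AL. \<not> (a < h' \<and> h' \<le> h)"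
      then have "\<not> (LEAST h'. h' \<in> AL \<and> a < h') \<le> h" using L by blast
      then show "h \<le> nx a" using e by linarith
    qed
  qed
  have ends: "LO y p \<in> AL" "HI y p \<in> AL" if "(y,p) \<in> Bs" for y p
  proof -
    obtain w where w: "w \<in> Xs" "y = f w" "p = part u v w" using \<open>(y,p) \<in> Bs\<close> by (auto simp: Bs_def blk_def)
    have "LO y p < k" "HI y p < k"
      using LO_in[OF XsX[OF w(1)]] HI_in[OF XsX[OF w(1)]] f'_alw w unfolding alw_def by metis+
    moreover have "cp (LO y p) \<in> A" "cp (HI y p) \<in> A"
      using that by (auto simp: A_def intro!: image_eqI[of _ _ "(y,p)"])
    ultimately show "LO y p \<in> AL" "HI y p \<in> AL" by (auto simp: AL_def)
  qed
  \<comment> \<open>A block with a position in a gap reaches across it: its \<open>HI\<close> lies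
    above the gap and, by \<open>W_lo\<close> below, its \<open>LO\<close> lies at or under the
    lower end.\<close>
  have W_up: "HI (f w) (part u v w) \<in> AL" "snd x < HI (f w) (part u v w)" if "w \<in> W x" for w x
  proof -
    have "w \<in> Xs" using that by (auto simp: W_def)
    then show "HI (f w) (part u v w) \<in> AL" using ends[of "f w" "part u v w"] by (auto simp: Bs_def blk_def)
    show "snd x < HI (f w) (part u v w)" using HI_ge[OF XsX[OF \<open>w \<in> Xs\<close>]] that by (auto simp: W_def)
  qed
  have Bs_I: "(f w, part u v w) \<in> Bs" if "w \<in> Xs" for w
    unfolding Bs_def using imageI[OF that, of blk] by (simp add: blk_def)
  have W_lo: "LO (f w) (part u v w) \<le> snd x" if "w \<in> W x" for w x
  proof -
    have w: "w \<in> Xs" "cp (f' w) \<notin> A" "\<forall>h\<in>AL. \<not> (snd x < h \<and> h < f' w)" using that by (simp_all add: W_def)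
    have l: "LO (f w) (part u v w) \<in> AL" by (rule ends(1)[OF Bs_I[OF w(1)]])
    then have "LO (f w) (part u v w) \<noteq> f' w" using w(2) by (auto simp: AL_def)
    then have "LO (f w) (part u v w) < f' w" using LO_le[OF XsX[OF w(1)]] by simp
    then show ?thesis using w(3) l by (meson not_le_imp_less)
  qed
  have W_f': "snd x < f' w" "f' w \<le> nx (snd x)" if "w \<in> W x" for w x
  proof -
    show "snd x < f' w" using that by (auto simp: W_def)
    then have "f' w \<le> nx (snd x) \<longleftrightarrow> (\<forall>h'\<in>AL. \<not> (snd x < h' \<and> h' \<le> f' w))" using nx W_up[OF that] by blast
    moreover have "f' w \<notin> AL" using that by (auto simp: W_def AL_def)
    ultimately show "f' w \<le> nx (snd x)" using that unfolding W_def by (metis (mono_tags, lifting) mem_Collect_eq nat_less_le)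
  qed
  have Wex: "\<exists>i<card I. w \<in> W (e i)" if w: "w \<in> Xs" "cp (f' w) \<notin> A" for w
  proof -
    \<comment> \<open>The zone of \<open>w\<close> starts at the last letter of \<open>AL\<close>
      below \<open>f' w\<close>; one exists because the \<open>LO\<close> of its block is such a
      letter.\<close>
    let ?a = "Max {h \<in> AL. h < f' w}"
    have b: "blk w \<in> Bs" using w by (auto simp: Bs_def)
    have "LO (f w) (part u v w) \<in> AL" using ends b by (auto simp: blk_def)
    moreover have "LO (f w) (part u v w) \<le> f' w" using LO_le[OF XsX[OF w(1)]] .
    moreover have "f' w \<notin> AL" using w by (auto simp: AL_def)
    ultimately have "LO (f w) (part u v w) \<in> {h \<in> AL. h < f' w}" by (auto simp: less_le)
    then have "?a \<in> {h \<in> AL. h < f' w}" using finAL by (intro Max_in) auto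
    moreover have "h \<le> ?a" if "h \<in> AL" "h < f' w" for h using that finAL by (intro Max_ge) auto
    ultimately have "w \<in> W (blk w, ?a)" using w unfolding W_def by (auto simp: not_less)
    moreover have "(blk w, ?a) \<in> I" using \<open>?a \<in> {h \<in> AL. h < f' w}\<close> b by (auto simp: I_def)
    ultimately show ?thesis using e_ex by metis
  qed
  have Cex: "\<exists>i<card I. w \<in> C (e i)" if w: "w \<in> Xs" "cp (f' w) \<in> A" for w
  proof -
    have "(blk w, f' w) \<in> I" using w f'k by (auto simp: I_def Bs_def AL_def)
    then show ?thesis using e_ex w unfolding C_def by fastforce
  qed
  have mer: "merge Q c g w = (if cp (f' w) \<in> A then f' w else g w)" if w: "w \<in> Xs" for g w
  proof -
    have C: "i < Q \<and> c (3*i) \<le> w \<and> w < c (3*i+1) \<longleftrightarrow> i < card I \<and> w \<in> C (e i)" for i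
      using cell IQ by blast
    have CA: "cp (f' w) \<in> A" if "i < card I" "w \<in> C (e i)" for i
      using that e_in[OF that(1)] by (auto simp: C_def I_def AL_def)
    show ?thesis
    proof (cases "cp (f' w) \<in> A")
      case True
      let ?i = "LEAST i. i < card I \<and> w \<in> C (e i)"
      have "?i < card I \<and> w \<in> C (e ?i)" using Cex[OF w True] by (metis (mono_tags, lifting) LeastI_ex)
      then have "c (3 * ?i + 2) = f' w" by (auto simp: c_def C_def Let_def d3)
      then show ?thesis using True Cex[OF w True] C unfolding merge_def by auto
    next
      case False
      then have "\<not> (\<exists>i<Q. c (3*i) \<le> w \<and> w < c (3*i+1))" using C CA by blast
      then show ?thesis using False unfolding merge_def by (simp only: if_False)
    qed
  qed
  have dom': "dom z' w \<longleftrightarrow> w \<in> Xs \<and> cp (f' w) \<notin> A" for w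
  proof
    assume "dom z' w" then show "w \<in> Xs \<and> cp (f' w) \<notin> A" using zone by (auto simp: dom_def W_def)
  next
    assume "w \<in> Xs \<and> cp (f' w) \<notin> A"
    then show "dom z' w" using Wex[of w] zone IQ unfolding dom_def by (auto simp: Xs_def X_def)
  qed
  have sub: "S' \<subset> S" using s by (auto simp: S'_def A_def)
  have alw': "alw S' z' w (f' w)" if w: "w \<in> Xs" "cp (f' w) \<notin> A" for w
  proof -
    obtain i where "i < card I" "w \<in> W (e i)" using Wex[OF w] by blast
    then show ?thesis using f'k[OF w(1)] w zone range W_f'[of w "e i"] IQ
      unfolding alw_def S'_def by blast
  qed
  have f'_edge: "eH (f' w) (f' w')" if "w \<in> Xs" "w' \<in> Xs" "eG w w'" "w*n+w' < j" for w w'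
    using f'_edge[OF XsX XsX] that by simp
  \<comment> \<open>The map \<open>f'\<close> itself solves the smaller instance, which is what the
    induction on the set of copies needs.\<close>
  have v': "valid j S' z' f'"
    unfolding valid_def dom' using alw' f'_edge f'_mono XsX by blast
  \<comment> \<open>A common letter forces both gaps to start at the same letter of
    \<open>AL\<close>. Two different blocks cannot share a gap: the left one would have its
    \<open>HI\<close> above a letter which is at least the \<open>LO\<close> of the right
    one.\<close>
  have W_sep: "x = x'" if "w \<in> W x" "w' \<in> W x'" "snd x < h" "h \<le> nx (snd x)" "snd x' < h" "h \<le> nx (snd x')"
      "snd x \<in> AL" "snd x' \<in> AL" for w w' x x' h
  proof -
    have "snd x \<le> snd x'" using nx[OF W_up[OF that(2)] that(5)] that by (meson not_le_imp_less less_imp_le)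
    moreover have "snd x' \<le> snd x" using nx[OF W_up[OF that(1)] that(3)] that by (meson not_le_imp_less less_imp_le)
    ultimately have eq: "snd x = snd x'" by simp
    have w: "w \<in> Xs" "w' \<in> Xs" "blk w = fst x" "blk w' = fst x'" using that by (auto simp: W_def)
    have "blk w = blk w'"
    proof (rule ccontr)
      assume ne: "blk w \<noteq> blk w'"
      have lo: "LO (f w) (part u v w) \<le> snd x" "LO (f w') (part u v w') \<le> snd x"
        using W_lo[OF that(1)] W_lo[OF that(2)] eq by simp_all
      show False
      proof (cases "w \<le> w'")
        case True
        then show False using blocks_sep[OF XsX[OF w(1)] XsX[OF w(2)] True ne] lo(2) W_up(2)[OF that(1)] by linarith
      next
        case False
        then show False using blocks_sep[OF XsX[OF w(2)] XsX[OF w(1)]] ne lo(1) W_up(2)[OF that(2)] eq by simp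
      qed
    qed
    then show ?thesis using eq w by (simp add: prod_eq_iff)
  qed
  have good': "good S' z'" unfolding good_def
  proof (intro allI impI conjI)
    fix i i' h assume a: "i < Q" "i' < Q" "z' (4*i) < z' (4*i+1)" "z' (4*i') < z' (4*i'+1)" "h < k" "cp h \<in> S'"
      "inr z' i h" "inr z' i' h"
    have "inz z' i (z' (4*i))" "inz z' i' (z' (4*i'))" using a by (auto simp: inz_def)
    then have b: "i < card I" "i' < card I" "z' (4*i) \<in> W (e i)" "z' (4*i') \<in> W (e i')" using zone by auto
    have "snd (e i) \<in> AL" "snd (e i') \<in> AL" using e_AL b by blast+
    then have "e i = e i'" using W_sep[OF b(3,4)] a range b by blast
    then show "i = i'" using e_inj b by blast
  next
    fix i i' w assume a: "i < Q" "i' < Q" "inz z' i w" "inz z' i' w"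
    then have b: "i < card I" "i' < card I" "w \<in> W (e i)" "w \<in> W (e i')" using zone by auto
    have "snd (e i) \<in> AL" "snd (e i') \<in> AL" using e_AL b by blast+
    then have "e i = e i'" using W_sep[OF b(3,4), of "f' w"] W_f' b by blast
    then show "i = i'" using e_inj b by blast
  qed
  have C_le: "C x \<subseteq> {..<n}" "W x \<subseteq> {..<n}" for x by (auto simp: C_def W_def Xs_def X_def)
  have sndk: "snd (e i) < k" if "i < card I" for i using e_in[OF that] by (auto simp: I_def AL_def)
  have nxk: "nx h \<le> k" for h
  proof (cases "\<exists>h'\<in>AL. h < h'")
    case True
    then have "(LEAST h'. h' \<in> AL \<and> h < h') \<in> AL" by (metis (mono_tags, lifting) LeastI_ex)
    then show ?thesis by (auto simp: nx_def AL_def)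
  qed (simp add: nx_def)
  have zb: "z' x \<le> n + k" for x
  proof (cases "x div 4 < card I")
    case True
    let ?e = "e (x div 4)"
    have "z' x = lft (W ?e) \<or> z' x = rgt (W ?e) \<or> z' x = Suc (snd ?e) \<or> z' x = nx (snd ?e)"
      using True by (simp add: z'_def Let_def)
    moreover have "lft (W ?e) \<le> n" "rgt (W ?e) \<le> n" using lft_rgt_le[OF C_le(2)] by auto
    moreover have "Suc (snd ?e) \<le> k" "nx (snd ?e) \<le> k" using sndk[OF True] nxk by auto
    ultimately show ?thesis by linarith
  qed (simp add: z'_def)
  have cb: "c x \<le> n + k" for x
  proof (cases "x div 3 < card I")
    case True
    let ?e = "e (x div 3)"
    have "c x = lft (C ?e) \<or> c x = rgt (C ?e) \<or> c x = snd ?e"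
      using True by (simp add: c_def Let_def)
    moreover have "lft (C ?e) \<le> n" "rgt (C ?e) \<le> n" using lft_rgt_le[OF C_le(1)] by auto
    moreover have "snd ?e \<le> k" using sndk[OF True] by auto
    ultimately show ?thesis by linarith
  qed (simp add: c_def)
  have okp: "okP j S z f u v LO HI s (merge Q c g)" if vg: "valid j S' z' g" for g
  proof -
    let ?G = "\<lambda>w. if cp (f' w) \<in> A then f' w else g w"
    have gw: "g w < k" "cp (g w) \<in> S" "cp (g w) \<notin> A" "\<exists>x. w \<in> W x \<and> snd x \<in> AL \<and> snd x < g w \<and> g w \<le> nx (snd x)"
      if "w \<in> Xs" "cp (f' w) \<notin> A" for w
    proof -
      have "alw S' z' w (g w)" using vg dom' that unfolding valid_def by (auto simp: Xs_def X_def)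
      then show "g w < k" "cp (g w) \<in> S" "cp (g w) \<notin> A" "\<exists>x. w \<in> W x \<and> snd x \<in> AL \<and> snd x < g w \<and> g w \<le> nx (snd x)"
        using zone range e_AL unfolding alw_def S'_def by blast+
    qed
    \<comment> \<open>No letter of \<open>AL\<close> separates \<open>g w\<close> from
      \<open>f' w\<close>, since both lie in one gap.\<close>
    have low: "h \<le> ?G w" if w: "w \<in> Xs" "h \<in> AL" "h \<le> f' w" for w h
    proof (cases "cp (f' w) \<in> A")
      case False
      then obtain x where x: "w \<in> W x" "snd x < g w" using gw w by blast
      have "h \<noteq> f' w" using False w by (auto simp: AL_def)
      then have "h \<le> snd x" using x w by (auto simp: W_def not_less)
      then show ?thesis using x False by simp
    qed (use w in simp)
    have upp: "?G w \<le> h" if w: "w \<in> Xs" "h \<in> AL" "f' w \<le> h" for w h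
    proof (cases "cp (f' w) \<in> A")
      case False
      then obtain x where x: "w \<in> W x" "snd x < g w" "g w \<le> nx (snd x)" using gw w by blast
      have "snd x < h" using x w by (auto simp: W_def)
      then have "\<not> h \<le> g w" using nx[OF w(2) _ x(2)] x w by blast
      then show ?thesis using False by simp
    qed (use w in simp)
    have ends': "LO (f w) (part u v w) \<in> AL" "HI (f w) (part u v w) \<in> AL" if "w \<in> Xs" for w
      using ends[OF Bs_I[OF that]] by simp_all
    have al: "alw S z w (?G w) \<and> LO (f w) (part u v w) \<le> ?G w \<and> ?G w \<le> HI (f w) (part u v w)" if w: "w \<in> Xs" for w
    proof -
      have b: "LO (f w) (part u v w) \<le> ?G w" "?G w \<le> HI (f w) (part u v w)"
        using low upp ends' LO_le HI_ge w XsX by blast+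
      obtain a where a: "a \<in> X" "blk a = blk w" "f' a = LO (f w) (part u v w)" by (rule LO_in[OF XsX[OF w]])
      obtain d where d: "d \<in> X" "blk d = blk w" "f' d = HI (f w) (part u v w)" by (rule HI_in[OF XsX[OF w]])
      obtain i where i: "i < Q" "inz z i w" using w by (auto simp: Xs_def X_def dom_def)
      \<comment> \<open>Both bounds are values of \<open>f'\<close> on the block, whose positions
        share the zone \<open>i\<close> of the parent instance. The letter range of \<open>i\<close>
        is an interval, so it contains everything between them.\<close>
      have "inz z i a" "inz z i d" using same_zone[OF XsX[OF w] _ _ i] a d by (auto simp: blk_def)
      then have "inr z i (f' a)" "inr z i (f' d)"
        using f'_alw[OF a(1)] f'_alw[OF d(1)] good_z[OF g] i unfolding alw_def by metis+
      then have "inr z i (?G w)" using b a d by (auto simp: inr_def)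
      moreover have "?G w < k" "cp (?G w) \<in> S" using gw(1,2)[OF w] f'k[OF w] by (simp_all split: if_split)
      ultimately show ?thesis using b i by (auto simp: alw_def)
    qed
    have mo: "?G w \<le> ?G w'" if w: "w \<in> Xs" "w' \<in> Xs" "w \<le> w'" for w w'
    proof -
      have le: "f' w \<le> f' w'" using f'_mono XsX w by auto
      consider "cp (f' w) \<in> A" | "cp (f' w') \<in> A" | "cp (f' w) \<notin> A" "cp (f' w') \<notin> A" by blast
      then show ?thesis
      proof cases
        case 1 then show ?thesis using low[OF w(2), of "f' w"] f'k[OF w(1)] le by (simp add: AL_def)
      next
        case 2 then show ?thesis using upp[OF w(1), of "f' w'"] f'k[OF w(2)] le by (simp add: AL_def)
      next
        case 3 then show ?thesis using vg w dom' unfolding valid_def by (auto simp: Xs_def X_def)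
      qed
    qed
    have ed: "eH (?G w) (?G w')" if w: "w \<in> Xs" "w' \<in> Xs" "eG w w'" "w*n+w' < j" for w w'
    proof -
      \<comment> \<open>Adjacent letters lie in one copy, so both ends are guessed or both are left
        to \<open>g\<close>.\<close>
      have e: "eH (f' w) (f' w')" using f'_edge w by blast
      then have "cp (f' w) = cp (f' w')" using cross f'k w by blast
      then show ?thesis using e vg w dom' unfolding valid_def by (auto simp: Xs_def X_def)
    qed
    have Xs_iff: "w < n \<and> dom z w \<and> cp (f w) = s \<longleftrightarrow> w \<in> Xs" for w by (auto simp: Xs_def X_def)
    show ?thesis unfolding okP_def
    proof (intro allI impI)
      fix w assume "w < n" "dom z w \<and> cp (f w) = s"
      then have w: "w \<in> Xs" using Xs_iff by blast
      have "(w \<le> w' \<longrightarrow> merge Q c g w \<le> merge Q c g w') \<and>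
          (eG w w' \<and> w*n+w' < j \<longrightarrow> eH (merge Q c g w) (merge Q c g w'))" if w': "w' \<in> Xs" for w'
        unfolding mer[OF w] mer[OF w'] using mo[OF w w'] ed[OF w w'] by iprover
      note M = this
      have al': "alw S z w (merge Q c g w) \<and> LO (f w) (part u v w) \<le> merge Q c g w \<and>
          merge Q c g w \<le> HI (f w) (part u v w)" unfolding mer[OF w] by (rule al[OF w])
      show "alw S z w (merge Q c g w) \<and> LO (f w) (part u v w) \<le> merge Q c g w \<and>
          merge Q c g w \<le> HI (f w) (part u v w) \<and> (\<forall>w'<n. dom z w' \<and> cp (f w') = s \<longrightarrow>
          (w \<le> w' \<longrightarrow> merge Q c g w \<le> merge Q c g w') \<and>
          (eG w w' \<and> w*n+w' < j \<longrightarrow> eH (merge Q c g w) (merge Q c g w')))"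
      proof (intro conjI[OF conjunct1[OF al']] conjI[OF conjunct1[OF conjunct2[OF al']]]
          conjI[OF conjunct2[OF conjunct2[OF al']]] allI impI)
        fix w' assume "w' < n" "dom z w' \<and> cp (f w') = s"
        then have "w' \<in> Xs" using Xs_iff by blast
        then show "(w \<le> w' \<longrightarrow> merge Q c g w \<le> merge Q c g w') \<and>
          (eG w w' \<and> w*n+w' < j \<longrightarrow> eH (merge Q c g w) (merge Q c g w'))" by (rule M)
      qed
    qed
  qed
  show thesis using that[OF sub good' v' zb cb okp] .
qed

end
end

section \<open>Tabulation\<close>

text \<open>The value is \<open>N\<close> if the search below \<open>N\<close> fails.\<close>

definition mu :: "nat \<Rightarrow> (nat \<Rightarrow> bool) \<Rightarrow> nat" where "mu N P = (LEAST i. i < N \<longrightarrow> P i)"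

lemma mu_le: "mu N P \<le> N" unfolding mu_def by (rule Least_le) simp
lemma mu_P: "mu N P < N \<Longrightarrow> P (mu N P)"
  using LeastI[of "\<lambda>i. i < N \<longrightarrow> P i" N] unfolding mu_def by simp
lemma mu_ex: "i < N \<Longrightarrow> P i \<Longrightarrow> mu N P < N"
  using Least_le[of "\<lambda>i. i < N \<longrightarrow> P i" i] unfolding mu_def by simp
lemma mu_iff: "mu N P < N \<longleftrightarrow> (\<exists>i<N. P i)" using mu_P mu_ex by blast
lemma mu_cong: "(\<And>i. i < N \<Longrightarrow> P i = P' i) \<Longrightarrow> mu N P = mu N P'"
  unfolding mu_def by (rule arg_cong[of _ _ Least]) auto

text \<open>The machine only adds and subtracts, so quotients, remainders and digits come from
  searches and loops clocked by \<open>N\<close>; they agree with \<open>div\<close> and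
  \<open>mod\<close> for arguments below \<open>N\<close>.\<close>

definition dvc :: "nat \<Rightarrow> nat \<Rightarrow> nat \<Rightarrow> nat" where "dvc N a b = mu N (\<lambda>q. a < b * Suc q)"
definition mdc :: "nat \<Rightarrow> nat \<Rightarrow> nat \<Rightarrow> nat" where "mdc N a b = a - b * dvc N a b"
definition digc :: "nat \<Rightarrow> nat \<Rightarrow> nat \<Rightarrow> nat \<Rightarrow> nat" where
  "digc N b i x = mdc N (rec_nat x (\<lambda>t a. if t < i then dvc N a b else a) N) b"

lemma dvc: assumes "a < N" "b > 0" shows "dvc N a b = a div b"
  unfolding dvc_def mu_def
proof (rule Least_equality)
  show "a div b < N \<longrightarrow> a < b * Suc (a div b)"
    using assms by (metis dividend_less_times_div mult_Suc_right)
next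
  fix q assume q: "q < N \<longrightarrow> a < b * Suc q"
  show "a div b \<le> q"
  proof (cases "q < N")
    case True then have "a < Suc q * b" using q by (simp add: mult.commute)
    then have "a div b < Suc q" by (rule less_mult_imp_div_less)
    then show ?thesis by simp
  next
    case False then show ?thesis using assms div_le_dividend[of a b] by linarith
  qed
qed

lemma mdc: assumes "a < N" "b > 0" shows "mdc N a b = a mod b"
  using dvc[OF assms] by (simp add: mdc_def minus_mult_div_eq_mod)

lemma digc: assumes "x < N" "b > 0" "i \<le> N" shows "digc N b i x = x div b ^ i mod b"
proof -
  have "rec_nat x (\<lambda>t a. if t < i then dvc N a b else a) j = x div b ^ (min i j)" for j
  proof (induction j)
    case (Suc j)
    have "x div b ^ min i j < N" using assms(1) div_le_dividend le_less_trans by blast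
    then show ?case using Suc dvc[OF _ assms(2)]
      by (auto simp: min_def div_mult2_eq[symmetric] not_less_eq_eq mult.commute le_Suc_eq)
  qed simp
  then show ?thesis using assms mdc[of "x div b ^ i" N b] div_le_dividend[of x "b ^ i"]
    by (simp add: digc_def min_absorb1)
qed

lemma digits_ex:
  fixes b :: nat
  assumes "\<And>i. i < L \<Longrightarrow> d i < b"
  shows "\<exists>x<b ^ L. \<forall>i<L. x div b ^ i mod b = d i"
  using assms
proof (induction L arbitrary: d)
  case (Suc L)
  then have b: "d 0 < b" by simp
  obtain x where x: "x < b ^ L" "\<forall>i<L. x div b ^ i mod b = d (Suc i)" using Suc(1)[of "\<lambda>i. d (Suc i)"] Suc(2) by auto
  have "d 0 + b * x < b ^ Suc L"
  proof -
    have "d 0 + b * x < b * Suc x" using b by simp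
    also have "\<dots> \<le> b * b ^ L" using x(1) by (intro mult_le_mono2) simp
    finally show ?thesis by simp
  qed
  moreover have "(d 0 + b * x) div b ^ i mod b = d i" if "i < Suc L" for i
  proof (cases i)
    case (Suc i')
    have "(d 0 + b * x) div b = x" using b by simp
    then show ?thesis using Suc x that by (simp add: div_mult2_eq)
  qed (use b in simp)
  ultimately show ?case by blast
qed simp

section \<open>The recurrence for the table\<close>

type_synonym tab = "nat \<Rightarrow> nat \<Rightarrow> nat \<Rightarrow> nat \<Rightarrow> nat"

locale solver_base = instances +
  fixes N B ZB K0 :: nat
begin

definition Sset :: "nat \<Rightarrow> nat set" where "Sset S = {s. s < k \<and> digc N 2 s S \<noteq> 0}"
definition za :: "nat \<Rightarrow> nat \<Rightarrow> nat" where "za z = (\<lambda>x. digc N B x z)"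
text \<open>A guess for one subproblem is a single number \<open>cS + B * (cz + ZB * cc)\<close>:
  the codes of the set of copies, of the zones, and of the intervals with prescribed
  letters.\<close>

definition gS :: "nat \<Rightarrow> nat" where "gS g = mdc N g B"
definition gz :: "nat \<Rightarrow> nat" where "gz g = mdc N (dvc N g B) ZB"
definition gc :: "nat \<Rightarrow> nat" where "gc g = dvc N (dvc N g B) ZB"

text \<open>Entries hold a letter plus one, with 0 reserved for unsolvable instances; hence the
  subtraction.\<close>

definition cand :: "tab \<Rightarrow> nat \<Rightarrow> nat \<Rightarrow> nat \<Rightarrow> nat" where
  "cand tb j g = merge Q (za (gc g)) (\<lambda>w. tb (gS g) j (gz g) w - 1)"
text \<open>The test \<open>gS g < S\<close> makes the recursion well-founded, as removing copies
  lowers the binary code of the set. The number \<open>p\<close> lists the bounds in base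
  \<open>K0\<close>, ten digits per old letter: two for each of the five parts.\<close>

definition okg :: "tab \<Rightarrow> nat \<Rightarrow> nat \<Rightarrow> nat \<Rightarrow> nat \<Rightarrow> nat \<Rightarrow> nat \<Rightarrow> bool" where
  "okg tb S j z p s g \<longleftrightarrow> gS g < S \<and> okP j (Sset S) (za z) (\<lambda>w. tb S j z w - 1) (dvc N j n) (mdc N j n)
     (\<lambda>y q. digc N K0 (10*y+2*q) p) (\<lambda>y q. digc N K0 (10*y+2*q+1) p) s (cand tb j g)"
text \<open>Once the bounds \<open>p\<close> are fixed, each copy gets its own search, so the costs
  of the guesses add up instead of multiplying.\<close>

definition gsel :: "tab \<Rightarrow> nat \<Rightarrow> nat \<Rightarrow> nat \<Rightarrow> nat \<Rightarrow> nat \<Rightarrow> nat" where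
  "gsel tb S j z p s = mu N (okg tb S j z p s)"
definition comb :: "tab \<Rightarrow> nat \<Rightarrow> nat \<Rightarrow> nat \<Rightarrow> nat \<Rightarrow> nat \<Rightarrow> nat" where
  "comb tb S j z p w = (if gsel tb S j z p (cp (tb S j z w - 1)) < N
     then cand tb j (gsel tb S j z p (cp (tb S j z w - 1))) w else 0)"
definition psel :: "tab \<Rightarrow> nat \<Rightarrow> nat \<Rightarrow> nat \<Rightarrow> nat" where
  "psel tb S j z = mu N (\<lambda>p. valid (j+1) (Sset S) (za z) (comb tb S j z p))"
definition init :: "nat \<Rightarrow> nat \<Rightarrow> nat \<Rightarrow> nat" where
  "init S z w = mu N (\<lambda>h. alw (Sset S) (za z) w h)"
text \<open>The case distinction is the same for all positions \<open>w\<close>, so the entry at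
  position 0 tells whether the instance is solved. The old solution is kept if it already respects
  the new pair; \<open>- 1 + 1\<close> then keeps the entry positive.\<close>

definition entry :: "tab \<Rightarrow> nat \<Rightarrow> nat \<Rightarrow> nat \<Rightarrow> nat \<Rightarrow> nat" where
  "entry tb S j z w =
    (if j = 0 then if valid 0 (Sset S) (za z) (init S z) then init S z w + 1 else 0
     else if tb S (j-1) z 0 = 0 then 0
     else if valid j (Sset S) (za z) (\<lambda>w. tb S (j-1) z w - 1) then tb S (j-1) z w - 1 + 1
     else if psel tb S (j-1) z < N then comb tb S (j-1) z (psel tb S (j-1) z) w + 1 else 0)"

text \<open>A guess with \<open>gS g\<close> not below \<open>S\<close> is rejected before the table
  matters, so only smaller sets and, for the same set, fewer edges are consulted. This is why one
  pass in increasing order fills the table.\<close>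

lemma entry_local:
  assumes "\<And>S' j' z' w'. S' < S \<or> S' = S \<and> j' < j \<Longrightarrow> tb S' j' z' w' = tb' S' j' z' w'"
  shows "entry tb S j z w = entry tb' S j z w"
proof (cases j)
  case (Suc i)
  have f: "tb S i z = tb' S i z" by (rule ext) (use assms Suc in simp)
  have c: "cand tb i g = cand tb' i g" if "gS g < S" for g
    unfolding cand_def using assms that by simp
  have o: "okg tb S i z p s g = okg tb' S i z p s g" for p s g
    unfolding okg_def f using c by (cases "gS g < S") simp_all
  then have g: "gsel tb S i z p s = gsel tb' S i z p s" for p s unfolding gsel_def by (intro mu_cong)
  have cm: "comb tb S i z p = comb tb' S i z p" for p
  proof
    fix w
    let ?s = "cp (tb' S i z w - 1)"
    have "gS (gsel tb' S i z p ?s) < S" if "gsel tb' S i z p ?s < N"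
      using mu_P[of N "okg tb' S i z p ?s"] that unfolding gsel_def okg_def by blast
    then show "comb tb S i z p w = comb tb' S i z p w"
      unfolding comb_def f g using c by simp
  qed
  show ?thesis using Suc unfolding entry_def psel_def by (simp add: f cm)
qed (simp add: entry_def)

lemma inz_cong: "(\<And>x. x < 4*Q \<Longrightarrow> z x = z' x) \<Longrightarrow> i < Q \<Longrightarrow> inz z i w = inz z' i w"
  unfolding inz_def by simp
lemma inr_cong: "(\<And>x. x < 4*Q \<Longrightarrow> z x = z' x) \<Longrightarrow> i < Q \<Longrightarrow> inr z i w = inr z' i w"
  unfolding inr_def by simp

lemma valid_cong_z:
  assumes z: "\<And>x. x < 4*Q \<Longrightarrow> z x = z' x"
  shows "valid j S z f = valid j S z' f"
proof -
  have "dom z w = dom z' w" for w unfolding dom_def using inz_cong[of z z', OF z] by auto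
  moreover have "alw S z w h = alw S z' w h" for w h
    unfolding alw_def using inz_cong[of z z', OF z] inr_cong[of z z', OF z] by blast
  ultimately show ?thesis unfolding valid_def by simp
qed

lemma good_cong_z:
  assumes z: "\<And>x. x < 4*Q \<Longrightarrow> z x = z' x"
  shows "good S z = good S z'"
proof -
  have "z (4*i) = z' (4*i)" "z (4*i+1) = z' (4*i+1)" if "i < Q" for i using z that by auto
  then show ?thesis unfolding good_def using inz_cong[of z z', OF z] inr_cong[of z z', OF z] by simp
qed

lemma merge_cong: assumes "\<And>x. x < 3*Q \<Longrightarrow> c x = c' x" shows "merge Q c g = merge Q c' g"
proof
  fix w
  have *: "(i < Q \<and> c (3*i) \<le> w \<and> w < c (3*i+1)) = (i < Q \<and> c' (3*i) \<le> w \<and> w < c' (3*i+1))" for i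
    using assms[of "3*i"] assms[of "3*i+1"] by (cases "i < Q") auto
  have "c (3*l+2) = c' (3*l+2)" if "l < Q" for l using assms that by simp
  moreover have "(LEAST i. i < Q \<and> c' (3*i) \<le> w \<and> w < c' (3*i+1)) < Q" if "\<exists>i. i < Q \<and> c' (3*i) \<le> w \<and> w < c' (3*i+1)"
    using LeastI_ex[OF that] by blast
  ultimately show "merge Q c g w = merge Q c' g w" unfolding merge_def * by (intro if_cong refl) blast
qed

end

text \<open>The clock \<open>N\<close> exceeds every code searched for: the guesses for one copy and
  the \<open>10 * k\<close> bounds in base \<open>K0\<close>. A set of copies and the number of
  edges fit into one digit in base \<open>B\<close>. The recurrence is assumed only on the range
  that the program stores.\<close>

locale solver = solver_base + colouring +
  fixes tb :: "nat \<Rightarrow> nat \<Rightarrow> nat \<Rightarrow> nat \<Rightarrow> nat"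
  assumes cpk: "\<And>h. h < k \<Longrightarrow> cp h < k"
    and B: "n + k < B" "2 ^ k \<le> B" "n * n < B" and ZB: "ZB = B ^ (4*Q)" and K0: "K0 = 2 ^ k"
    and N: "B * ZB * B ^ (3*Q) < N" "K0 ^ (10*k+10) < N" "10*k+10 \<le> N" "4*Q \<le> N"
    and tb: "\<And>S j z w. S < 2 ^ k \<Longrightarrow> j \<le> n * n \<Longrightarrow> z < ZB \<Longrightarrow> w < B \<Longrightarrow> tb S j z w = entry tb S j z w"
begin

section \<open>Soundness and completeness of the table\<close>

lemma B0: "B > 0" using B by simp
lemma ZB0: "ZB > 0" using B0 ZB by simp
lemma ZN: "B ^ (3*Q) < N" "ZB < N" "B < N"
proof -
  have 1: "1 \<le> B" "1 \<le> ZB" "1 \<le> B ^ (3*Q)" using B0 ZB0 by (simp_all add: Suc_leI)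
  have "B * ZB * 1 \<le> B * ZB * B ^ (3*Q)" "1 * 1 * B ^ (3*Q) \<le> B * ZB * B ^ (3*Q)" using 1 by (intro mult_le_mono; simp)+
  moreover have "B * 1 \<le> B * ZB" "1 * ZB \<le> B * ZB" using 1 by (intro mult_le_mono; simp)+
  ultimately show "B ^ (3*Q) < N" "ZB < N" "B < N" using N(1) by linarith+
qed

lemma Sset: assumes "S < 2 ^ k" shows "Sset S = set_decode S" "set_decode S \<subseteq> {..<k}"
proof -
  show sub: "set_decode S \<subseteq> {..<k}"
  proof
    fix s assume "s \<in> set_decode S"
    then have "S div 2 ^ s \<noteq> 0" by (auto simp: set_decode_def odd_pos)
    then have "(2::nat) ^ s \<le> S" by (simp add: div_eq_0_iff)
    then have "(2::nat) ^ s < 2 ^ k" using assms by (rule le_less_trans)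
    then show "s \<in> {..<k}" by simp
  qed
  have "S < N" using assms B ZN by linarith
  have "digc N 2 s S \<noteq> 0 \<longleftrightarrow> s \<in> set_decode S" if "s < k" for s
  proof -
    have "s \<le> N" using that N by linarith
    then have "digc N 2 s S = S div 2 ^ s mod 2" using \<open>S < N\<close> by (simp add: digc)
    then show ?thesis by (simp add: set_decode_def odd_iff_mod_2_eq_one)
  qed
  then show "Sset S = set_decode S" using sub by (auto simp: Sset_def)
qed

text \<open>Binary codes are strictly monotone under inclusion, so descending in the set of copies
  is descending in the order of the table.\<close>

lemma Sset_sub:
  assumes S: "S < 2 ^ k" and A: "A \<subset> Sset S"
  obtains S' where "S' < S" "Sset S' = A"
proof -
  have fin: "finite (Sset S)" by (simp add: Sset_def)
  have finA: "finite A" using A fin finite_subset by blast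
  obtain b where b: "b \<in> Sset S - A" using A by blast
  have "sum ((^) 2) A < sum ((^) (2::nat)) (Sset S)"
    by (rule sum_strict_mono2[OF fin _ b]) (use A in auto)
  then have "set_encode A < set_encode (set_decode S)" unfolding Sset(1)[OF S] set_encode_def .
  then have l: "set_encode A < S" by simp
  have "Sset (set_encode A) = set_decode (set_encode A)" by (rule Sset(1)) (use l S in linarith)
  also have "\<dots> = A" by (rule set_encode_inverse[OF finA])
  finally have "Sset (set_encode A) = A" .
  then show ?thesis using that l by blast
qed

lemma code_ex:
  assumes "\<And>x. d x \<le> n + k" "L \<le> 4*Q"
  obtains c where "c < B ^ L" "\<And>x. x < L \<Longrightarrow> za c x = d x"
proof -
  obtain c where c: "c < B ^ L" "\<forall>i<L. c div B ^ i mod B = d i"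
    using digits_ex[of L d B] le_less_trans[OF assms(1) B(1)] by blast
  have "B ^ L \<le> B ^ (4*Q)" using B0 assms(2) by (intro power_increasing) auto
  then have cN: "c < N" using c ZB ZN by linarith
  have "za c x = d x" if "x < L" for x
  proof -
    have "x \<le> N" using that assms(2) N by linarith
    then show ?thesis using c cN B0 that by (simp add: za_def digc)
  qed
  then show ?thesis using that c by blast
qed

lemma valid_cong_f:
  assumes "valid j S z f" "\<And>w. w < n \<Longrightarrow> dom z w \<Longrightarrow> f' w = f w"
  shows "valid j S z f'"
  using assms(1) unfolding valid_def by (simp add: assms(2))

lemma valid_less: "valid j S z f \<Longrightarrow> i \<le> j \<Longrightarrow> valid i S z f"
proof -
  assume v: "valid j S z f" and "i \<le> j"
  then have "x < i \<Longrightarrow> x < j" for x by simp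
  then show ?thesis using v unfolding valid_def by (simp add: conj_ac)
qed

lemma okP_cong:
  assumes "\<And>w. w < n \<Longrightarrow> dom z w \<Longrightarrow> lo (f w) (part u v w) = lo' (f w) (part u v w)"
    "\<And>w. w < n \<Longrightarrow> dom z w \<Longrightarrow> hi (f w) (part u v w) = hi' (f w) (part u v w)"
  shows "okP j S z f u v lo hi s g = okP j S z f u v lo' hi' s g"
  unfolding okP_def using assms by simp

text \<open>Each nonzero entry has passed a test of \<open>valid\<close>, so soundness holds entry
  by entry, however the guesses were found.\<close>

lemma sound:
  assumes b: "S < 2 ^ k" "j \<le> n * n" "z < ZB" and t: "tb S j z 0 \<noteq> 0"
  shows "valid j (Sset S) (za z) (\<lambda>w. tb S j z w - 1)"
proof -
  have e: "tb S j z w = entry tb S j z w" if "w < B" for w using tb b that by blast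
  have nB: "w < n \<Longrightarrow> w < B" for w using B by simp
  have t0: "entry tb S j z 0 \<noteq> 0" using t e[of 0] B0 by simp
  consider (a) "j = 0" "valid 0 (Sset S) (za z) (init S z)"
    | (b) "j > 0" "valid j (Sset S) (za z) (\<lambda>w. tb S (j-1) z w - 1)" "tb S (j-1) z 0 \<noteq> 0"
    | (c) "j > 0" "tb S (j-1) z 0 \<noteq> 0" "\<not> valid j (Sset S) (za z) (\<lambda>w. tb S (j-1) z w - 1)" "psel tb S (j-1) z < N"
    using t0 unfolding entry_def by (metis gr0I)
  then show ?thesis
  proof cases
    case a
    have "tb S j z w - 1 = init S z w" if "w < n" for w using e[OF nB[OF that]] a by (simp add: entry_def)
    then show ?thesis using a valid_cong_f[OF a(2)] by simp
  next
    case b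
    have "tb S j z w - 1 = tb S (j-1) z w - 1" if "w < n" for w using e[OF nB[OF that]] b by (simp add: entry_def)
    then show ?thesis using valid_cong_f[OF b(2)] by simp
  next
    case c
    have "tb S j z w - 1 = comb tb S (j-1) z (psel tb S (j-1) z) w" if "w < n" for w
      using e[OF nB[OF that]] c by (simp add: entry_def)
    moreover have "valid (j-1+1) (Sset S) (za z) (comb tb S (j-1) z (psel tb S (j-1) z))"
      using c(4) mu_P unfolding psel_def by blast
    ultimately show ?thesis using c(1) valid_cong_f[of "j-1+1" "Sset S" "za z" "comb tb S (j-1) z (psel tb S (j-1) z)"] by simp
  qed
qed

lemma mu_LEAST: assumes "i < M" "P i" shows "mu M P = (LEAST i. P i)"
proof (rule Least_equality[symmetric])
  show "P (mu M P)" using assms mu_P mu_ex by blast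
  fix y assume "P y"
  then show "mu M P \<le> y" unfolding mu_def by (intro Least_le) simp
qed

text \<open>The outer induction runs over the set code and the inner one over the number of edges.
  The inner one supplies the old homomorphism \<open>?f\<close>, which may differ from
  \<open>f'\<close>; for each copy \<open>split\<close> supplies an instance that \<open>f'\<close>
  still solves, and the outer hypothesis covers it.\<close>

lemma complete:
  assumes "S < 2 ^ k" "j \<le> n * n" "z < ZB" "good (Sset S) (za z)" "valid j (Sset S) (za z) f'"
  shows "tb S j z 0 \<noteq> 0"
  using assms
proof (induction S arbitrary: j z f' rule: less_induct)
  case (less S)
  note IHS = less.IH
  from less.prems show ?case
  proof (induction j)
    case 0
    have "init S z w = (LEAST h. alw (Sset S) (za z) w h)" if "w < n" "dom (za z) w" for w
    proof -
      have a: "alw (Sset S) (za z) w (f' w)" using 0(5) that by (simp add: valid_def)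
      then have "f' w < N" using B ZN by (simp add: alw_def)
      then show ?thesis unfolding init_def using a by (rule mu_LEAST)
    qed
    then have "valid 0 (Sset S) (za z) (init S z)"
      by (rule valid_cong_f[OF valid_0[OF 0(4,5)]])
    then show ?case using tb[OF 0(1-3) B0] by (simp add: entry_def)
  next
    case (Suc j)
    let ?S = "Sset S" and ?z = "za z" and ?f = "\<lambda>w. tb S j z w - 1"
    have v': "valid j ?S ?z f'" using valid_less[OF Suc.prems(5)] by simp
    have t: "tb S j z 0 \<noteq> 0" using Suc.IH Suc.prems v' by simp
    have f: "valid j ?S ?z ?f" by (rule sound) (use Suc.prems t in auto)
    have n0: "n > 0" using Suc.prems(2) by (cases n) auto
    let ?u = "j div n" and ?v = "j mod n"
    have u: "?u < n" using Suc.prems(2) n0 by (simp add: less_mult_imp_div_less)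
    have v: "?v < n" using n0 by simp
    have jN: "j < N" using Suc.prems(2) B ZN by linarith
    have juv: "j = ?u * n + ?v" by simp
    have dm: "dvc N j n = ?u" "mdc N j n = ?v" using dvc[OF jN n0] mdc[OF jN n0] .
    note ctx = Suc.prems(4) f Suc.prems(5) u v juv
    let ?LO = "LO ?z ?f f' ?u ?v" and ?HI = "HI ?z ?f f' ?u ?v"
    \<comment> \<open>Blocks that do not occur have the minimum or maximum of the empty set as
      bound, an unspecified number; it is cut down to 0 so that it is a legal digit.\<close>
    define d where "d x = (let v = (if even x then ?LO else ?HI) (x div 10) (x mod 10 div 2) in if v < K0 then v else 0)" for x
    have dd: "d (10 * y + 2 * q) = (if ?LO y q < K0 then ?LO y q else 0)"
      "d (10 * y + 2 * q + 1) = (if ?HI y q < K0 then ?HI y q else 0)" if "q < 5" for y q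
    proof -
      have ar: "(10 * y + 2 * q) div 10 = y" "(10 * y + 2 * q) mod 10 div 2 = q" "even (10 * y + 2 * q)"
        "(10 * y + 2 * q + 1) div 10 = y" "(10 * y + 2 * q + 1) mod 10 div 2 = q" "even (10 * y + 2 * q + 1) = False"
        using that by presburger+
      show "d (10 * y + 2 * q) = (if ?LO y q < K0 then ?LO y q else 0)"
        "d (10 * y + 2 * q + 1) = (if ?HI y q < K0 then ?HI y q else 0)"
        unfolding d_def ar Let_def using ar(3) by (simp_all only: if_True if_False simp_thms)
    qed
    have "d x < K0" for x using K0 by (auto simp: d_def Let_def)
    then obtain p where p: "p < K0 ^ (10*k)" "\<forall>i<10*k. p div K0 ^ i mod K0 = d i" using digits_ex[of "10*k" d K0] by blast
    have K00: "K0 > 0" using K0 by simp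
    have "K0 ^ (10*k) \<le> K0 ^ (10*k+10)" using K00 by (intro power_increasing) auto
    then have pN: "p < N" using p N by linarith
    have dg: "digc N K0 x p = d x" if "x < 10*k" for x
      using p that digc[OF pN K00, of x] N by simp
    have kK: "k < K0" using K0 by simp
    have lohi: "digc N K0 (10 * ?f w + 2 * part ?u ?v w) p = ?LO (?f w) (part ?u ?v w)"
       "digc N K0 (10 * ?f w + 2 * part ?u ?v w + 1) p = ?HI (?f w) (part ?u ?v w)"
       if w: "w < n" "dom ?z w" for w
    proof -
      have X: "w \<in> X ?z" using w by (simp add: X_def[OF ctx])
      have fk: "?f w < k" using f_alw[OF ctx X] by (simp add: alw_def)
      let ?q = "part ?u ?v w"
      have q: "?q < 5" by (rule part_le)
      have i: "10 * ?f w + 2 * ?q < 10*k" "10 * ?f w + 2 * ?q + 1 < 10 * k" using fk q by linarith+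
      obtain a where a: "a \<in> X ?z" "blk ?f ?u ?v a = blk ?f ?u ?v w" "f' a = ?LO (?f w) ?q" by (rule LO_in[OF ctx X])
      obtain b where b: "b \<in> X ?z" "blk ?f ?u ?v b = blk ?f ?u ?v w" "f' b = ?HI (?f w) ?q" by (rule HI_in[OF ctx X])
      have "?LO (?f w) ?q < k" "?HI (?f w) ?q < k"
        using f'_alw[OF ctx a(1)] f'_alw[OF ctx b(1)] a(3) b(3) by (simp_all add: alw_def)
      then have lt: "?LO (?f w) ?q < K0" "?HI (?f w) ?q < K0" using kK by linarith+
      show "digc N K0 (10 * ?f w + 2 * part ?u ?v w) p = ?LO (?f w) (part ?u ?v w)"
        unfolding dg[OF i(1)] dd(1)[OF q] using lt(1) by (rule if_P)
      show "digc N K0 (10 * ?f w + 2 * part ?u ?v w + 1) p = ?HI (?f w) (part ?u ?v w)"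
        unfolding dg[OF i(2)] dd(2)[OF q] using lt(2) by (rule if_P)
    qed
    \<comment> \<open>The guess agrees with \<open>?LO\<close> and \<open>?HI\<close> on the blocks
      that occur, and \<open>okP\<close> looks at no others.\<close>
    have ok_eq: "okP j ?S ?z ?f (dvc N j n) (mdc N j n) (\<lambda>y q. digc N K0 (10*y+2*q) p)
        (\<lambda>y q. digc N K0 (10*y+2*q+1) p) s g = okP j ?S ?z ?f ?u ?v ?LO ?HI s g" for s g
      unfolding dm by (rule okP_cong) (use lohi in auto)
    have g: "\<exists>g<N. okg tb S j z p s g" if s: "s \<in> ?S" for s
    proof -
      obtain S' z' c where o: "S' \<subset> ?S" "good S' z'" "valid j S' z' f'" "\<And>x. z' x \<le> n + k" "\<And>x. c x \<le> n + k"
        "\<And>g. valid j S' z' g \<Longrightarrow> okP j ?S ?z ?f ?u ?v ?LO ?HI s (merge Q c g)"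
        using split[OF ctx s] by blast
      obtain cS where cS: "cS < S" "Sset cS = S'" using Sset_sub[OF Suc.prems(1) o(1)] by blast
      obtain cz where cz: "cz < ZB" "\<And>x. x < 4*Q \<Longrightarrow> za cz x = z' x" using code_ex[of z' "4*Q"] o(4) ZB by auto
      obtain cc where cc: "cc < B ^ (3*Q)" "\<And>x. x < 3*Q \<Longrightarrow> za cc x = c x" using code_ex[of c "3*Q"] o(5) by auto
      have cSk: "cS < 2 ^ k" using cS Suc.prems by simp
      have gd: "good (Sset cS) (za cz)" "valid j (Sset cS) (za cz) f'"
        using o(2,3) cS(2) good_cong_z[of "za cz" z'] valid_cong_z[of "za cz" z'] cz(2) by auto
      have jn: "j \<le> n * n" using Suc.prems(2) by simp
      \<comment> \<open>What gets merged is the solution stored in the table, which need not be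
        \<open>f'\<close>; \<open>sound\<close> guarantees that it solves the child
        instance.\<close>
      have "tb cS j cz 0 \<noteq> 0" by (rule IHS[OF cS(1) cSk jn cz(1) gd])
      then have "valid j (Sset cS) (za cz) (\<lambda>w. tb cS j cz w - 1)" by (rule sound[OF cSk jn cz(1)])
      then have "valid j S' z' (\<lambda>w. tb cS j cz w - 1)" using cS(2) valid_cong_z[of "za cz" z'] cz(2) by simp
      then have ok: "okP j ?S ?z ?f ?u ?v ?LO ?HI s (merge Q c (\<lambda>w. tb cS j cz w - 1))" by (rule o(6))
      \<comment> \<open>The code from which \<open>gS\<close>, \<open>gz\<close> and
        \<open>gc\<close> recover the three components.\<close>
      let ?g = "cS + B * (cz + ZB * cc)"
      have cSB: "cS < B" using cSk B by linarith
      have "cz + ZB * cc < ZB * Suc cc" using cz by simp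
      also have "\<dots> \<le> ZB * B ^ (3*Q)" using cc by (intro mult_le_mono2) simp
      finally have l1: "Suc (cz + ZB * cc) \<le> ZB * B ^ (3*Q)" by simp
      have "?g < B * Suc (cz + ZB * cc)" using cSB by simp
      also have "\<dots> \<le> B * (ZB * B ^ (3*Q))" using l1 by (rule mult_le_mono2)
      finally have gN: "?g < N" using N(1) by (simp add: mult.assoc)
      have gd: "?g div B = cz + ZB * cc" using cSB by simp
      have gN': "cz + ZB * cc < N" using gN gd div_le_dividend[of ?g B] by linarith
      have "dvc N ?g B = cz + ZB * cc" using dvc[OF gN B0] gd by simp
      then have dec: "gS ?g = cS" "gz ?g = cz" "gc ?g = cc"
        using mdc[OF gN B0] mdc[OF gN' ZB0] dvc[OF gN' ZB0] cSB cz(1) by (simp_all add: gS_def gz_def gc_def)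
      have "cand tb j ?g = merge Q c (\<lambda>w. tb cS j cz w - 1)"
        unfolding cand_def dec by (rule merge_cong) (rule cc(2))
      then have "okg tb S j z p s ?g" unfolding okg_def ok_eq dec(1) using ok cS(1) by simp
      then show ?thesis using gN by blast
    qed
    have gs: "gsel tb S j z p s < N" "okg tb S j z p s (gsel tb S j z p s)" if "s \<in> ?S" for s
      using g[OF that] mu_P[of N "okg tb S j z p s"] mu_iff[of N "okg tb S j z p s"] unfolding gsel_def by blast+
    have "valid (Suc j) ?S ?z (\<lambda>w. cand tb j (gsel tb S j z p (cp (?f w))) w)"
    proof (rule combine[OF ctx])
      fix s assume "s \<in> ?S"
      then show "okP j ?S ?z ?f ?u ?v ?LO ?HI s (\<lambda>w. cand tb j (gsel tb S j z p s) w)"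
        using gs(2) ok_eq unfolding okg_def by simp
    qed
    moreover have "comb tb S j z p w = cand tb j (gsel tb S j z p (cp (?f w))) w" if "w < n" "dom ?z w" for w
    proof -
      have "cp (?f w) \<in> ?S" using f that by (simp add: valid_def alw_def)
      then show ?thesis using gs(1) by (simp add: comb_def)
    qed
    ultimately have "valid (j+1) ?S ?z (comb tb S j z p)" by (simp add: valid_cong_f)
    then have "psel tb S j z < N" unfolding psel_def using pN by (intro mu_ex)
    then show ?case using tb[OF Suc.prems(1-3) B0] t by (simp add: entry_def)
  qed
qed

end

section \<open>Clocked expressions\<close>

text \<open>Every loop runs for at most as many rounds as register 2 says, so the running time is polynomial
  in that register. The list of naturals holds the values of the bound variables, innermost first.\<close>

datatype ex = Hd | Wk ex | Cst nat | Glb nat | Rd ex | Ad ex ex | Sb ex ex | Ite ex ex ex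
  | MuE ex ex | LoopE ex ex | SubE ex nat ex

definition hd0 :: "nat list \<Rightarrow> nat" where "hd0 c = (if c = [] then 0 else hd c)"
lemma hd0_simps [simp]: "hd0 [] = 0" "hd0 (a # c) = a" by (simp_all add: hd0_def)

text \<open>\<open>SubE a n b\<close> is a substitution: \<open>a\<close> sees the whole list,
  \<open>b\<close> sees its value in front of the list without the first \<open>n\<close> entries.
  Registers from 16 on are scratch space of compiled code, so \<open>Glb\<close> does not look at
  them.\<close>

primrec eval :: "ex \<Rightarrow> state \<Rightarrow> nat list \<Rightarrow> nat" where
  "eval Hd s c = hd0 c"
| "eval (Wk e) s c = eval e s (tl c)"
| "eval (Cst a) s c = a"
| "eval (Glb i) s c = (if i < 16 then reg s i else 0)"
| "eval (Rd e) s c = mem s (eval e s c)"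
| "eval (Ad a b) s c = eval a s c + eval b s c"
| "eval (Sb a b) s c = eval a s c - eval b s c"
| "eval (Ite a b d) s c = (if eval a s c \<noteq> 0 then eval b s c else eval d s c)"
| "eval (MuE b p) s c = mu (min (eval b s c) (reg s 2)) (\<lambda>i. eval p s (i # c) \<noteq> 0)"
| "eval (LoopE a b) s c = rec_nat (eval a s c) (\<lambda>t x. eval b s (t # x # c)) (reg s 2)"
| "eval (SubE a n b) s c = eval b s (eval a s c # drop n c)"

text \<open>\<open>rs\<close> are the registers of the bound variables; the result and the scratch values go to registers
  from \<open>r\<close> on.\<close>

primrec compile :: "ex \<Rightarrow> nat list \<Rightarrow> nat \<Rightarrow> com" where
  "compile Hd rs r = Assign r (if rs = [] then Num 0 else Reg (hd rs))"
| "compile (Wk e) rs r = compile e (tl rs) r"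
| "compile (Cst a) rs r = Assign r (Num a)"
| "compile (Glb i) rs r = Assign r (if i < 16 then Reg i else Num 0)"
| "compile (Rd e) rs r = Seq (compile e rs r) (Assign r (Load (Reg r)))"
| "compile (Ad a b) rs r = Seq (compile a rs r) (Seq (compile b rs (r+1)) (Assign r (Plus (Reg r) (Reg (r+1)))))"
| "compile (Sb a b) rs r = Seq (compile a rs r) (Seq (compile b rs (r+1)) (Assign r (Minus (Reg r) (Reg (r+1)))))"
| "compile (Ite a b d) rs r = Seq (compile a rs r) (If (Reg r) (compile b rs r) (compile d rs r))"
| "compile (MuE b p) rs r = Seq (compile b rs r)
     (Seq (If (Minus (Reg r) (Reg 2)) (Assign r (Reg 2)) Skip)
     (Seq (Assign (r+1) (Num 0))
       (While (Minus (Reg r) (Reg (r+1)))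
         (Seq (compile p ((r+1) # rs) (r+2))
           (If (Reg (r+2)) (Assign r (Reg (r+1))) (Assign (r+1) (Plus (Reg (r+1)) (Num 1))))))))"
| "compile (LoopE a b) rs r = Seq (compile a rs r) (Seq (Assign (r+1) (Num 0))
     (While (Minus (Reg 2) (Reg (r+1)))
       (Seq (compile b ((r+1) # r # rs) (r+2))
         (Seq (Assign r (Reg (r+2))) (Assign (r+1) (Plus (Reg (r+1)) (Num 1)))))))"
| "compile (SubE a n b) rs r = Seq (compile a rs r) (Seq (compile b (r # drop n rs) (r+1)) (Assign r (Reg (r+1))))"

primrec cost :: "ex \<Rightarrow> nat \<Rightarrow> nat" where
  "cost Hd N = 1"
| "cost (Wk e) N = cost e N"
| "cost (Cst a) N = 1"
| "cost (Glb i) N = 1"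
| "cost (Rd e) N = cost e N + 1"
| "cost (Ad a b) N = cost a N + cost b N + 1"
| "cost (Sb a b) N = cost a N + cost b N + 1"
| "cost (Ite a b d) N = cost a N + cost b N + cost d N + 1"
| "cost (MuE b p) N = cost b N + 4 + N * (cost p N + 3)"
| "cost (LoopE a b) N = cost a N + 2 + N * (cost b N + 3)"
| "cost (SubE a n b) N = cost a N + cost b N + 1"

text \<open>Each loop contributes a factor of the order of the clock, and the loops are nested to a
  depth fixed by the expression; the degree therefore depends on the expression alone.\<close>

lemma cost_poly: "\<exists>C d. \<forall>N. cost e N \<le> C * (N + 1) ^ d"
proof -
  have mono: "C * (N+1) ^ d \<le> C' * (N+1) ^ d'" if "C \<le> C'" "d \<le> d'" for C C' d d' N :: nat
    using that by (intro mult_le_mono power_increasing) auto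
  have one: "x \<le> x * (N+1) ^ d" for x N d :: nat by simp
  have N1: "N * x \<le> x * (N+1)" for N x :: nat by simp
  show ?thesis
  proof (induction e)
    case Hd show ?case by (rule exI[of _ 1], rule exI[of _ 0]) simp
  next
    case (Wk e) then show ?case by simp
  next
    case (Cst a) show ?case by (rule exI[of _ 1], rule exI[of _ 0]) simp
  next
    case (Glb i) show ?case by (rule exI[of _ 1], rule exI[of _ 0]) simp
  next
    case (Rd e)
    then obtain C d where *: "\<forall>N. cost e N \<le> C * (N+1) ^ d" by blast
    have "cost (Rd e) N \<le> (C + 1) * (N+1) ^ d" for N
      using *[rule_format, of N] one[of 1 N d] unfolding cost.simps add_mult_distrib by linarith
    then show ?case by blast
  next
    case (Ad a b)
    then obtain C d C' d' where *: "\<forall>N. cost a N \<le> C * (N+1) ^ d" "\<forall>N. cost b N \<le> C' * (N+1) ^ d'" by blast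
    have "cost (Ad a b) N \<le> (C + C' + 1) * (N+1) ^ (d + d')" for N
      using *[rule_format, of N] mono[of C C d "d+d'" N] mono[of C' C' d' "d+d'" N] one[of 1 N "d+d'"]
      unfolding cost.simps add_mult_distrib by linarith
    then show ?case by blast
  next
    case (Sb a b)
    then obtain C d C' d' where *: "\<forall>N. cost a N \<le> C * (N+1) ^ d" "\<forall>N. cost b N \<le> C' * (N+1) ^ d'" by blast
    have "cost (Sb a b) N \<le> (C + C' + 1) * (N+1) ^ (d + d')" for N
      using *[rule_format, of N] mono[of C C d "d+d'" N] mono[of C' C' d' "d+d'" N] one[of 1 N "d+d'"]
      unfolding cost.simps add_mult_distrib by linarith
    then show ?case by blast
  next
    case (SubE a n b)
    then obtain C d C' d' where *: "\<forall>N. cost a N \<le> C * (N+1) ^ d" "\<forall>N. cost b N \<le> C' * (N+1) ^ d'" by blast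
    have "cost (SubE a n b) N \<le> (C + C' + 1) * (N+1) ^ (d + d')" for N
      using *[rule_format, of N] mono[of C C d "d+d'" N] mono[of C' C' d' "d+d'" N] one[of 1 N "d+d'"]
      unfolding cost.simps add_mult_distrib by linarith
    then show ?case by blast
  next
    case (Ite a b e)
    then obtain C d C' d' C2 d2 where *: "\<forall>N. cost a N \<le> C * (N+1) ^ d" "\<forall>N. cost b N \<le> C' * (N+1) ^ d'"
      "\<forall>N. cost e N \<le> C2 * (N+1) ^ d2" by blast
    have "cost (Ite a b e) N \<le> (C + C' + C2 + 1) * (N+1) ^ (d + d' + d2)" for N
      using *[rule_format, of N] mono[of C C d "d+d'+d2" N] mono[of C' C' d' "d+d'+d2" N]
        mono[of C2 C2 d2 "d+d'+d2" N] one[of 1 N "d+d'+d2"]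
      unfolding cost.simps add_mult_distrib by linarith
    then show ?case by blast
  next
    case (MuE a b)
    then obtain C d C' d' where *: "\<forall>N. cost a N \<le> C * (N+1) ^ d" "\<forall>N. cost b N \<le> C' * (N+1) ^ d'" by blast
    have "cost (MuE a b) N \<le> (C + 4 + (C' + 3)) * (N+1) ^ (d + (d'+1))" for N
    proof -
      have "cost b N + 3 \<le> (C' + 3) * (N+1) ^ d'" using *(2)[rule_format, of N] one[of 3 N d'] unfolding add_mult_distrib by linarith
      then have "N * (cost b N + 3) \<le> (N+1) * ((C' + 3) * (N+1) ^ d')" by (intro mult_le_mono) auto
      also have "\<dots> = (C' + 3) * (N+1) ^ (d'+1)" by (simp only: power_add power_one_right mult_ac)
      finally show ?thesis
        using *(1)[rule_format, of N] mono[of C C d "d+(d'+1)" N] mono[of "C'+3" "C'+3" "d'+1" "d+(d'+1)" N] one[of 4 N "d+(d'+1)"]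
        unfolding cost.simps add_mult_distrib by linarith
    qed
    then show ?case by blast
  next
    case (LoopE a b)
    then obtain C d C' d' where *: "\<forall>N. cost a N \<le> C * (N+1) ^ d" "\<forall>N. cost b N \<le> C' * (N+1) ^ d'" by blast
    have "cost (LoopE a b) N \<le> (C + 4 + (C' + 3)) * (N+1) ^ (d + (d'+1))" for N
    proof -
      have "cost b N + 3 \<le> (C' + 3) * (N+1) ^ d'" using *(2)[rule_format, of N] one[of 3 N d'] unfolding add_mult_distrib by linarith
      then have "N * (cost b N + 3) \<le> (N+1) * ((C' + 3) * (N+1) ^ d')" by (intro mult_le_mono) auto
      also have "\<dots> = (C' + 3) * (N+1) ^ (d'+1)" by (simp only: power_add power_one_right mult_ac)
      finally show ?thesis
        using *(1)[rule_format, of N] mono[of C C d "d+(d'+1)" N] mono[of "C'+3" "C'+3" "d'+1" "d+(d'+1)" N] one[of 4 N "d+(d'+1)"]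
        unfolding cost.simps add_mult_distrib by linarith
    qed
    then show ?case by blast
  qed
qed

section \<open>Correctness and running time of compiled expressions\<close>

definition same :: "nat \<Rightarrow> state \<Rightarrow> state \<Rightarrow> bool" where
  "same r s s' \<longleftrightarrow> mem s' = mem s \<and> (\<forall>i<r. reg s' i = reg s i)"

lemma eval_same: "same 16 s s' \<Longrightarrow> eval e s' c = eval e s c"
  by (induction e arbitrary: c) (simp_all add: same_def)

lemma same_refl [simp]: "same r s s" by (simp add: same_def)
lemma same_trans: "same r s s' \<Longrightarrow> same r s' s'' \<Longrightarrow> same r s s''" by (simp add: same_def)
lemma same_map: "same r s s' \<Longrightarrow> \<forall>i\<in>set rs. i < r \<Longrightarrow> map (reg s') rs = map (reg s) rs" by (simp add: same_def)

definition runs :: "com \<Rightarrow> state \<Rightarrow> nat \<Rightarrow> (state \<Rightarrow> bool) \<Rightarrow> bool" where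
  "runs c s T P \<longleftrightarrow> (\<exists>t s'. exec c s t s' \<and> t \<le> T \<and> P s')"

lemma runs_Seq: "runs c s T P \<Longrightarrow> (\<And>s'. P s' \<Longrightarrow> runs d s' T' R) \<Longrightarrow> runs (Seq c d) s (T + T') R"
  unfolding runs_def by (meson add_mono exec.Seq)
lemma runs_Assign: "P (s\<lparr>reg := (reg s)(i := eval_exp a s)\<rparr>) \<Longrightarrow> 1 \<le> T \<Longrightarrow> runs (Assign i a) s T P"
  unfolding runs_def using exec.Assign by blast
lemma runs_Skip: "P s \<Longrightarrow> 1 \<le> T \<Longrightarrow> runs Skip s T P"
  unfolding runs_def using exec.Skip by blast
lemma runs_If: "(eval_exp a s \<noteq> 0 \<Longrightarrow> runs c s T P) \<Longrightarrow> (eval_exp a s = 0 \<Longrightarrow> runs d s T P) \<Longrightarrow> runs (If a c d) s (T + 1) P"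
  unfolding runs_def by (cases "eval_exp a s = 0") (auto intro: exec.IfTrue exec.IfFalse Suc_le_mono[THEN iffD2])
lemma runs_mono: "runs c s T P \<Longrightarrow> T \<le> T' \<Longrightarrow> (\<And>s'. P s' \<Longrightarrow> P' s') \<Longrightarrow> runs c s T' P'"
  unfolding runs_def by (meson le_trans)

text \<open>\<open>I j\<close> is the invariant when \<open>j\<close> iterations remain.\<close>

lemma runs_While:
  assumes "\<And>j s. I (Suc j) s \<Longrightarrow> eval_exp a s \<noteq> 0 \<Longrightarrow> runs c s T (\<lambda>s'. \<exists>i\<le>j. I i s')"
    and "\<And>s. I 0 s \<Longrightarrow> eval_exp a s = 0"
    and "I j s"
  shows "runs (While a c) s (1 + j * (T + 1)) (\<lambda>s'. \<exists>i\<le>j. I i s' \<and> eval_exp a s' = 0)"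
  using assms(3)
proof (induction j arbitrary: s rule: less_induct)
  case (less j)
  show ?case
  proof (cases "eval_exp a s = 0")
    case True
    then show ?thesis unfolding runs_def using exec.WhileFalse[OF True] less(2) by fastforce
  next
    case False
    then obtain j' where j: "j = Suc j'" using assms(2) less(2) by (cases j) auto
    obtain t s' i where 1: "exec c s t s'" "t \<le> T" "i \<le> j'" "I i s'" using assms(1)[of j' s] less(2) j False unfolding runs_def by blast
    obtain t' s'' i' where 2: "exec (While a c) s' t' s''" "t' \<le> 1 + i * (T + 1)" "i' \<le> i" "I i' s''" "eval_exp a s'' = 0"
      using less(1)[of i s'] 1 j unfolding runs_def by auto
    have "exec (While a c) s (Suc (t + t')) s''" using exec.WhileTrue[OF False 1(1) 2(1)] .
    moreover have "i * (T+1) \<le> j' * (T+1)" using 1 by (intro mult_le_mono) auto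
    then have "Suc (t + t') \<le> 1 + j * (T + 1)" using 1 2 j by simp
    moreover have "i' \<le> j" using 2 1 j by simp
    ultimately show ?thesis unfolding runs_def using 2(4,5) by blast
  qed
qed

text \<open>Subterms evaluated while \<open>r\<close> or \<open>r + 1\<close> holds something of
  value write to later registers only, so partial results, loop counters and bound variables
  survive.\<close>

lemma compile_runs:
  assumes "16 \<le> r" "\<forall>i\<in>set rs. i < r"
  shows "runs (compile e rs r) s (cost e (reg s 2)) (\<lambda>s'. same r s s' \<and> reg s' r = eval e s (map (reg s) rs))"
  using assms
proof (induction e arbitrary: rs r s)
  case Hd then show ?case by (auto intro!: runs_Assign simp: same_def hd_map hd0_def)
next
  case (Wk e)
  have "\<forall>i\<in>set (tl rs). i < r" using Wk.prems(2) by (cases rs) auto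
  then show ?case using Wk.IH[of r "tl rs" s] Wk.prems(1) by (simp add: map_tl)
next
  case (Cst a) then show ?case by (auto intro!: runs_Assign simp: same_def)
next
  case (Glb i) then show ?case by (auto intro!: runs_Assign simp: same_def)
next
  case (Rd e)
  show ?case unfolding compile.simps cost.simps
    by (rule runs_Seq[OF Rd.IH[OF Rd.prems]]) (auto intro!: runs_Assign simp: same_def)
next
  case (Ad a b)
  show ?case unfolding compile.simps cost.simps add.assoc
  proof (rule runs_Seq[OF Ad.IH(1)[OF Ad.prems]])
    fix s' assume 1: "same r s s' \<and> reg s' r = eval a s (map (reg s) rs)"
    have 16: "same 16 s s'" "reg s' 2 = reg s 2" using 1 Ad.prems by (auto simp: same_def)
    have rs: "map (reg s') rs = map (reg s) rs" using same_map 1 Ad.prems by blast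
    show "runs (Seq (compile b rs (r + 1)) (Assign r (Plus (Reg r) (Reg (r + 1))))) s' (cost b (reg s 2) + 1)
      (\<lambda>s'. same r s s' \<and> reg s' r = eval (Ad a b) s (map (reg s) rs))"
      using Ad.IH(2)[of "r+1" rs s'] Ad.prems 1 less_SucI[of _ r]
      by (intro runs_Seq[of _ _ _ "\<lambda>s''. same (r+1) s' s'' \<and> reg s'' (r+1) = eval b s' (map (reg s') rs)"])
        (auto intro!: runs_Assign simp: 16(2) rs eval_same[OF 16(1)] same_def)
  qed
next
  case (Sb a b)
  show ?case unfolding compile.simps cost.simps add.assoc
  proof (rule runs_Seq[OF Sb.IH(1)[OF Sb.prems]])
    fix s' assume 1: "same r s s' \<and> reg s' r = eval a s (map (reg s) rs)"
    have 16: "same 16 s s'" "reg s' 2 = reg s 2" using 1 Sb.prems by (auto simp: same_def)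
    have rs: "map (reg s') rs = map (reg s) rs" using same_map 1 Sb.prems by blast
    show "runs (Seq (compile b rs (r + 1)) (Assign r (Minus (Reg r) (Reg (r + 1))))) s' (cost b (reg s 2) + 1)
      (\<lambda>s'. same r s s' \<and> reg s' r = eval (Sb a b) s (map (reg s) rs))"
      using Sb.IH(2)[of "r+1" rs s'] Sb.prems 1 less_SucI[of _ r]
      by (intro runs_Seq[of _ _ _ "\<lambda>s''. same (r+1) s' s'' \<and> reg s'' (r+1) = eval b s' (map (reg s') rs)"])
        (auto intro!: runs_Assign simp: 16(2) rs eval_same[OF 16(1)] same_def)
  qed
next
  case (SubE a n b)
  show ?case unfolding compile.simps cost.simps add.assoc
  proof (rule runs_Seq[OF SubE.IH(1)[OF SubE.prems]])
    fix s' assume 1: "same r s s' \<and> reg s' r = eval a s (map (reg s) rs)"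
    have 16: "same 16 s s'" "reg s' 2 = reg s 2" using 1 SubE.prems by (auto simp: same_def)
    have rs: "map (reg s') rs = map (reg s) rs" using same_map 1 SubE.prems by blast
    have rs': "map (reg s') (r # drop n rs) = eval a s (map (reg s) rs) # drop n (map (reg s) rs)"
      using 1 by (simp only: list.map drop_map[symmetric] rs)
    have l: "\<forall>i\<in>set (r # drop n rs). i < r + 1" using SubE.prems by (auto dest: in_set_dropD simp: less_SucI)
    show "runs (Seq (compile b (r # drop n rs) (r + 1)) (Assign r (Reg (r + 1)))) s' (cost b (reg s 2) + 1)
      (\<lambda>s'. same r s s' \<and> reg s' r = eval (SubE a n b) s (map (reg s) rs))"
    proof (rule runs_Seq)
      show "runs (compile b (r # drop n rs) (r + 1)) s' (cost b (reg s 2))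
        (\<lambda>s''. same (r+1) s' s'' \<and> reg s'' (r+1) = eval (SubE a n b) s (map (reg s) rs))"
        using SubE.IH(2)[of "r+1" "r # drop n rs" s', OF _ l] SubE.prems(1)
        by (simp only: 16(2) rs' eval_same[OF 16(1)] eval.simps)
      fix s'' assume "same (r+1) s' s'' \<and> reg s'' (r+1) = eval (SubE a n b) s (map (reg s) rs)"
      then show "runs (Assign r (Reg (r + 1))) s'' 1 (\<lambda>s'. same r s s' \<and> reg s' r = eval (SubE a n b) s (map (reg s) rs))"
        using 1 by (intro runs_Assign) (auto simp: same_def)
    qed
  qed
next
  case (Ite a b d)
  show ?case unfolding compile.simps cost.simps add.assoc
  proof (rule runs_Seq[OF Ite.IH(1)[OF Ite.prems]])
    fix s' assume 1: "same r s s' \<and> reg s' r = eval a s (map (reg s) rs)"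
    have 16: "same 16 s s'" "reg s' 2 = reg s 2" using 1 Ite.prems by (auto simp: same_def)
    have rs: "map (reg s') rs = map (reg s) rs" using same_map 1 Ite.prems by blast
    have "runs (compile b rs r) s' (cost b (reg s 2) + cost d (reg s 2)) (\<lambda>s''. same r s s'' \<and> reg s'' r = eval b s (map (reg s) rs))"
      by (rule runs_mono[OF Ite.IH(2)[OF Ite.prems]])
        (use 1 in \<open>auto simp: 16(2) rs eval_same[OF 16(1)] intro: same_trans\<close>)
    moreover have "runs (compile d rs r) s' (cost b (reg s 2) + cost d (reg s 2)) (\<lambda>s''. same r s s'' \<and> reg s'' r = eval d s (map (reg s) rs))"
      by (rule runs_mono[OF Ite.IH(3)[OF Ite.prems]])
        (use 1 in \<open>auto simp: 16(2) rs eval_same[OF 16(1)] intro: same_trans\<close>)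
    ultimately show "runs (If (Reg r) (compile b rs r) (compile d rs r)) s' (cost b (reg s 2) + (cost d (reg s 2) + 1))
      (\<lambda>s'. same r s s' \<and> reg s' r = eval (Ite a b d) s (map (reg s) rs))"
      unfolding add.assoc[symmetric] using 1 by (intro runs_If) auto
  qed
next
  case (MuE b p)
  let ?c = "map (reg s) rs" and ?N = "reg s 2"
  define M where "M = min (eval b s ?c) ?N"
  define P where "P i \<longleftrightarrow> eval p s (i # ?c) \<noteq> 0" for i
  \<comment> \<open>The loop stops when the counter in \<open>r + 1\<close> meets \<open>r\<close>.
    Success lowers \<open>r\<close> to the counter, failure lets the counter climb to
    \<open>M\<close>; either way \<open>r\<close> holds the value of \<open>mu\<close>.\<close>
  define I where "I j s' \<longleftrightarrow> same r s s' \<and> reg s' (r+1) \<le> reg s' r \<and> reg s' r - reg s' (r+1) \<le> j \<and> reg s' r \<le> M \<and>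
      (\<forall>i<reg s' (r+1). \<not> P i) \<and> (reg s' r = M \<or> reg s' (r+1) = reg s' r \<and> P (reg s' r))" for j s'
  have step: "runs (Seq (compile p ((r+1) # rs) (r+2))
           (If (Reg (r+2)) (Assign r (Reg (r+1))) (Assign (r+1) (Plus (Reg (r+1)) (Num 1))))) s1 (cost p ?N + 2)
           (\<lambda>s'. \<exists>i\<le>j. I i s')" if I: "I (Suc j) s1" and ne: "eval_exp (Minus (Reg r) (Reg (r+1))) s1 \<noteq> 0" for j s1
  proof -
    from I ne have sm: "same r s s1" and y: "reg s1 r = M" and x: "reg s1 (r+1) < M" "M - reg s1 (r+1) \<le> Suc j" "\<forall>i<reg s1 (r+1). \<not> P i"
      by (auto simp: I_def)
    have 16: "same 16 s s1" "reg s1 2 = ?N" using sm MuE.prems by (auto simp: same_def)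
    have rs0: "map (reg s1) rs = ?c" by (rule same_map[OF sm MuE.prems(2)])
    show ?thesis
    proof (rule runs_Seq)
      show "runs (compile p ((r+1) # rs) (r+2)) s1 (cost p ?N)
        (\<lambda>s'. same (r+2) s1 s' \<and> (reg s' (r+2) \<noteq> 0 \<longleftrightarrow> P (reg s1 (r+1))))"
        by (rule runs_mono[OF MuE.IH(2)[of "r+2" "(r+1) # rs" s1]])
          (use MuE.prems in \<open>auto simp: 16(2) P_def rs0 eval_same[OF 16(1)]\<close>)
      fix s2 assume 2: "same (r+2) s1 s2 \<and> (reg s2 (r+2) \<noteq> 0 \<longleftrightarrow> P (reg s1 (r+1)))"
      have r: "reg s2 r = M" "reg s2 (r+1) = reg s1 (r+1)" "same r s s2"
        using 2 y sm by (auto simp: same_def)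
      have "I 0 (s2\<lparr>reg := (reg s2)(r := reg s2 (r+1))\<rparr>)" if "reg s2 (r+2) \<noteq> 0"
        using r x 2 that by (auto simp: I_def same_def)
      moreover
      have "I j (s2\<lparr>reg := (reg s2)(r+1 := reg s2 (r+1) + 1)\<rparr>)" if "reg s2 (r+2) = 0"
        using r x 2 that by (auto simp: I_def same_def less_Suc_eq)
      ultimately have I': "reg s2 (r+2) \<noteq> 0 \<Longrightarrow> I 0 (s2\<lparr>reg := (reg s2)(r := reg s2 (r+1))\<rparr>)"
        "reg s2 (r+2) = 0 \<Longrightarrow> I j (s2\<lparr>reg := (reg s2)(r+1 := reg s2 (r+1) + 1)\<rparr>)" by blast+
      have a1: "runs (Assign r (Reg (r+1))) s2 1 (\<lambda>s'. \<exists>i\<le>j. I i s')" if "eval_exp (Reg (r+2)) s2 \<noteq> 0"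
        by (rule runs_Assign) (use I'(1) that in auto)
      have a2: "runs (Assign (r+1) (Plus (Reg (r+1)) (Num 1))) s2 1 (\<lambda>s'. \<exists>i\<le>j. I i s')" if "eval_exp (Reg (r+2)) s2 = 0"
        by (rule runs_Assign) (use I'(2) that in auto)
      show "runs (If (Reg (r+2)) (Assign r (Reg (r+1))) (Assign (r+1) (Plus (Reg (r+1)) (Num 1)))) s2 2 (\<lambda>s'. \<exists>i\<le>j. I i s')"
        using runs_If[where a="Reg (r+2)", OF a1 a2] by (simp add: numeral_2_eq_2)
    qed
  qed
  have fin: "reg s' r = eval (MuE b p) s ?c" if "I i s'" "eval_exp (Minus (Reg r) (Reg (r+1))) s' = 0" for i s'
  proof -
    from that have "\<forall>i<reg s' r. \<not> P i" "reg s' r = M \<or> P (reg s' r)" "reg s' r \<le> M" by (auto simp: I_def)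
    then have "mu M P = reg s' r" unfolding mu_def
      by (intro Least_equality) (auto simp: not_less[symmetric])
    then show ?thesis by (simp add: M_def P_def[abs_def])
  qed
  have w: "runs (While (Minus (Reg r) (Reg (r+1)))
         (Seq (compile p ((r+1) # rs) (r+2))
           (If (Reg (r+2)) (Assign r (Reg (r+1))) (Assign (r+1) (Plus (Reg (r+1)) (Num 1)))))) s1 (1 + ?N * (cost p ?N + 3))
         (\<lambda>s'. same r s s' \<and> reg s' r = eval (MuE b p) s ?c)" if "I M s1" for s1
  proof (rule runs_mono[OF runs_While[where I=I and T="cost p ?N + 2" and j=M, OF step _ that]])
    have "M * (cost p ?N + 3) \<le> ?N * (cost p ?N + 3)" by (rule mult_le_mono1) (simp add: M_def)
    then show "1 + M * (cost p ?N + 2 + 1) \<le> 1 + ?N * (cost p ?N + 3)" by (simp add: algebra_simps)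
    show "same r s s' \<and> reg s' r = eval (MuE b p) s ?c"
      if ex: "\<exists>i\<le>M. I i s' \<and> eval_exp (Minus (Reg r) (Reg (r+1))) s' = 0" for s'
    proof -
      obtain i where i: "I i s'" "eval_exp (Minus (Reg r) (Reg (r+1))) s' = 0" using ex by blast
      show ?thesis using fin[OF i] i(1) unfolding I_def by blast
    qed
  qed (auto simp: I_def)
  show ?case unfolding compile.simps
  proof (rule runs_mono[OF runs_Seq[OF MuE.IH(1)[OF MuE.prems]]])
    fix s1 assume 1: "same r s s1 \<and> reg s1 r = eval b s ?c"
    have N: "reg s1 2 = ?N" using 1 MuE.prems by (auto simp: same_def)
    show "runs (Seq (If (Minus (Reg r) (Reg 2)) (Assign r (Reg 2)) Skip) (Seq (Assign (r+1) (Num 0))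
       (While (Minus (Reg r) (Reg (r+1))) (Seq (compile p ((r+1) # rs) (r+2))
           (If (Reg (r+2)) (Assign r (Reg (r+1))) (Assign (r+1) (Plus (Reg (r+1)) (Num 1)))))))) s1
       ((1+1) + (1 + (1 + ?N * (cost p ?N + 3)))) (\<lambda>s'. same r s s' \<and> reg s' r = eval (MuE b p) s ?c)"
    proof (rule runs_Seq)
      show "runs (If (Minus (Reg r) (Reg 2)) (Assign r (Reg 2)) Skip) s1 (1+1) (\<lambda>s'. same r s s' \<and> reg s' r = M)"
        by (rule runs_If, rule runs_Assign, use 1 N in \<open>simp_all add: same_def M_def\<close>, rule runs_Skip)
          (use 1 N in \<open>simp_all add: same_def M_def\<close>)
      fix s2 assume 2: "same r s s2 \<and> reg s2 r = M"
      show "runs (Seq (Assign (r+1) (Num 0))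
       (While (Minus (Reg r) (Reg (r+1))) (Seq (compile p ((r+1) # rs) (r+2))
           (If (Reg (r+2)) (Assign r (Reg (r+1))) (Assign (r+1) (Plus (Reg (r+1)) (Num 1))))))) s2 (1 + (1 + ?N * (cost p ?N + 3)))
         (\<lambda>s'. same r s s' \<and> reg s' r = eval (MuE b p) s ?c)"
        by (rule runs_Seq[where P="I M"], rule runs_Assign) (use 2 w in \<open>simp_all add: I_def same_def\<close>)
    qed
  qed auto
next
  case (LoopE a b)
  let ?c = "map (reg s) rs" and ?N = "reg s 2"
  define R where "R x = rec_nat (eval a s ?c) (\<lambda>t x. eval b s (t # x # ?c)) x" for x
  define I where "I j s' \<longleftrightarrow> same r s s' \<and> reg s' (r+1) \<le> ?N \<and> ?N - reg s' (r+1) \<le> j \<and> reg s' r = R (reg s' (r+1))" for j s'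
  have step: "runs (Seq (compile b ((r+1) # r # rs) (r+2))
         (Seq (Assign r (Reg (r+2))) (Assign (r+1) (Plus (Reg (r+1)) (Num 1))))) s1 (cost b ?N + (1 + 1))
           (\<lambda>s'. \<exists>i\<le>j. I i s')" if I: "I (Suc j) s1" and ne: "eval_exp (Minus (Reg 2) (Reg (r+1))) s1 \<noteq> 0" for j s1
  proof -
    from I have sm: "same r s s1" by (simp add: I_def)
    have 16: "same 16 s s1" "reg s1 2 = ?N" using sm LoopE.prems by (auto simp: same_def)
    have rs0: "map (reg s1) rs = ?c" by (rule same_map[OF sm LoopE.prems(2)])
    show ?thesis
    proof (rule runs_Seq)
      show "runs (compile b ((r+1) # r # rs) (r+2)) s1 (cost b ?N)
        (\<lambda>s'. same (r+2) s1 s' \<and> reg s' (r+2) = R (Suc (reg s1 (r+1))))"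
        by (rule runs_mono[OF LoopE.IH(2)[of "r+2" "(r+1) # r # rs" s1]])
          (use LoopE.prems I in \<open>auto simp: 16(2) I_def R_def rs0 eval_same[OF 16(1)]\<close>)
      fix s2 assume 2: "same (r+2) s1 s2 \<and> reg s2 (r+2) = R (Suc (reg s1 (r+1)))"
      show "runs (Seq (Assign r (Reg (r+2))) (Assign (r+1) (Plus (Reg (r+1)) (Num 1)))) s2 (1 + 1) (\<lambda>s'. \<exists>i\<le>j. I i s')"
      proof (rule runs_Seq)
        show "runs (Assign r (Reg (r+2))) s2 1 (\<lambda>s'. same r s s' \<and> reg s' r = R (Suc (reg s1 (r+1))) \<and> reg s' (r+1) = reg s1 (r+1))"
          by (rule runs_Assign) (use 2 sm in \<open>auto simp: same_def\<close>)
        fix s3 assume 3: "same r s s3 \<and> reg s3 r = R (Suc (reg s1 (r+1))) \<and> reg s3 (r+1) = reg s1 (r+1)"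
        have "I j (s3\<lparr>reg := (reg s3)(r+1 := reg s3 (r+1) + 1)\<rparr>)"
          using 3 I ne 16 by (auto simp: I_def same_def)
        then show "runs (Assign (r+1) (Plus (Reg (r+1)) (Num 1))) s3 1 (\<lambda>s'. \<exists>i\<le>j. I i s')"
          by (intro runs_Assign) auto
      qed
    qed
  qed
  have r2: "2 < r" using LoopE.prems by simp
  have w: "runs (While (Minus (Reg 2) (Reg (r+1))) (Seq (compile b ((r+1) # r # rs) (r+2))
         (Seq (Assign r (Reg (r+2))) (Assign (r+1) (Plus (Reg (r+1)) (Num 1)))))) s1 (1 + ?N * (cost b ?N + 3))
         (\<lambda>s'. same r s s' \<and> reg s' r = eval (LoopE a b) s ?c)" if "I ?N s1" for s1
  proof (rule runs_mono[OF runs_While[where I=I and T="cost b ?N + (1 + 1)" and j="?N", OF step _ that]])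
    show "1 + ?N * (cost b ?N + (1+1) + 1) \<le> 1 + ?N * (cost b ?N + 3)" by (simp add: algebra_simps)
    show "same r s s' \<and> reg s' r = eval (LoopE a b) s ?c"
      if "\<exists>i\<le>?N. I i s' \<and> eval_exp (Minus (Reg 2) (Reg (r+1))) s' = 0" for s'
    proof -
      from that obtain i where i: "I i s'" "reg s' 2 - reg s' (r+1) = 0" by auto
      then have "reg s' (r+1) = ?N" using r2 by (auto simp: I_def same_def)
      then show ?thesis using i by (simp add: I_def R_def)
    qed
  qed (use r2 in \<open>auto simp: I_def same_def\<close>)
  show ?case unfolding compile.simps
  proof (rule runs_mono[OF runs_Seq[OF LoopE.IH(1)[OF LoopE.prems]]])
    fix s1 assume 1: "same r s s1 \<and> reg s1 r = eval a s ?c"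
    show "runs (Seq (Assign (r+1) (Num 0)) (While (Minus (Reg 2) (Reg (r+1))) (Seq (compile b ((r+1) # r # rs) (r+2))
         (Seq (Assign r (Reg (r+2))) (Assign (r+1) (Plus (Reg (r+1)) (Num 1))))))) s1 (1 + (1 + ?N * (cost b ?N + 3)))
         (\<lambda>s'. same r s s' \<and> reg s' r = eval (LoopE a b) s ?c)"
      by (rule runs_Seq[where P="I ?N"], rule runs_Assign) (use 1 w in \<open>auto simp: I_def same_def R_def\<close>)
  qed auto
qed

text \<open>Expressions are never written out for the solver: closure rules build them along the
  structure of the HOL term. \<open>OK\<close> carries the bounds on registers under which clocked
  searches are complete.\<close>

definition D :: "(state \<Rightarrow> bool) \<Rightarrow> (state \<Rightarrow> nat list \<Rightarrow> nat) \<Rightarrow> bool" where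
  "D OK F \<longleftrightarrow> (\<exists>e. \<forall>s c. OK s \<longrightarrow> eval e s c = F s c)"
definition DP :: "(state \<Rightarrow> bool) \<Rightarrow> (state \<Rightarrow> nat list \<Rightarrow> bool) \<Rightarrow> bool" where
  "DP OK P \<longleftrightarrow> D OK (\<lambda>s c. if P s c then 1 else 0)"

section \<open>Closure properties of definability\<close>

lemma D_I: "(\<And>s c. OK s \<Longrightarrow> eval e s c = F s c) \<Longrightarrow> D OK F" unfolding D_def by blast

lemma D_cong: "D OK F \<Longrightarrow> (\<And>s c. OK s \<Longrightarrow> F s c = F' s c) \<Longrightarrow> D OK F'" unfolding D_def by simp
lemma DP_cong: "DP OK F \<Longrightarrow> (\<And>s c. OK s \<Longrightarrow> F s c = F' s c) \<Longrightarrow> DP OK F'" unfolding DP_def D_def by simp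

lemma D_hd: "D OK (\<lambda>s c. hd0 c)" by (rule D_I[of _ Hd]) simp
lemma D_wk:
  assumes "D OK F"
  shows "D OK (\<lambda>s c. F s (tl c))"
proof -
  obtain e where e: "\<And>s c. OK s \<Longrightarrow> eval e s c = F s c" using assms(1) unfolding D_def by blast
  show ?thesis by (rule D_I[of _ "Wk e"]) (simp add: e)
qed

lemma D_cst: "D OK (\<lambda>s c. a)" by (rule D_I[of _ "Cst a"]) simp

lemma D_glb: "i < 16 \<Longrightarrow> D OK (\<lambda>s c. reg s i)" by (rule D_I[of _ "Glb i"]) simp

lemma D_mem:
  assumes "D OK F"
  shows "D OK (\<lambda>s c. mem s (F s c))"
proof -
  obtain e where e: "\<And>s c. OK s \<Longrightarrow> eval e s c = F s c" using assms(1) unfolding D_def by blast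
  show ?thesis by (rule D_I[of _ "Rd e"]) (simp add: e)
qed

lemma D_add:
  assumes "D OK F" "D OK G"
  shows "D OK (\<lambda>s c. F s c + G s c)"
proof -
  obtain e where e: "\<And>s c. OK s \<Longrightarrow> eval e s c = F s c" using assms(1) unfolding D_def by blast
  obtain e' where e': "\<And>s c. OK s \<Longrightarrow> eval e' s c = G s c" using assms(2) unfolding D_def by blast
  show ?thesis by (rule D_I[of _ "Ad e e'"]) (simp add: e e')
qed

lemma D_sub:
  assumes "D OK F" "D OK G"
  shows "D OK (\<lambda>s c. F s c - G s c)"
proof -
  obtain e where e: "\<And>s c. OK s \<Longrightarrow> eval e s c = F s c" using assms(1) unfolding D_def by blast
  obtain e' where e': "\<And>s c. OK s \<Longrightarrow> eval e' s c = G s c" using assms(2) unfolding D_def by blast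
  show ?thesis by (rule D_I[of _ "Sb e e'"]) (simp add: e e')
qed

lemma D_if:
  assumes "DP OK P" "D OK F" "D OK G"
  shows "D OK (\<lambda>s c. if P s c then F s c else G s c)"
proof -
  obtain e where e: "\<And>s c. OK s \<Longrightarrow> eval e s c = (\<lambda>s c. if P s c then 1 else 0) s c" using assms(1) unfolding DP_def D_def by blast
  obtain e' where e': "\<And>s c. OK s \<Longrightarrow> eval e' s c = F s c" using assms(2) unfolding D_def by blast
  obtain e'' where e'': "\<And>s c. OK s \<Longrightarrow> eval e'' s c = G s c" using assms(3) unfolding D_def by blast
  show ?thesis by (rule D_I[of _ "Ite e e' e''"]) (simp add: e e' e'')
qed

lemma D_loop:
  assumes "D OK F" "D OK (\<lambda>s c. G s (tl (tl c)) (hd0 c) (hd0 (tl c)))"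
  shows "D OK (\<lambda>s c. rec_nat (F s c) (\<lambda>t x. G s c t x) (reg s 2))"
proof -
  obtain e where e: "\<And>s c. OK s \<Longrightarrow> eval e s c = F s c" using assms(1) unfolding D_def by blast
  obtain e' where e': "\<And>s c. OK s \<Longrightarrow> eval e' s c = ((\<lambda>s c. G s (tl (tl c)) (hd0 c) (hd0 (tl c)))) s c" using assms(2) unfolding D_def by blast
  show ?thesis by (rule D_I[of _ "LoopE e e'"]) (simp add: e e')
qed

text \<open>The expression cuts its search off at the clock, hence the bound on the range.\<close>

lemma D_mu:
  assumes "D OK F" "DP OK (\<lambda>s c. P s (tl c) (hd0 c))" "\<And>s c. OK s \<Longrightarrow> F s c \<le> reg s 2"
  shows "D OK (\<lambda>s c. mu (F s c) (\<lambda>i. P s c i))"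
proof -
  obtain e where e: "\<And>s c. OK s \<Longrightarrow> eval e s c = F s c" using assms(1) unfolding D_def by blast
  obtain e' where e': "\<And>s c. OK s \<Longrightarrow> eval e' s c = (\<lambda>s c. if ((\<lambda>s c. P s (tl c) (hd0 c))) s c then 1 else 0) s c" using assms(2) unfolding DP_def D_def by blast
  show ?thesis by (rule D_I[of _ "MuE e e'"]) (simp add: e e' min_absorb1 assms(3))
qed

text \<open>Used for functions as arguments: \<open>F\<close> is definable with its argument as
  innermost variable, and \<open>n\<close> counts the binders that lie between the place where
  \<open>F\<close> was formed and the place where it is applied.\<close>

lemma D_app:
  assumes "D OK (\<lambda>s c. F s (tl c) (hd0 c))" "D OK A"
  shows "D OK (\<lambda>s c. F s (drop n c) (A s c))"
proof -
  obtain e where e: "\<And>s c. OK s \<Longrightarrow> eval e s c = F s (tl c) (hd0 c)" using assms(1) unfolding D_def by blast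
  obtain e' where e': "\<And>s c. OK s \<Longrightarrow> eval e' s c = A s c" using assms(2) unfolding D_def by blast
  show ?thesis by (rule D_I[of _ "SubE e' n e"]) (simp add: e e')
qed

lemmas D_app0 = D_app[where n=0, simplified]
lemmas D_app1 = D_app[where n="Suc 0", unfolded drop_Suc drop_0]
lemmas D_app2 = D_app[where n="Suc (Suc 0)", unfolded drop_Suc drop_0]
lemma DP_less:
  assumes "D OK F" "D OK G"
  shows "DP OK (\<lambda>s c. F s c < G s c)"
proof -
  obtain e where e: "\<And>s c. OK s \<Longrightarrow> eval e s c = F s c" using assms(1) unfolding D_def by blast
  obtain e' where e': "\<And>s c. OK s \<Longrightarrow> eval e' s c = G s c" using assms(2) unfolding D_def by blast
  show ?thesis unfolding DP_def by (rule D_I[of _ "Ite (Sb e' e) (Cst 1) (Cst 0)"]) (simp add: e e')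
qed

lemma DP_le:
  assumes "D OK F" "D OK G"
  shows "DP OK (\<lambda>s c. F s c \<le> G s c)"
proof -
  obtain e where e: "\<And>s c. OK s \<Longrightarrow> eval e s c = F s c" using assms(1) unfolding D_def by blast
  obtain e' where e': "\<And>s c. OK s \<Longrightarrow> eval e' s c = G s c" using assms(2) unfolding D_def by blast
  show ?thesis unfolding DP_def by (rule D_I[of _ "Ite (Sb e e') (Cst 0) (Cst 1)"]) (simp add: e e')
qed

lemma DP_eq:
  assumes "D OK F" "D OK G"
  shows "DP OK (\<lambda>s c. F s c = (G s c :: nat))"
proof -
  obtain e where e: "\<And>s c. OK s \<Longrightarrow> eval e s c = F s c" using assms(1) unfolding D_def by blast
  obtain e' where e': "\<And>s c. OK s \<Longrightarrow> eval e' s c = G s c" using assms(2) unfolding D_def by blast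
  show ?thesis unfolding DP_def by (rule D_I[of _ "Ite (Ad (Sb e e') (Sb e' e)) (Cst 0) (Cst 1)"]) (simp add: e e')
qed

lemma DP_conj:
  assumes "DP OK P" "DP OK R"
  shows "DP OK (\<lambda>s c. P s c \<and> R s c)"
proof -
  obtain e where e: "\<And>s c. OK s \<Longrightarrow> eval e s c = (\<lambda>s c. if P s c then 1 else 0) s c" using assms(1) unfolding DP_def D_def by blast
  obtain e' where e': "\<And>s c. OK s \<Longrightarrow> eval e' s c = (\<lambda>s c. if R s c then 1 else 0) s c" using assms(2) unfolding DP_def D_def by blast
  show ?thesis unfolding DP_def by (rule D_I[of _ "Ite e e' (Cst 0)"]) (simp add: e e')
qed

lemma DP_not:
  assumes "DP OK P"
  shows "DP OK (\<lambda>s c. \<not> P s c)"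
proof -
  obtain e where e: "\<And>s c. OK s \<Longrightarrow> eval e s c = (\<lambda>s c. if P s c then 1 else 0) s c" using assms(1) unfolding DP_def D_def by blast
  show ?thesis unfolding DP_def by (rule D_I[of _ "Ite e (Cst 0) (Cst 1)"]) (simp add: e)
qed

lemma DP_imp:
  assumes "DP OK P" "DP OK R"
  shows "DP OK (\<lambda>s c. P s c \<longrightarrow> R s c)"
proof -
  obtain e where e: "\<And>s c. OK s \<Longrightarrow> eval e s c = (\<lambda>s c. if P s c then 1 else 0) s c" using assms(1) unfolding DP_def D_def by blast
  obtain e' where e': "\<And>s c. OK s \<Longrightarrow> eval e' s c = (\<lambda>s c. if R s c then 1 else 0) s c" using assms(2) unfolding DP_def D_def by blast
  show ?thesis unfolding DP_def by (rule D_I[of _ "Ite e e' (Cst 1)"]) (simp add: e e')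
qed

lemma DP_disj:
  assumes "DP OK P" "DP OK R"
  shows "DP OK (\<lambda>s c. P s c \<or> R s c)"
proof -
  obtain e where e: "\<And>s c. OK s \<Longrightarrow> eval e s c = (\<lambda>s c. if P s c then 1 else 0) s c" using assms(1) unfolding DP_def D_def by blast
  obtain e' where e': "\<And>s c. OK s \<Longrightarrow> eval e' s c = (\<lambda>s c. if R s c then 1 else 0) s c" using assms(2) unfolding DP_def D_def by blast
  show ?thesis unfolding DP_def by (rule D_I[of _ "Ite e (Cst 1) e'"]) (simp add: e e')
qed
lemma DP_const: "DP OK (\<lambda>s c. b)" unfolding DP_def by (rule D_cst)
lemma DP_iff: "DP OK P \<Longrightarrow> DP OK R \<Longrightarrow> DP OK (\<lambda>s c. P s c \<longleftrightarrow> R s c)"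
  by (rule DP_cong[OF DP_conj[OF DP_imp DP_imp], of OK P R R P]) auto
lemma DP_ex: "D OK F \<Longrightarrow> DP OK (\<lambda>s c. P s (tl c) (hd0 c)) \<Longrightarrow> (\<And>s c. OK s \<Longrightarrow> F s c \<le> reg s 2) \<Longrightarrow>
   DP OK (\<lambda>s c. \<exists>i<F s c. P s c i)"
  by (rule DP_cong[OF DP_less[OF D_mu]]) (auto simp: mu_iff)
lemma DP_all: "D OK F \<Longrightarrow> DP OK (\<lambda>s c. P s (tl c) (hd0 c)) \<Longrightarrow> (\<And>s c. OK s \<Longrightarrow> F s c \<le> reg s 2) \<Longrightarrow>
   DP OK (\<lambda>s c. \<forall>i<F s c. P s c i)"
  by (rule DP_cong[OF DP_not[OF DP_ex[OF _ DP_not]]]) auto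

lemma D_Suc: "D OK F \<Longrightarrow> D OK (\<lambda>s c. Suc (F s c))"
  using D_add[OF _ D_cst[of OK 1], of F] by simp

text \<open>Multiplication is repeated addition in a loop driven by the clock, so the first factor
  must not exceed the clock.\<close>

lemma D_mult: assumes "D OK F" "D OK G" "\<And>s c. OK s \<Longrightarrow> F s c \<le> reg s 2" shows "D OK (\<lambda>s c. F s c * G s c)"
proof -
  have "D OK (\<lambda>s c. rec_nat 0 (\<lambda>t x. if t < F s c then x + G s c else x) (reg s 2))"
    by (intro D_loop D_cst D_if DP_less D_add D_hd D_wk[OF D_hd] D_wk[OF D_wk[OF assms(1)]] D_wk[OF D_wk[OF assms(2)]])
  moreover have "rec_nat 0 (\<lambda>t x. if t < a then x + b else x) N = min a N * b" for a b N :: nat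
    by (induction N) (auto simp: min_def le_Suc_eq)
  ultimately show ?thesis using assms(3) by (auto elim!: D_cong simp: min_absorb1)
qed

lemma D_dvc: assumes "D OK F" "D OK G" "\<And>s c. OK s \<Longrightarrow> G s c \<le> reg s 2" shows "D OK (\<lambda>s c. dvc (reg s 2) (F s c) (G s c))"
  unfolding dvc_def
  by (rule D_mu, rule D_glb, simp, rule DP_less, rule D_wk[OF assms(1)], rule D_mult, rule D_wk[OF assms(2)],
    rule D_Suc, rule D_hd, rule assms(3), assumption, rule order_refl)

lemma D_mdc: assumes "D OK F" "D OK G" "\<And>s c. OK s \<Longrightarrow> G s c \<le> reg s 2" shows "D OK (\<lambda>s c. mdc (reg s 2) (F s c) (G s c))"
  unfolding mdc_def by (intro D_sub D_mult D_dvc assms)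

lemma D_digc: assumes "D OK F" "D OK G" "D OK H" "\<And>s c. OK s \<Longrightarrow> F s c \<le> reg s 2"
  shows "D OK (\<lambda>s c. digc (reg s 2) (F s c) (G s c) (H s c))"
  unfolding digc_def
  by (intro D_mdc D_loop D_if DP_less D_dvc D_hd D_wk[OF D_hd] D_wk[OF D_wk[OF assms(1)]] D_wk[OF D_wk[OF assms(2)]] assms(1-3)) (erule assms(4))+

lemmas DP_app0 = D_app0[where F="\<lambda>s c x. if P s c x then 1 else 0" for P, folded DP_def]
lemmas DP_app2 = D_app2[where F="\<lambda>s c x. if P s c x then 1 else 0" for P, folded DP_def]
text \<open>Registers: 0 length of the word, 1 parameter, 2 clock, 5 table index, 7 number of positions,
  8 code of \<open>cp\<close>, 9 bound \<open>B\<close> on positions and letters, 10 number of zone codes,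
  11 number of sets of copies, 12 flag for well-formed inputs. The table is stored behind the word.\<close>

definition OKE :: "nat \<Rightarrow> state \<Rightarrow> bool" where
  "OKE Q s \<longleftrightarrow> 2 \<le> reg s 2 \<and> Q \<le> reg s 2 \<and> reg s 1 \<le> reg s 2 \<and> reg s 7 \<le> reg s 2 \<and> reg s 9 \<le> reg s 2 \<and>
     reg s 10 \<le> reg s 2 \<and> reg s 11 \<le> reg s 2"

text \<open>The offset skips the unary vertex number of \<open>G\<close> and the separator. In
  \<open>eHs\<close> it skips the whole encoding of \<open>G\<close> and then the same kind of
  header for \<open>H\<close>.\<close>

definition eGs :: "state \<Rightarrow> nat \<Rightarrow> nat \<Rightarrow> bool" where
  "eGs s u v \<longleftrightarrow> u < reg s 7 \<and> v < reg s 7 \<and> mem s (reg s 7 * u + v + reg s 7 + 1) \<noteq> 0"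
definition eHs :: "state \<Rightarrow> nat \<Rightarrow> nat \<Rightarrow> bool" where
  "eHs s u v \<longleftrightarrow> u < reg s 1 \<and> v < reg s 1 \<and> mem s (reg s 1 * u + v + reg s 7 + 1 + reg s 7 * reg s 7 + reg s 1 + 1) \<noteq> 0"
definition cps :: "state \<Rightarrow> nat \<Rightarrow> nat" where
  "cps s h = digc (reg s 2) (reg s 11) h (reg s 8)"
text \<open>The set code is the most significant part of the address, followed by the number of
  edges; filling the memory upwards therefore follows the order required by
  \<open>entry_local\<close>.\<close>

definition tbs :: "state \<Rightarrow> nat \<Rightarrow> nat \<Rightarrow> nat \<Rightarrow> nat \<Rightarrow> nat" where
  "tbs s S j z w = (if j < reg s 9 \<and> z < reg s 10 \<and> w < reg s 9
     then mem s (reg s 0 + (w + reg s 9 * (z + reg s 10 * (j + reg s 9 * S)))) else 0)"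

lemma D_cmul: "D OK F \<Longrightarrow> D OK (\<lambda>s c. a * F s c)"
proof (induction a)
  case 0 show ?case using D_cst[of OK 0] by simp
next
  case (Suc a)
  have "D OK (\<lambda>s c. F s c + a * F s c)" by (intro D_add Suc)
  then show ?case by simp
qed

context fixes Q :: nat
begin

section \<open>Definability of the recurrence\<close>

lemma OKb: "OKE Q s \<Longrightarrow> reg s 1 \<le> reg s 2" "OKE Q s \<Longrightarrow> reg s 7 \<le> reg s 2" "OKE Q s \<Longrightarrow> reg s 9 \<le> reg s 2"
  "OKE Q s \<Longrightarrow> reg s 10 \<le> reg s 2" "OKE Q s \<Longrightarrow> reg s 11 \<le> reg s 2" "OKE Q s \<Longrightarrow> 2 \<le> reg s 2" "OKE Q s \<Longrightarrow> Q \<le> reg s 2"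
  "OKE Q s \<Longrightarrow> reg s 2 \<le> reg s 2"
  by (simp_all add: OKE_def)

lemma glb: "D (OKE Q) (\<lambda>s c. reg s 0)" "D (OKE Q) (\<lambda>s c. reg s 1)" "D (OKE Q) (\<lambda>s c. reg s 2)" "D (OKE Q) (\<lambda>s c. reg s 5)"
  "D (OKE Q) (\<lambda>s c. reg s 7)" "D (OKE Q) (\<lambda>s c. reg s 8)" "D (OKE Q) (\<lambda>s c. reg s 9)" "D (OKE Q) (\<lambda>s c. reg s 10)"
  "D (OKE Q) (\<lambda>s c. reg s 11)"
  by (rule D_glb; simp)+

lemma D_eGs: "D (OKE Q) F \<Longrightarrow> D (OKE Q) G \<Longrightarrow> DP (OKE Q) (\<lambda>s c. eGs s (F s c) (G s c))"
  unfolding eGs_def by (intro DP_conj DP_less DP_not DP_eq D_mem D_add D_mult D_cst glb; (assumption | erule OKb))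

lemma D_eHs: "D (OKE Q) F \<Longrightarrow> D (OKE Q) G \<Longrightarrow> DP (OKE Q) (\<lambda>s c. eHs s (F s c) (G s c))"
  unfolding eHs_def by (intro DP_conj DP_less DP_not DP_eq D_mem D_add D_mult D_cst glb; (assumption | erule OKb))

lemma D_cps: "D (OKE Q) F \<Longrightarrow> D (OKE Q) (\<lambda>s c. cps s (F s c))"
  unfolding cps_def by (intro D_digc glb; (assumption | erule OKb))

lemma D_tbs: "D (OKE Q) S \<Longrightarrow> D (OKE Q) J \<Longrightarrow> D (OKE Q) Z \<Longrightarrow> D (OKE Q) W \<Longrightarrow> D (OKE Q) (\<lambda>s c. tbs s (S s c) (J s c) (Z s c) (W s c))"
  unfolding tbs_def by (intro D_if DP_conj DP_less D_mem D_add D_mult D_cst glb; (assumption | erule OKb))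

lemma D_part: "D (OKE Q) F \<Longrightarrow> D (OKE Q) G \<Longrightarrow> D (OKE Q) H \<Longrightarrow> D (OKE Q) (\<lambda>s c. part (F s c) (G s c) (H s c))"
  unfolding part_def min_def max_def by (intro D_if DP_less DP_le DP_eq D_cst)

lemma D_merge:
  assumes "D (OKE Q) (\<lambda>s c. C s (tl c) (hd0 c))" "D (OKE Q) (\<lambda>s c. G s (tl c) (hd0 c))" "D (OKE Q) W"
  shows "D (OKE Q) (\<lambda>s c. merge Q (C s c) (G s c) (W s c))"
proof -
  \<comment> \<open>Phrased by \<open>mu\<close>, the least index becomes a bounded search, with
    \<open>Q\<close> itself signalling that no interval contains \<open>w\<close>.\<close>
  have eq: "merge Q c g w = (if mu Q (\<lambda>i. c (3*i) \<le> w \<and> w < c (3*i+1)) < Q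
      then c (3 * mu Q (\<lambda>i. c (3*i) \<le> w \<and> w < c (3*i+1)) + 2) else g w)" for c g :: "nat \<Rightarrow> nat" and w
  proof -
    let ?P = "\<lambda>i. c (3*i) \<le> w \<and> w < c (3*i+1)"
    have "(LEAST i. i < Q \<and> ?P i) = mu Q ?P" if "mu Q ?P < Q"
      using that mu_P[OF that] unfolding mu_def
      by (intro Least_equality) (auto intro!: Least_le)
    then show ?thesis unfolding merge_def mu_iff[symmetric] by (intro if_cong refl) auto
  qed
  have m: "D (OKE Q) (\<lambda>s c. mu Q (\<lambda>i. C s c (3*i) \<le> W s c \<and> W s c < C s c (3*i+1)))"
    by (intro D_mu D_cst DP_conj DP_le DP_less D_wk[OF assms(3)] D_app1[OF assms(1)] D_add D_cmul D_hd) (erule OKb)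
  show ?thesis unfolding eq
    by (intro D_if DP_less D_cst m D_app0[OF assms(1)] D_app0[OF assms(2)] D_add D_cmul assms(3))
qed

abbreviation "i_inz s \<equiv> instances.inz"
abbreviation "i_dom s \<equiv> instances.dom (reg s 7) Q"
abbreviation "i_alw s \<equiv> instances.alw (reg s 1) (cps s) Q"
abbreviation "i_valid s \<equiv> instances.valid (reg s 7) (reg s 1) (eGs s) (eHs s) (cps s) Q"
abbreviation "i_okP s \<equiv> instances.okP (reg s 7) (reg s 1) (eGs s) (eHs s) (cps s) Q"

lemma D_inz: "D (OKE Q) (\<lambda>s c. z s (tl c) (hd0 c)) \<Longrightarrow> D (OKE Q) i \<Longrightarrow> D (OKE Q) w \<Longrightarrow> DP (OKE Q) (\<lambda>s c. instances.inz (z s c) (i s c) (w s c))"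
  unfolding instances.inz_def by (intro DP_conj DP_le DP_less D_app0[where F=z] D_add D_cmul D_cst)
lemma D_inr: "D (OKE Q) (\<lambda>s c. z s (tl c) (hd0 c)) \<Longrightarrow> D (OKE Q) i \<Longrightarrow> D (OKE Q) w \<Longrightarrow> DP (OKE Q) (\<lambda>s c. instances.inr (z s c) (i s c) (w s c))"
  unfolding instances.inr_def by (intro DP_conj DP_le DP_less D_app0[where F=z] D_add D_cmul D_cst)

lemma D_wk1: "D (OKE Q) (\<lambda>s c. f s (tl c) (hd0 c)) \<Longrightarrow> D (OKE Q) (\<lambda>s c. f s (tl (tl c)) (hd0 c))"
  by (rule D_app2[where F=f, OF _ D_hd])
lemma DP_wk1: "DP (OKE Q) (\<lambda>s c. f s (tl c) (hd0 c)) \<Longrightarrow> DP (OKE Q) (\<lambda>s c. f s (tl (tl c)) (hd0 c))"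
  by (rule DP_app2[where P=f, OF _ D_hd])

lemma D_dom: assumes "D (OKE Q) (\<lambda>s c. z s (tl c) (hd0 c))" "D (OKE Q) w" shows "DP (OKE Q) (\<lambda>s c. i_dom s (z s c) (w s c))"
  unfolding instances.dom_def
  by (intro DP_conj DP_less DP_ex D_inz[where z="\<lambda>s c. z s (tl c)"] D_wk1[where f=z] D_wk[OF assms(2)] assms D_hd D_cst glb) (erule OKb)

lemma D_alw:
  assumes "DP (OKE Q) (\<lambda>s c. hd0 c \<in> S s (tl c))" "D (OKE Q) (\<lambda>s c. z s (tl c) (hd0 c))" "D (OKE Q) w" "D (OKE Q) h"
  shows "DP (OKE Q) (\<lambda>s c. i_alw s (S s c) (z s c) (w s c) (h s c))"
  unfolding instances.alw_def
  by (intro DP_conj DP_less DP_ex D_inz[where z="\<lambda>s c. z s (tl c)"] D_inr[where z="\<lambda>s c. z s (tl c)"]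
     DP_app0[where P="\<lambda>s c x. x \<in> S s c"] D_cps D_wk1[where f=z] D_wk[OF assms(3)] D_wk[OF assms(4)] assms D_hd D_cst glb) (erule OKb)

lemma D_valid:
  assumes J: "D (OKE Q) J" and S: "DP (OKE Q) (\<lambda>s c. hd0 c \<in> S s (tl c))" and z: "D (OKE Q) (\<lambda>s c. z s (tl c) (hd0 c))"
    and f: "D (OKE Q) (\<lambda>s c. f s (tl c) (hd0 c))"
  shows "DP (OKE Q) (\<lambda>s c. i_valid s (J s c) (S s c) (z s c) (f s c))"
  unfolding instances.valid_def
  apply (intro DP_all DP_imp DP_conj)
  subgoal by (rule glb)
  subgoal by (intro D_dom[where z="\<lambda>s c. z s (tl c)"] D_wk1[where f=z] z D_hd)
  subgoal by (intro D_alw[where z="\<lambda>s c. z s (tl c)" and S="\<lambda>s c. S s (tl c)"] D_wk1[where f=z] z D_hd f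
     DP_wk1[where f="\<lambda>s c x. x \<in> S s c"] S)
  subgoal by (rule glb)
  subgoal by (intro D_dom[where z="\<lambda>s c. z s (tl (tl c))"] D_wk1[where f="\<lambda>s c. z s (tl c)"] D_wk1[where f=z] z D_hd)
  subgoal by (intro DP_le D_hd D_wk[OF D_hd])
  subgoal by (intro DP_le D_app2[where F=f] f D_hd D_wk[OF D_hd])
  subgoal by (intro D_eGs D_hd D_wk[OF D_hd])
  \<comment> \<open>\<open>D_mult\<close> wants its first factor below the clock; this is known for
    the number of positions but not for a bound variable.\<close>
  subgoal by (simp only: mult.commute[of "hd0 (tl c)" for c]) (intro DP_less D_add D_mult glb D_hd D_wk[OF D_hd] D_wk[OF D_wk[OF J]], erule OKb)
  subgoal by (intro D_eHs D_app2[where F=f] f D_hd D_wk[OF D_hd])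
  subgoal by (erule OKb)
  subgoal by (erule OKb)
  done

lemma D_okP:
  assumes J: "D (OKE Q) J" and S: "DP (OKE Q) (\<lambda>s c. hd0 c \<in> S s (tl c))" and z: "D (OKE Q) (\<lambda>s c. z s (tl c) (hd0 c))"
    and f: "D (OKE Q) (\<lambda>s c. f s (tl c) (hd0 c))" and u: "D (OKE Q) u" and v: "D (OKE Q) v" and t: "D (OKE Q) t"
    and g: "D (OKE Q) (\<lambda>s c. g s (tl c) (hd0 c))"
    and lo: "D (OKE Q) (\<lambda>s c. lo s (tl (tl (tl c))) (hd0 c) (hd0 (tl c)))"
    and hi: "D (OKE Q) (\<lambda>s c. hi s (tl (tl (tl c))) (hd0 c) (hd0 (tl c)))"
  shows "DP (OKE Q) (\<lambda>s c. i_okP s (J s c) (S s c) (z s c) (f s c) (u s c) (v s c) (lo s c) (hi s c) (t s c) (g s c))"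
proof -
  \<comment> \<open>A function of two variables is applied by substituting its arguments one after
    the other.\<close>
  have ap: "D (OKE Q) (\<lambda>s c. l s (tl c) (a s c) (b s c))"
    if l: "D (OKE Q) (\<lambda>s c. l s (tl (tl (tl c))) (hd0 c) (hd0 (tl c)))" and a: "D (OKE Q) a" and b: "D (OKE Q) b"
      for l :: "state \<Rightarrow> nat list \<Rightarrow> nat \<Rightarrow> nat \<Rightarrow> nat" and a b
    by (rule D_app0[where F="\<lambda>s c x. l s (tl c) (a s c) x", OF _ b])
      (rule D_app0[where F="\<lambda>s c x. l s (tl (tl c)) x (hd0 c)", OF l D_wk[OF a]])
  show ?thesis
  unfolding instances.okP_def
  apply (intro DP_all DP_imp DP_conj)
  subgoal by (rule glb)
  subgoal by (intro D_dom[where z="\<lambda>s c. z s (tl c)"] D_wk1[where f=z] z D_hd)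
  subgoal by (intro DP_eq D_cps f D_wk[OF t])
  subgoal by (intro D_alw[where z="\<lambda>s c. z s (tl c)" and S="\<lambda>s c. S s (tl c)"] D_wk1[where f=z] z D_hd g
     DP_wk1[where f="\<lambda>s c x. x \<in> S s c"] S)
  subgoal by (intro DP_le ap[OF lo] f g D_part D_hd D_wk[OF u] D_wk[OF v])
  subgoal by (intro DP_le ap[OF hi] f g D_part D_hd D_wk[OF u] D_wk[OF v])
  subgoal by (rule glb)
  subgoal by (intro D_dom[where z="\<lambda>s c. z s (tl (tl c))"] D_wk1[where f="\<lambda>s c. z s (tl c)"] D_wk1[where f=z] z D_hd)
  subgoal by (intro DP_eq D_cps D_app2[where F=f] f D_hd D_wk[OF D_wk[OF t]])
  subgoal by (intro DP_le D_hd D_wk[OF D_hd])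
  subgoal by (intro DP_le D_app2[where F=g] g D_hd D_wk[OF D_hd])
  subgoal by (intro D_eGs D_hd D_wk[OF D_hd])
  subgoal by (simp only: mult.commute[of "hd0 (tl c)" for c]) (intro DP_less D_add D_mult glb D_hd D_wk[OF D_hd] D_wk[OF D_wk[OF J]], erule OKb)
  subgoal by (intro D_eHs D_app2[where F=g] g D_hd D_wk[OF D_hd])
  subgoal by (erule OKb)
  subgoal by (erule OKb)
  done
qed

abbreviation "s_za s \<equiv> solver_base.za (reg s 2) (reg s 9)"
abbreviation "s_Sset s \<equiv> solver_base.Sset (reg s 1) (reg s 2)"
abbreviation "s_cand s \<equiv> solver_base.cand Q (reg s 2) (reg s 9) (reg s 10) (tbs s)"
abbreviation "s_okg s \<equiv> solver_base.okg (reg s 7) (reg s 1) (eGs s) (eHs s) (cps s) Q (reg s 2) (reg s 9) (reg s 10) (reg s 11) (tbs s)"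
abbreviation "s_gsel s \<equiv> solver_base.gsel (reg s 7) (reg s 1) (eGs s) (eHs s) (cps s) Q (reg s 2) (reg s 9) (reg s 10) (reg s 11) (tbs s)"
abbreviation "s_comb s \<equiv> solver_base.comb (reg s 7) (reg s 1) (eGs s) (eHs s) (cps s) Q (reg s 2) (reg s 9) (reg s 10) (reg s 11) (tbs s)"
abbreviation "s_psel s \<equiv> solver_base.psel (reg s 7) (reg s 1) (eGs s) (eHs s) (cps s) Q (reg s 2) (reg s 9) (reg s 10) (reg s 11) (tbs s)"
abbreviation "s_init s \<equiv> solver_base.init (reg s 1) (cps s) Q (reg s 2) (reg s 9)"
abbreviation "s_entry s \<equiv> solver_base.entry (reg s 7) (reg s 1) (eGs s) (eHs s) (cps s) Q (reg s 2) (reg s 9) (reg s 10) (reg s 11) (tbs s)"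

lemma D_za: "D (OKE Q) Z \<Longrightarrow> D (OKE Q) x \<Longrightarrow> D (OKE Q) (\<lambda>s c. s_za s (Z s c) (x s c))"
  unfolding solver_base.za_def by (intro D_digc glb; (assumption | erule OKb))

lemma D_Sset: "D (OKE Q) S \<Longrightarrow> D (OKE Q) x \<Longrightarrow> DP (OKE Q) (\<lambda>s c. x s c \<in> s_Sset s (S s c))"
  unfolding solver_base.Sset_def mem_Collect_eq
  by (intro DP_conj DP_less DP_not DP_eq D_digc D_cst glb; (assumption | erule OKb))

lemma D_gS: "D (OKE Q) g \<Longrightarrow> D (OKE Q) (\<lambda>s c. solver_base.gS (reg s 2) (reg s 9) (g s c))"
  unfolding solver_base.gS_def by (intro D_mdc glb; (assumption | erule OKb))
lemma D_gz: "D (OKE Q) g \<Longrightarrow> D (OKE Q) (\<lambda>s c. solver_base.gz (reg s 2) (reg s 9) (reg s 10) (g s c))"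
  unfolding solver_base.gz_def by (intro D_mdc D_dvc glb; (assumption | erule OKb))
lemma D_gc: "D (OKE Q) g \<Longrightarrow> D (OKE Q) (\<lambda>s c. solver_base.gc (reg s 2) (reg s 9) (reg s 10) (g s c))"
  unfolding solver_base.gc_def by (intro D_mdc D_dvc glb; (assumption | erule OKb))

lemma D_cand: assumes "D (OKE Q) J" "D (OKE Q) g" "D (OKE Q) w" shows "D (OKE Q) (\<lambda>s c. s_cand s (J s c) (g s c) (w s c))"
  unfolding solver_base.cand_def
  by (intro D_merge[where C="\<lambda>s c x. s_za s (solver_base.gc (reg s 2) (reg s 9) (reg s 10) (g s c)) x"
     and G="\<lambda>s c w. tbs s (solver_base.gS (reg s 2) (reg s 9) (g s c)) (J s c) (solver_base.gz (reg s 2) (reg s 9) (reg s 10) (g s c)) w - 1"]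
    D_za D_gc D_gS D_gz D_tbs D_sub D_cst D_hd assms D_wk[OF assms(1)] D_wk[OF assms(2)])

lemma D_okg: assumes "D (OKE Q) S" "D (OKE Q) J" "D (OKE Q) Z" "D (OKE Q) P" "D (OKE Q) t" "D (OKE Q) g"
  shows "DP (OKE Q) (\<lambda>s c. s_okg s (S s c) (J s c) (Z s c) (P s c) (t s c) (g s c))"
proof -
  note wk = assms[THEN D_wk]
  note wk3 = assms(4)[THEN D_wk, THEN D_wk, THEN D_wk]
  have "DP (OKE Q) (\<lambda>s c. i_okP s (J s c) (s_Sset s (S s c)) (s_za s (Z s c)) (\<lambda>w. tbs s (S s c) (J s c) (Z s c) w - 1)
     (dvc (reg s 2) (J s c) (reg s 7)) (mdc (reg s 2) (J s c) (reg s 7))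
     (\<lambda>y q. digc (reg s 2) (reg s 11) (10*y+2*q) (P s c)) (\<lambda>y q. digc (reg s 2) (reg s 11) (10*y+2*q+1) (P s c)) (t s c) (\<lambda>w. s_cand s (J s c) (g s c) w))"
    apply (rule D_okP[where S="\<lambda>s c. s_Sset s (S s c)" and z="\<lambda>s c x. s_za s (Z s c) x"
      and f="\<lambda>s c w. tbs s (S s c) (J s c) (Z s c) w - 1" and g="\<lambda>s c w. s_cand s (J s c) (g s c) w"
      and lo="\<lambda>s c y q. digc (reg s 2) (reg s 11) (10*y+2*q) (P s c)"
      and hi="\<lambda>s c y q. digc (reg s 2) (reg s 11) (10*y+2*q+1) (P s c)"])
    subgoal by (rule assms)
    subgoal by (intro D_Sset wk D_hd)
    subgoal by (intro D_za wk D_hd)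
    subgoal by (intro D_sub D_tbs wk D_hd D_cst)
    subgoal by (intro D_dvc assms glb; erule OKb)
    subgoal by (intro D_mdc assms glb; erule OKb)
    subgoal by (rule assms)
    subgoal by (intro D_cand wk D_hd)
    subgoal by (intro D_digc D_add D_cmul D_cst D_hd D_wk[OF D_hd] glb wk3; erule OKb)
    subgoal by (intro D_digc D_add D_cmul D_cst D_hd D_wk[OF D_hd] glb wk3; erule OKb)
    done
  then show ?thesis unfolding solver_base.okg_def by (intro DP_conj DP_less D_gS assms)
qed

lemma D_gsel: assumes "D (OKE Q) S" "D (OKE Q) J" "D (OKE Q) Z" "D (OKE Q) P" "D (OKE Q) t"
  shows "D (OKE Q) (\<lambda>s c. s_gsel s (S s c) (J s c) (Z s c) (P s c) (t s c))"
  unfolding solver_base.gsel_def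
  by (intro D_mu D_okg glb assms[THEN D_wk] D_hd) (erule OKb)

lemma D_comb: assumes "D (OKE Q) S" "D (OKE Q) J" "D (OKE Q) Z" "D (OKE Q) P" "D (OKE Q) w"
  shows "D (OKE Q) (\<lambda>s c. s_comb s (S s c) (J s c) (Z s c) (P s c) (w s c))"
  unfolding solver_base.comb_def
  by (intro D_if DP_less D_gsel D_cand D_cps D_sub D_tbs D_cst glb assms)

lemma D_psel: assumes "D (OKE Q) S" "D (OKE Q) J" "D (OKE Q) Z"
  shows "D (OKE Q) (\<lambda>s c. s_psel s (S s c) (J s c) (Z s c))"
  unfolding solver_base.psel_def
  apply (rule D_mu)
  subgoal by (rule glb)
  subgoal
    apply (rule D_valid[where S="\<lambda>s c. s_Sset s (S s (tl c))" and z="\<lambda>s c x. s_za s (Z s (tl c)) x"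
      and f="\<lambda>s c w. s_comb s (S s (tl c)) (J s (tl c)) (Z s (tl c)) (hd0 c) w"])
    subgoal by (intro D_add D_cst assms[THEN D_wk])
    subgoal by (intro D_Sset assms[THEN D_wk, THEN D_wk] D_hd)
    subgoal by (intro D_za assms[THEN D_wk, THEN D_wk] D_hd)
    subgoal by (intro D_comb assms[THEN D_wk, THEN D_wk] D_hd D_wk[OF D_hd])
    done
  subgoal by (erule OKb)
  done

lemma D_init: assumes "D (OKE Q) S" "D (OKE Q) Z" "D (OKE Q) w"
  shows "D (OKE Q) (\<lambda>s c. s_init s (S s c) (Z s c) (w s c))"
  unfolding solver_base.init_def
  apply (rule D_mu)
  subgoal by (rule glb)
  subgoal
    apply (rule D_alw[where S="\<lambda>s c. s_Sset s (S s (tl c))" and z="\<lambda>s c x. s_za s (Z s (tl c)) x"])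
    subgoal by (intro D_Sset assms[THEN D_wk, THEN D_wk] D_hd)
    subgoal by (intro D_za assms[THEN D_wk, THEN D_wk] D_hd)
    subgoal by (rule assms[THEN D_wk])
    subgoal by (rule D_hd)
    done
  subgoal by (erule OKb)
  done

lemma D_entry: assumes "D (OKE Q) S" "D (OKE Q) J" "D (OKE Q) Z" "D (OKE Q) w"
  shows "D (OKE Q) (\<lambda>s c. s_entry s (S s c) (J s c) (Z s c) (w s c))"
proof -
  note wk = assms[THEN D_wk]
  have v: "DP (OKE Q) (\<lambda>s c. i_valid s 0 (s_Sset s (S s c)) (s_za s (Z s c)) (\<lambda>w. s_init s (S s c) (Z s c) w))"
    by (rule D_valid[where S="\<lambda>s c. s_Sset s (S s c)" and z="\<lambda>s c x. s_za s (Z s c) x"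
      and f="\<lambda>s c w. s_init s (S s c) (Z s c) w"]) (intro D_cst D_Sset D_za D_init wk D_hd)+
  have v2: "DP (OKE Q) (\<lambda>s c. i_valid s (J s c) (s_Sset s (S s c)) (s_za s (Z s c)) (\<lambda>w. tbs s (S s c) (J s c - 1) (Z s c) w - 1))"
    by (rule D_valid[where S="\<lambda>s c. s_Sset s (S s c)" and z="\<lambda>s c x. s_za s (Z s c) x"
      and f="\<lambda>s c w. tbs s (S s c) (J s c - 1) (Z s c) w - 1"]) (intro D_cst D_Sset D_za D_tbs D_sub assms wk D_hd)+
  show ?thesis unfolding solver_base.entry_def
    by (intro D_if v v2 DP_eq DP_less D_add D_sub D_tbs D_comb D_psel D_init D_cst glb assms)
qed

text \<open>Register 5 is the cell number relative to the start of the table; dividing undoes the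
  address computation of \<open>tbs\<close>.\<close>

definition row :: "state \<Rightarrow> nat" where
  "row s = (let N = reg s 2; B = reg s 9; ZB = reg s 10; i = reg s 5; i1 = dvc N i B; i2 = dvc N i1 ZB
     in s_entry s (dvc N i2 B) (mdc N i2 B) (mdc N i1 ZB) (mdc N i B))"

lemma D_row: "D (OKE Q) (\<lambda>s c. row s)"
  unfolding row_def Let_def by (intro D_entry D_dvc D_mdc glb; erule OKb)

end

section \<open>Encoded instances\<close>

definition wf_word :: "bool list \<Rightarrow> nat \<Rightarrow> nat \<Rightarrow> bool" where
  "wf_word x k n \<longleftrightarrow> length x = n+1+n*n+k+1+k*k \<and> (\<forall>i<n. x ! i) \<and> \<not> x ! n \<and>
     (\<forall>i<k. x ! (n+1+n*n+i)) \<and> \<not> x ! (n+1+n*n+k)"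
definition eGx :: "bool list \<Rightarrow> nat \<Rightarrow> nat \<Rightarrow> nat \<Rightarrow> bool" where
  "eGx x n u v \<longleftrightarrow> x ! (n*u+v+n+1)"
definition eHx :: "bool list \<Rightarrow> nat \<Rightarrow> nat \<Rightarrow> nat \<Rightarrow> nat \<Rightarrow> bool" where
  "eHx x n k u v \<longleftrightarrow> x ! (k*u+v+n+1+n*n+k+1)"
definition simple :: "nat \<Rightarrow> (nat \<Rightarrow> nat \<Rightarrow> bool) \<Rightarrow> bool" where
  "simple n e \<longleftrightarrow> (\<forall>u<n. \<not> e u u \<and> (\<forall>v<n. e u v \<longrightarrow> e v u))"
text \<open>The factor structure in numbers: \<open>cp\<close> names a copy, \<open>role\<close> is
  the vertex of the fixed graph played by a letter, and \<open>R\<close> is the adjacency of that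
  graph. Being onto and strictly increasing on a copy makes \<open>role\<close> an isomorphism of
  orders.\<close>

definition copies :: "nat \<Rightarrow> (nat \<Rightarrow> nat \<Rightarrow> bool) \<Rightarrow> nat \<Rightarrow> (nat \<Rightarrow> nat \<Rightarrow> bool) \<Rightarrow> (nat \<Rightarrow> nat) \<Rightarrow> (nat \<Rightarrow> nat) \<Rightarrow> bool" where
  "copies k e m R cp role \<longleftrightarrow> (\<forall>h<k. cp h < k \<and> role h < m \<and>
     (\<forall>r<m. \<exists>h'<k. cp h' = cp h \<and> role h' = r) \<and>
     (\<forall>h'<k. (e h h' \<longrightarrow> cp h = cp h') \<and> (cp h = cp h' \<longrightarrow> (h < h' \<longrightarrow> role h < role h') \<and> (e h h' \<longleftrightarrow> R (role h) (role h')))))"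
definition phom :: "nat \<Rightarrow> nat \<Rightarrow> (nat \<Rightarrow> nat \<Rightarrow> bool) \<Rightarrow> (nat \<Rightarrow> nat \<Rightarrow> bool) \<Rightarrow> (nat \<Rightarrow> nat) \<Rightarrow> bool" where
  "phom n k eG eH f \<longleftrightarrow> (\<forall>u<n. f u < k \<and> (\<forall>v<n. (u \<le> v \<longrightarrow> f u \<le> f v) \<and> (eG u v \<longrightarrow> eH (f u) (f v))))"

section \<open>Graphs in terms of positions in the vertex order\<close>

definition vlist :: "'a::linorder ograph \<Rightarrow> 'a list" where "vlist G = sorted_list_of_set (verts G)"
definition padj :: "'a::linorder ograph \<Rightarrow> nat \<Rightarrow> nat \<Rightarrow> bool" where
  "padj G u v \<longleftrightarrow> {vlist G ! u, vlist G ! v} \<in> edges G"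

lemma vlist:
  assumes "ordered_graph G"
  shows "set (vlist G) = verts G" "length (vlist G) = card (verts G)"
    "\<And>i j. i < j \<Longrightarrow> j < card (verts G) \<Longrightarrow> vlist G ! i < vlist G ! j"
    "\<And>i. i < card (verts G) \<Longrightarrow> vlist G ! i \<in> verts G"
proof -
  have fin: "finite (verts G)" using assms by (simp add: ordered_graph_def)
  then show 1: "set (vlist G) = verts G" and 2: "length (vlist G) = card (verts G)" by (simp_all add: vlist_def)
  show "i < j \<Longrightarrow> j < card (verts G) \<Longrightarrow> vlist G ! i < vlist G ! j" for i j
    using strict_sorted_list_of_set[of "verts G"] 2 unfolding vlist_def by (simp add: sorted_wrt_nth_less)
  show "i < card (verts G) \<Longrightarrow> vlist G ! i \<in> verts G" for i using 1 2 nth_mem by metis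
qed

lemma vlist_le:
  assumes "ordered_graph G" "i < card (verts G)" "j < card (verts G)"
  shows "vlist G ! i \<le> vlist G ! j \<longleftrightarrow> i \<le> j" "vlist G ! i = vlist G ! j \<longleftrightarrow> i = j"
  using vlist(3)[OF assms(1), of i j] vlist(3)[OF assms(1), of j i] assms(2,3)
  by (cases i j rule: linorder_cases; force)+

lemma vlist_ex:
  assumes "ordered_graph G" "a \<in> verts G"
  obtains i where "i < card (verts G)" "vlist G ! i = a"
  using assms vlist(1,2)[OF assms(1)] by (metis in_set_conv_nth)

lemma concat_nth:
  assumes "\<And>a. a \<in> set xs \<Longrightarrow> length (g a) = n" "u < length xs" "v < n"
  shows "concat (map g xs) ! (n*u+v) = g (xs ! u) ! v"
  using assms
proof (induction xs arbitrary: u)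
  case (Cons a xs)
  then show ?case by (cases u) (simp_all add: nth_append)
qed simp

lemma enc_length: "length (encode_ograph G) = card (verts G) + 1 + card (verts G) * card (verts G)"
  by (simp add: encode_ograph_def Let_def length_concat comp_def sum_list_triv)

lemma enc_eq: "encode_ograph G = replicate (length (vlist G)) True @ False #
     concat (map (\<lambda>u. map (\<lambda>v. {u, v} \<in> edges G) (vlist G)) (vlist G))"
  by (simp add: encode_ograph_def Let_def vlist_def)

lemma enc_nth:
  assumes "ordered_graph G" and n: "n = card (verts G)"
  shows "i < n \<Longrightarrow> encode_ograph G ! i" "\<not> encode_ograph G ! n"
    "u < n \<Longrightarrow> v < n \<Longrightarrow> encode_ograph G ! (n*u+v+n+1) \<longleftrightarrow> padj G u v"
proof -
  have l: "length (vlist G) = n" using vlist(2) assms by metis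
  show "i < n \<Longrightarrow> encode_ograph G ! i" "\<not> encode_ograph G ! n" unfolding enc_eq l by (simp_all add: nth_append)
  assume uv: "u < n" "v < n"
  have "concat (map (\<lambda>u. map (\<lambda>v. {u, v} \<in> edges G) (vlist G)) (vlist G)) ! (n*u+v) =
      map (\<lambda>v. {vlist G ! u, v} \<in> edges G) (vlist G) ! v"
    by (rule concat_nth) (simp_all add: l uv)
  also have "\<dots> = padj G u v" by (simp add: l uv padj_def)
  finally show "encode_ograph G ! (n*u+v+n+1) \<longleftrightarrow> padj G u v"
    unfolding enc_eq l by (simp add: nth_append)
qed

lemma simple_padj: "ordered_graph G \<Longrightarrow> simple (card (verts G)) (padj G)"
  unfolding simple_def padj_def ordered_graph_def by (force simp: insert_commute doubleton_eq_iff)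

definition pgraph :: "nat \<Rightarrow> (nat \<Rightarrow> nat \<Rightarrow> bool) \<Rightarrow> nat ograph" where
  "pgraph n e = \<lparr>verts = {..<n}, edges = {{u, v} | u v. u < n \<and> v < n \<and> e u v}\<rparr>"

lemma pgraph:
  assumes "simple n e"
  shows "ordered_graph (pgraph n e)" "vlist (pgraph n e) = [0..<n]" "card (verts (pgraph n e)) = n"
    "\<And>u v. u < n \<Longrightarrow> v < n \<Longrightarrow> padj (pgraph n e) u v \<longleftrightarrow> e u v"
    "\<And>u v. {u, v} \<in> edges (pgraph n e) \<longleftrightarrow> u < n \<and> v < n \<and> e u v"
proof -
  show v: "vlist (pgraph n e) = [0..<n]"
    by (simp add: vlist_def pgraph_def lessThan_atLeast0)
  show e: "{u, v} \<in> edges (pgraph n e) \<longleftrightarrow> u < n \<and> v < n \<and> e u v" for u v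
  proof -
    have sy: "u < n \<Longrightarrow> v < n \<Longrightarrow> e v u \<Longrightarrow> e u v" using assms by (simp add: simple_def)
    show ?thesis unfolding pgraph_def by (auto simp: doubleton_eq_iff sy)
  qed
  have irr: "u < n \<Longrightarrow> \<not> e u u" for u using assms by (simp add: simple_def)
  show "ordered_graph (pgraph n e)" unfolding ordered_graph_def
  proof (intro conjI ballI)
    show "finite (verts (pgraph n e))" by (simp add: pgraph_def)
    fix E assume "E \<in> edges (pgraph n e)"
    then obtain u v where uv: "E = {u, v}" "u < n" "v < n" "e u v" by (auto simp: pgraph_def)
    then have "u \<noteq> v" using irr by blast
    then show "\<exists>u\<in>verts (pgraph n e). \<exists>v\<in>verts (pgraph n e). u \<noteq> v \<and> E = {u, v}"
      using uv by (auto simp: pgraph_def)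
  qed
  show "card (verts (pgraph n e)) = n" by (simp add: pgraph_def)
  show "u < n \<Longrightarrow> v < n \<Longrightarrow> padj (pgraph n e) u v \<longleftrightarrow> e u v" for u v unfolding padj_def v e by simp
qed

lemma hom_phom:
  assumes G: "ordered_graph G" and H: "ordered_graph H" and f: "ordered_hom G H f"
  shows "\<exists>p. phom (card (verts G)) (card (verts H)) (padj G) (padj H) p"
proof -
  define p where "p i = (SOME j. j < card (verts H) \<and> vlist H ! j = f (vlist G ! i))" for i
  have p: "p i < card (verts H) \<and> vlist H ! p i = f (vlist G ! i)" if "i < card (verts G)" for i
  proof -
    have "f (vlist G ! i) \<in> verts H" using f vlist(4)[OF G that] by (auto simp: ordered_hom_def)
    then have "\<exists>j. j < card (verts H) \<and> vlist H ! j = f (vlist G ! i)" by (rule vlist_ex[OF H]) blast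
    then show ?thesis unfolding p_def by (rule someI_ex)
  qed
  have "p u \<le> p v" if "u < card (verts G)" "v < card (verts G)" "u \<le> v" for u v
  proof -
    have "vlist G ! u \<le> vlist G ! v" using vlist_le[OF G] that by simp
    then have "f (vlist G ! u) \<le> f (vlist G ! v)" using f vlist(4)[OF G] that by (auto simp: ordered_hom_def mono_on_def)
    then show ?thesis using p[OF that(1)] p[OF that(2)] vlist_le(1)[OF H, of "p u" "p v"] by simp
  qed
  moreover have "padj H (p u) (p v)" if "u < card (verts G)" "v < card (verts G)" "padj G u v" for u v
  proof -
    have "{f (vlist G ! u), f (vlist G ! v)} \<in> edges H" using f that(3) unfolding ordered_hom_def padj_def by blast
    then show ?thesis using p[OF that(1)] p[OF that(2)] by (simp add: padj_def)
  qed
  moreover have "p u < card (verts H)" if "u < card (verts G)" for u using p[OF that] by simp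
  ultimately have "phom (card (verts G)) (card (verts H)) (padj G) (padj H) p" unfolding phom_def by blast
  then show ?thesis by blast
qed

lemma factor_copies:
  assumes H0: "ordered_graph H0" and F: "ordered_factor H0 H"
  shows "\<exists>cp role. copies (card (verts H)) (padj H) (card (verts H0)) (padj H0) cp role"
proof -
  let ?k = "card (verts H)" and ?m = "card (verts H0)"
  obtain P where H: "ordered_graph H" and P: "partition_on (verts H) P" and iso: "\<forall>S\<in>P. ordered_iso (induced_subgraph H S) H0"
    and ed: "\<forall>e\<in>edges H. \<exists>S\<in>P. e \<subseteq> S" using F by (auto simp: ordered_factor_def)
  have uniq: "S = T" if "S \<in> P" "T \<in> P" "a \<in> S" "a \<in> T" for S T a
    using partition_onD2[OF P] that disjointD[of P S T] by blast
  define pt where "pt h = (THE S. S \<in> P \<and> vlist H ! h \<in> S)" for h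
  have pt: "pt h \<in> P" "vlist H ! h \<in> pt h" if "h < ?k" for h
  proof -
    have "vlist H ! h \<in> \<Union>P" using vlist(4)[OF H that] P by (simp add: partition_on_def)
    then obtain S where S: "S \<in> P" "vlist H ! h \<in> S" by blast
    have "\<exists>!S. S \<in> P \<and> vlist H ! h \<in> S" by (rule ex1I[of _ S]) (use S uniq in auto)
    then have "pt h \<in> P \<and> vlist H ! h \<in> pt h" unfolding pt_def by (rule theI')
    then show "pt h \<in> P" "vlist H ! h \<in> pt h" by simp_all
  qed
  have pt_eq: "S = pt h" if "h < ?k" "S \<in> P" "vlist H ! h \<in> S" for h S
    by (rule uniq[OF that(2) pt(1)[OF that(1)] that(3) pt(2)[OF that(1)]])
  have sub: "S \<subseteq> verts H" if "S \<in> P" for S using P that by (auto simp: partition_on_def)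
  have "\<forall>S\<in>P. \<exists>g. bij_betw g S (verts H0) \<and> mono_on S g \<and> (\<forall>u\<in>S. \<forall>v\<in>S. {u, v} \<in> edges H \<longleftrightarrow> {g u, g v} \<in> edges H0)"
    using iso unfolding ordered_iso_def induced_subgraph_def by auto
  then obtain g where g: "\<And>S. S \<in> P \<Longrightarrow> bij_betw (g S) S (verts H0)" "\<And>S. S \<in> P \<Longrightarrow> mono_on S (g S)"
    "\<And>S u v. S \<in> P \<Longrightarrow> u \<in> S \<Longrightarrow> v \<in> S \<Longrightarrow> {u, v} \<in> edges H \<longleftrightarrow> {g S u, g S v} \<in> edges H0"
    unfolding bchoice_iff by blast
  \<comment> \<open>A copy is named by its least position, which keeps the names below the number of
    vertices.\<close>
  define cp where "cp h = (LEAST h'. h' < ?k \<and> pt h' = pt h)" for h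
  define role where "role h = (SOME i. i < ?m \<and> vlist H0 ! i = g (pt h) (vlist H ! h))" for h
  have cp: "cp h < ?k" "pt (cp h) = pt h" if "h < ?k" for h
    using LeastI[of "\<lambda>h'. h' < ?k \<and> pt h' = pt h" h] that unfolding cp_def by auto
  have cp_eq: "cp h = cp h' \<longleftrightarrow> pt h = pt h'" if "h < ?k" "h' < ?k" for h h'
  proof
    assume "cp h = cp h'"
    then show "pt h = pt h'" using cp(2)[OF that(1)] cp(2)[OF that(2)] by simp
  qed (simp add: cp_def)
  have role: "role h < ?m \<and> vlist H0 ! role h = g (pt h) (vlist H ! h)" if "h < ?k" for h
  proof -
    have "g (pt h) (vlist H ! h) \<in> verts H0" using bij_betwE[OF g(1)[OF pt(1)[OF that]]] pt(2)[OF that] by blast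
    then have "\<exists>i. i < ?m \<and> vlist H0 ! i = g (pt h) (vlist H ! h)" by (rule vlist_ex[OF H0]) blast
    then show ?thesis unfolding role_def by (rule someI_ex)
  qed
  have all: "\<exists>h'<?k. cp h' = cp h \<and> role h' = r" if h: "h < ?k" and r: "r < ?m" for h r
  proof -
    have "vlist H0 ! r \<in> g (pt h) ` pt h" unfolding bij_betw_imp_surj_on[OF g(1)[OF pt(1)[OF h]]] by (rule vlist(4)[OF H0 r])
    then obtain a where a: "a \<in> pt h" "g (pt h) a = vlist H0 ! r" by fastforce
    have "a \<in> verts H" using sub[OF pt(1)[OF h]] a(1) by (rule subsetD)
    then obtain h' where h': "h' < ?k" "vlist H ! h' = a" by (rule vlist_ex[OF H])
    have p: "pt h' = pt h" using pt_eq[OF h'(1) pt(1)[OF h]] a(1) h'(2) by simp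
    then have "vlist H0 ! role h' = vlist H0 ! r" using role[OF h'(1)] a(2) h'(2) by simp
    then have "role h' = r" using vlist_le(2)[OF H0 conjunct1[OF role[OF h'(1)]] r] by simp
    then show ?thesis using h'(1) p cp_eq[OF h'(1) h] by blast
  qed
  have cross: "cp h = cp h'" if hh: "h < ?k" "h' < ?k" "padj H h h'" for h h'
  proof -
    obtain S where S: "S \<in> P" "vlist H ! h \<in> S" "vlist H ! h' \<in> S" using ed hh(3) unfolding padj_def by blast
    then have "pt h = pt h'" using pt_eq[OF hh(1) S(1,2)] pt_eq[OF hh(2) S(1,3)] by simp
    then show ?thesis using cp_eq[OF hh(1,2)] by simp
  qed
  have inc: "role h < role h'" if "h < ?k" "h' < ?k" "cp h = cp h'" "h < h'" for h h'
  proof -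
    have p: "pt h' = pt h" using that(3) cp_eq[OF that(1,2)] by simp
    have i: "vlist H ! h \<in> pt h" "vlist H ! h' \<in> pt h" using pt(2)[OF that(1)] pt(2)[OF that(2)] p by simp_all
    have l: "vlist H ! h < vlist H ! h'" by (rule vlist(3)[OF H that(4,2)])
    have r: "role h < ?m" "role h' < ?m" "vlist H0 ! role h = g (pt h) (vlist H ! h)" "vlist H0 ! role h' = g (pt h) (vlist H ! h')"
      using role[OF that(1)] role[OF that(2)] p by simp_all
    have "g (pt h) (vlist H ! h) \<le> g (pt h) (vlist H ! h')"
      by (rule mono_onD[OF g(2)[OF pt(1)[OF that(1)]] i less_imp_le[OF l]])
    then have le: "role h \<le> role h'" using vlist_le(1)[OF H0 r(1,2)] r(3,4) by simp
    have "g (pt h) (vlist H ! h) \<noteq> g (pt h) (vlist H ! h')"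
      using inj_onD[OF bij_betw_imp_inj_on[OF g(1)[OF pt(1)[OF that(1)]]] _ i] less_imp_neq[OF l] by blast
    then show ?thesis using le r(3,4) by (metis le_neq_implies_less)
  qed
  have adj: "padj H h h' \<longleftrightarrow> padj H0 (role h) (role h')" if "h < ?k" "h' < ?k" "cp h = cp h'" for h h'
  proof -
    have p: "pt h' = pt h" using that(3) cp_eq[OF that(1,2)] by simp
    show ?thesis unfolding padj_def
      using g(3)[OF pt(1)[OF that(1)] pt(2)[OF that(1)], of "vlist H ! h'"] pt(2)[OF that(2)] p role[OF that(1)] role[OF that(2)] by simp
  qed
  have "copies ?k (padj H) ?m (padj H0) cp role"
    unfolding copies_def
  proof (intro allI impI conjI)
    fix h h' r assume h: "h < ?k"
    show "cp h < ?k" "role h < ?m" using cp(1)[OF h] role[OF h] by simp_all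
    show "r < ?m \<Longrightarrow> \<exists>h'<?k. cp h' = cp h \<and> role h' = r" by (rule all[OF h])
    assume h': "h' < ?k"
    show "padj H h h' \<Longrightarrow> cp h = cp h'" by (rule cross[OF h h'])
    show "cp h = cp h' \<Longrightarrow> h < h' \<Longrightarrow> role h < role h'" by (rule inc[OF h h'])
    show "cp h = cp h' \<Longrightarrow> padj H h h' = padj H0 (role h) (role h')" by (rule adj[OF h h'])
  qed
  then show ?thesis by blast
qed

text \<open>Strict monotonicity of \<open>role\<close> on a copy gives injectivity and order, and
  the onto condition gives the remaining half of a bijection with the vertices of
  \<open>H0\<close>.\<close>

lemma copies_factor:
  assumes H0: "ordered_graph H0" and s: "simple k e" and c: "copies k e (card (verts H0)) (padj H0) cp role"
  shows "ordered_factor H0 (pgraph k e)"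
proof -
  let ?H = "pgraph k e" and ?m = "card (verts H0)"
  have c1: "cp h < k" "role h < ?m" "\<And>r. r < ?m \<Longrightarrow> \<exists>h'<k. cp h' = cp h \<and> role h' = r" if "h < k" for h
    using c that unfolding copies_def by blast+
  have c2: "e h h' \<Longrightarrow> cp h = cp h'" "cp h = cp h' \<Longrightarrow> h < h' \<Longrightarrow> role h < role h'"
    "cp h = cp h' \<Longrightarrow> e h h' \<longleftrightarrow> padj H0 (role h) (role h')" if "h < k" "h' < k" for h h'
    using c that unfolding copies_def by blast+
  define P where "P = (\<lambda>h. {h'. h' < k \<and> cp h' = cp h}) ` {..<k}"
  have "partition_on {..<k} P" unfolding partition_on_def disjoint_def P_def by auto
  moreover have "ordered_iso (induced_subgraph ?H S) H0" if "S \<in> P" for S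
  proof -
    obtain h where h: "h < k" "S = {h'. h' < k \<and> cp h' = cp h}" using \<open>S \<in> P\<close> by (auto simp: P_def)
    let ?f = "\<lambda>h. vlist H0 ! role h"
    have mono: "?f a < ?f b" if "a \<in> S" "b \<in> S" "a < b" for a b
      using c2(2)[of a b] c1(2)[of b] vlist(3)[OF H0] h that by auto
    have "inj_on ?f S"
    proof (rule inj_onI)
      fix a b assume "a \<in> S" "b \<in> S" "?f a = ?f b"
      then show "a = b" using mono[of a b] mono[of b a] by (cases a b rule: linorder_cases) auto
    qed
    moreover have "?f ` S = verts H0"
    proof
      show "?f ` S \<subseteq> verts H0" using vlist(4)[OF H0] c1(2) h by auto
      show "verts H0 \<subseteq> ?f ` S"
      proof
        fix a assume "a \<in> verts H0"
        then obtain i where i: "i < ?m" "vlist H0 ! i = a" using vlist_ex[OF H0] by blast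
        then obtain h' where "h' < k" "cp h' = cp h" "role h' = i" using c1(3)[OF h(1)] by blast
        then show "a \<in> ?f ` S" using i h by auto
      qed
    qed
    moreover have "mono_on S ?f" using mono by (auto simp: mono_on_def le_less)
    moreover have "{a, b} \<in> edges (induced_subgraph ?H S) \<longleftrightarrow> {?f a, ?f b} \<in> edges H0" if "a \<in> S" "b \<in> S" for a b
      using that h c2(3)[of a b] pgraph(5)[OF s] by (auto simp: induced_subgraph_def padj_def)
    ultimately show ?thesis unfolding ordered_iso_def
      by (intro exI[of _ ?f]) (auto simp: bij_betw_def induced_subgraph_def)
  qed
  moreover have "\<exists>S\<in>P. E \<subseteq> S" if E: "E \<in> edges ?H" for E
  proof -
    obtain a b where "E = {a, b}" "a < k" "b < k" "e a b" using E by (auto simp: pgraph_def)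
    then show ?thesis using c2(1)[of a b] by (auto simp: P_def intro!: bexI[of _ a])
  qed
  ultimately show ?thesis unfolding ordered_factor_def using pgraph(1)[OF s] by (auto simp: pgraph_def)
qed

lemma simple_cong: "(\<And>u v. u < n \<Longrightarrow> v < n \<Longrightarrow> e u v = e' u v) \<Longrightarrow> simple n e = simple n e'"
  unfolding simple_def by simp
lemma copies_mono:
  assumes "\<And>u v. u < k \<Longrightarrow> v < k \<Longrightarrow> e u v = e' u v" "copies k e m R cp role"
  shows "copies k e' m R cp role"
  unfolding copies_def
proof (intro allI impI conjI)
  fix h h' r assume h: "h < k"
  note C = assms(2)[unfolded copies_def, rule_format, OF h]
  show "cp h < k" "role h < m" "r < m \<Longrightarrow> \<exists>h'<k. cp h' = cp h \<and> role h' = r" using C by blast+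
  assume h': "h' < k"
  show "e' h h' \<Longrightarrow> cp h = cp h'" "cp h = cp h' \<Longrightarrow> h < h' \<Longrightarrow> role h < role h'"
    "cp h = cp h' \<Longrightarrow> e' h h' = R (role h) (role h')"
    using C h' assms(1)[OF h h'] by blast+
qed
lemma phom_cong:
  assumes "phom n k eG eH f" "\<And>u v. u < n \<Longrightarrow> v < n \<Longrightarrow> eG' u v = eG u v" "\<And>u v. u < k \<Longrightarrow> v < k \<Longrightarrow> eH' u v = eH u v"
  shows "phom n k eG' eH' f"
  using assms unfolding phom_def by blast

text \<open>The encoding records adjacency and order of the vertices but not their names, so every
  member word is the encoding of two graphs on initial segments of the naturals, and these can be
  read off the word.\<close>

lemma problem_iff:
  assumes H0: "ordered_graph H0"
  shows "(x, k) \<in> ordered_hom_factor_problem H0 \<longleftrightarrow> (\<exists>n. wf_word x k n \<and> simple n (eGx x n) \<and> simple k (eHx x n k) \<and>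
    (\<exists>cp role. copies k (eHx x n k) (card (verts H0)) (padj H0) cp role) \<and> (\<exists>f. phom n k (eGx x n) (eHx x n k) f))"
    (is "?L = ?R")
proof
  assume ?L
  then obtain G H :: "nat ograph" and f where x: "x = encode_ograph G @ encode_ograph H" and k: "k = card (verts H)"
    and G: "ordered_graph G" and F: "ordered_factor H0 H" and f: "ordered_hom G H f"
    unfolding ordered_hom_factor_problem_def by blast
  have H: "ordered_graph H" using F by (simp add: ordered_factor_def)
  define n where "n = card (verts G)"
  have lG: "length (encode_ograph G) = n + 1 + n * n" using enc_length n_def by metis
  have lH: "length (encode_ograph H) = k + 1 + k * k" using enc_length k by metis
  have sq: "n*u+v < n*n" if "u < n" "v < n" for u v n :: nat
  proof -
    have "n*u+v < n * Suc u" using that by simp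
    also have "\<dots> \<le> n * n" using that by (intro mult_le_mono2) simp
    finally show ?thesis .
  qed
  have e1: "eGx x n u v \<longleftrightarrow> padj G u v" if "u < n" "v < n" for u v
    using enc_nth(3)[OF G n_def that] sq[OF that] lG by (simp add: eGx_def x nth_append)
  have e2: "eHx x n k u v \<longleftrightarrow> padj H u v" if "u < k" "v < k" for u v
  proof -
    have "k*u+v+n+1+n*n+k+1 = (n+1+n*n) + (k*u+v+k+1)" by simp
    then show ?thesis using enc_nth(3)[OF H k that] lG unfolding eHx_def x by (simp only: nth_append) (simp add: add.assoc)
  qed
  have "wf_word x k n" unfolding wf_word_def
    using lG lH enc_nth(1,2)[OF G n_def] enc_nth(1,2)[OF H k] by (simp add: x nth_append)
  moreover have "simple n (eGx x n)" using simple_padj[OF G] simple_cong[OF e1] n_def by simp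
  moreover have "simple k (eHx x n k)" using simple_padj[OF H] simple_cong[OF e2] k by simp
  moreover obtain cp role where "copies k (padj H) (card (verts H0)) (padj H0) cp role" using factor_copies[OF H0 F] k by blast
  then have "copies k (eHx x n k) (card (verts H0)) (padj H0) cp role" by (rule copies_mono[rotated]) (simp add: e2)
  moreover obtain p where p: "phom n k (padj G) (padj H) p" using hom_phom[OF G H f] k n_def by blast
  then have "phom n k (eGx x n) (eHx x n k) p" by (rule phom_cong) (simp_all add: e1 e2)
  ultimately show ?R by blast
next
  assume ?R
  then obtain n cp role f where w: "wf_word x k n" and s: "simple n (eGx x n)" "simple k (eHx x n k)"
    and c: "copies k (eHx x n k) (card (verts H0)) (padj H0) cp role" and f: "phom n k (eGx x n) (eHx x n k) f" by blast
  let ?G = "pgraph n (eGx x n)" and ?H = "pgraph k (eHx x n k)"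
  have l: "length (encode_ograph ?G) = n + 1 + n * n" "length (encode_ograph ?H) = k + 1 + k * k"
    using enc_length pgraph(3)[OF s(1)] pgraph(3)[OF s(2)] by metis+
  have eqG: "encode_ograph ?G ! i = x ! i" if i: "i < n + 1 + n * n" for i
  proof -
    note E = enc_nth[OF pgraph(1)[OF s(1)] pgraph(3)[OF s(1), symmetric]]
    consider "i < n" | "i = n" | "n < i" by linarith
    then show ?thesis
    proof cases
      case 3
      define j where "j = i - n - 1"
      have j: "i = j + n + 1" "j < n * n" using 3 i by (simp_all add: j_def)
      then have n0: "n > 0" by (cases n) auto
      have d: "j div n < n" "j mod n < n" using j n0 by (simp_all add: less_mult_imp_div_less)
      have "encode_ograph ?G ! (n * (j div n) + j mod n + n + 1) = x ! (n * (j div n) + j mod n + n + 1)"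
        using E(3)[OF d] pgraph(4)[OF s(1) d] by (simp add: eGx_def)
      then show ?thesis using j by simp
    qed (use E w in \<open>auto simp: wf_word_def\<close>)
  qed
  have eqH: "encode_ograph ?H ! i = x ! (n + 1 + n * n + i)" if i: "i < k + 1 + k * k" for i
  proof -
    note E = enc_nth[OF pgraph(1)[OF s(2)] pgraph(3)[OF s(2), symmetric]]
    consider "i < k" | "i = k" | "k < i" by linarith
    then show ?thesis
    proof cases
      case 3
      define j where "j = i - k - 1"
      have j: "i = j + k + 1" "j < k * k" using 3 i by (simp_all add: j_def)
      then have n0: "k > 0" by (cases k) auto
      have d: "j div k < k" "j mod k < k" using j n0 by (simp_all add: less_mult_imp_div_less)
      have "encode_ograph ?H ! (k * (j div k) + j mod k + k + 1) = x ! (k * (j div k) + j mod k + n + 1 + n * n + k + 1)"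
        using E(3)[OF d] pgraph(4)[OF s(2) d] by (simp add: eHx_def)
      then show ?thesis using j by (simp add: algebra_simps)
    qed (use E w in \<open>auto simp: wf_word_def\<close>)
  qed
  have x: "x = encode_ograph ?G @ encode_ograph ?H"
  proof (rule nth_equalityI)
    show "length x = length (encode_ograph ?G @ encode_ograph ?H)" using w l by (simp add: wf_word_def)
    fix i assume "i < length x"
    then show "x ! i = (encode_ograph ?G @ encode_ograph ?H) ! i"
      using eqG[of i] eqH[of "i - (n+1+n*n)"] w l by (auto simp: nth_append wf_word_def)
  qed
  have "ordered_hom ?G ?H f"
    unfolding ordered_hom_def using f pgraph(5)[OF s(1)] pgraph(5)[OF s(2)]
    by (auto simp: phom_def mono_on_def pgraph_def)
  then have "ordered_graph ?G \<and> ordered_factor H0 ?H \<and> (\<exists>f. ordered_hom ?G ?H f)"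
    using pgraph(1)[OF s(1)] copies_factor[OF H0 s(2) c] by blast
  moreover have "(x, k) = (encode_ograph ?G @ encode_ograph ?H, card (verts ?H))"
    unfolding prod.inject by (intro conjI x pgraph(3)[OF s(2), symmetric])
  ultimately show ?L unfolding ordered_hom_factor_problem_def mem_Collect_eq
    by (intro exI[of _ ?G] exI[of _ ?H]) iprover
qed

section \<open>The program\<close>

definition setr :: "nat \<Rightarrow> nat \<Rightarrow> state \<Rightarrow> state \<Rightarrow> bool" where
  "setr r x s s' \<longleftrightarrow> mem s' = mem s \<and> (\<forall>i<16. reg s' i = (if i = r then x else reg s i))"

section \<open>Programs that set a register or fill the table\<close>

lemma poly_add:
  fixes N :: nat
  shows "C * (N+1) ^ d + C' * (N+1) ^ d' \<le> (C + C') * (N+1) ^ (d + d')"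
proof -
  have "C * (N+1) ^ d \<le> C * (N+1) ^ (d+d')" "C' * (N+1) ^ d' \<le> C' * (N+1) ^ (d+d')"
    by (intro mult_le_mono power_increasing; simp)+
  then show ?thesis by (simp only: add_mult_distrib)
qed

lemma set_reg:
  assumes "D OK (\<lambda>s c. F s)"
  shows "\<exists>p C d. \<forall>s. OK s \<longrightarrow> runs p s (C * (reg s 2 + 1) ^ d) (setr r (F s) s)"
proof -
  obtain e where e: "\<And>s c. OK s \<Longrightarrow> eval e s c = F s" using assms unfolding D_def by blast
  obtain C d where C: "\<And>N. cost e N \<le> C * (N + 1) ^ d" using cost_poly by blast
  have "runs (Seq (compile e [] 16) (Assign r (Reg 16))) s ((C+1) * (reg s 2 + 1) ^ d) (setr r (F s) s)" if "OK s" for s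
  proof (rule runs_mono[OF runs_Seq[OF compile_runs]])
    fix s' assume "same 16 s s' \<and> reg s' 16 = eval e s (map (reg s) [])"
    then show "runs (Assign r (Reg 16)) s' 1 (setr r (F s) s)"
      by (intro runs_Assign) (auto simp: setr_def same_def e[OF that])
  next
    have "1 \<le> (reg s 2 + 1) ^ d" by simp
    then show "cost e (reg s 2) + 1 \<le> (C+1) * (reg s 2 + 1) ^ d" using C[of "reg s 2"] unfolding add_mult_distrib by linarith
  qed auto
  then show ?thesis by blast
qed

text \<open>Course-of-values recursion on memory cells: \<open>E\<close> may inspect all cells
  written so far.\<close>

primrec tmem :: "(nat \<Rightarrow> (nat \<Rightarrow> nat) \<Rightarrow> nat) \<Rightarrow> nat \<Rightarrow> (nat \<Rightarrow> nat) \<Rightarrow> nat \<Rightarrow> nat \<Rightarrow> nat" where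
  "tmem E l m 0 = m"
| "tmem E l m (Suc i) = (tmem E l m i)(l + i := E i (tmem E l m i))"

lemma tmem_low: "a < l \<Longrightarrow> tmem E l m i a = m a" by (induction i) auto
lemma tmem_at: "i < j \<Longrightarrow> tmem E l m j (l + i) = E i (tmem E l m i)"
  by (induction j) (auto simp: less_Suc_eq)

text \<open>The memory changes from round to round, so \<open>OK\<close> is demanded for arbitrary
  memory and scratch registers, and for every value of register 5.\<close>

lemma table_loop:
  assumes "D OK (\<lambda>s c. F s)"
  shows "\<exists>p C d. \<forall>s. reg s 5 = 0 \<and> (\<forall>s'. (\<forall>i<16. i \<noteq> 5 \<longrightarrow> reg s' i = reg s i) \<longrightarrow> OK s') \<longrightarrow>
    runs p s (C * (reg s 2 + 1) ^ d) (\<lambda>s'. (\<forall>i<16. i \<noteq> 5 \<longrightarrow> reg s' i = reg s i) \<and>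
      mem s' = tmem (\<lambda>i m. F (s\<lparr>reg := (reg s)(5 := i), mem := m\<rparr>)) (reg s 0) (mem s) (reg s 2))"
proof -
  obtain e where e: "\<And>s c. OK s \<Longrightarrow> eval e s c = F s" using assms unfolding D_def by blast
  obtain C d where C: "\<And>N. cost e N \<le> C * (N + 1) ^ d" using cost_poly by blast
  let ?body = "Seq (compile e [] 16) (Seq (Store (Plus (Reg 0) (Reg 5)) (Reg 16)) (Assign 5 (Plus (Reg 5) (Num 1))))"
  let ?p = "While (Minus (Reg 2) (Reg 5)) ?body"
  have "runs ?p s ((C+4) * (reg s 2 + 1) ^ (d+1)) (\<lambda>s'. (\<forall>i<16. i \<noteq> 5 \<longrightarrow> reg s' i = reg s i) \<and>
      mem s' = tmem (\<lambda>i m. F (s\<lparr>reg := (reg s)(5 := i), mem := m\<rparr>)) (reg s 0) (mem s) (reg s 2))"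
    if s: "reg s 5 = 0" and OK: "\<And>s'. (\<forall>i<16. i \<noteq> 5 \<longrightarrow> reg s' i = reg s i) \<Longrightarrow> OK s'" for s
  proof -
    let ?N = "reg s 2"
    define E where "E = (\<lambda>i m. F (s\<lparr>reg := (reg s)(5 := i), mem := m\<rparr>))"
    define I where "I j s' \<longleftrightarrow> (\<forall>i<16. i \<noteq> 5 \<longrightarrow> reg s' i = reg s i) \<and> reg s' 5 \<le> ?N \<and> ?N - reg s' 5 \<le> j \<and>
       mem s' = tmem E (reg s 0) (mem s) (reg s' 5)" for j and s' :: state
    have st: "runs (Store a b) s T P" if "P (s\<lparr>mem := (mem s)(eval_exp a s := eval_exp b s)\<rparr>)" "1 \<le> T" for a b s T P
      using that exec.Store unfolding runs_def by blast
    have step: "runs ?body s1 (cost e ?N + (1 + 1)) (\<lambda>s'. \<exists>i\<le>j. I i s')"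
      if I: "I (Suc j) s1" and ne: "eval_exp (Minus (Reg 2) (Reg 5)) s1 \<noteq> 0" for j and s1 :: state
    proof -
      have r: "\<forall>i<16. i \<noteq> 5 \<longrightarrow> reg s1 i = reg s i" and m: "mem s1 = tmem E (reg s 0) (mem s) (reg s1 5)"
        and b: "reg s1 5 < ?N" "?N - reg s1 5 \<le> Suc j" using I ne by (auto simp: I_def)
      have c2: "reg s1 2 = ?N" "reg s1 0 = reg s 0" using r by auto
      let ?b = "s\<lparr>reg := (reg s)(5 := reg s1 5), mem := mem s1\<rparr>"
      have "same 16 ?b s1" using r by (auto simp: same_def)
      then have ev: "eval e s1 [] = E (reg s1 5) (mem s1)" using eval_same[of ?b s1 e "[]"] e[of ?b] OK[of ?b] by (simp add: E_def)
      show ?thesis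
      proof (rule runs_Seq)
        show "runs (compile e [] 16) s1 (cost e ?N) (\<lambda>s'. same 16 s1 s' \<and> reg s' 16 = E (reg s1 5) (mem s1))"
          using compile_runs[of 16 "[]" e s1] ev c2 by simp
        fix s2 :: state assume 2: "same 16 s1 s2 \<and> reg s2 16 = E (reg s1 5) (mem s1)"
        show "runs (Seq (Store (Plus (Reg 0) (Reg 5)) (Reg 16)) (Assign 5 (Plus (Reg 5) (Num 1)))) s2 (1 + 1) (\<lambda>s'. \<exists>i\<le>j. I i s')"
        proof (rule runs_Seq)
          show "runs (Store (Plus (Reg 0) (Reg 5)) (Reg 16)) s2 1 (\<lambda>s3. (\<forall>i<16. reg s3 i = reg s1 i) \<and>
             mem s3 = tmem E (reg s 0) (mem s) (Suc (reg s1 5)))"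
            by (rule st) (use 2 m c2 in \<open>auto simp: same_def\<close>)
          fix s3 :: state assume 3: "(\<forall>i<16. reg s3 i = reg s1 i) \<and> mem s3 = tmem E (reg s 0) (mem s) (Suc (reg s1 5))"
          have "I j (s3\<lparr>reg := (reg s3)(5 := reg s3 5 + 1)\<rparr>)" unfolding I_def using 3 r b by auto
          then show "runs (Assign 5 (Plus (Reg 5) (Num 1))) s3 1 (\<lambda>s'. \<exists>i\<le>j. I i s')" by (intro runs_Assign) auto
        qed
      qed
    qed
    have I0: "I ?N s" using s by (simp add: I_def)
    show ?thesis
    proof (rule runs_mono[OF runs_While[where I=I and T="cost e ?N + (1+1)" and j="?N", OF step _ I0]])
      have "cost e ?N + 3 \<le> (C + 3) * (?N + 1) ^ d"
        using C[of ?N] one_le_power[of "?N + 1" d] unfolding add_mult_distrib by linarith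
      then have "?N * (cost e ?N + 3) \<le> ?N * ((C + 3) * (?N + 1) ^ d)" by (rule mult_le_mono2)
      moreover have "?N * ((C + 3) * (?N + 1) ^ d) + (C+3) * (?N+1) ^ d = (C+3) * (?N+1) ^ (d+1)" by (simp add: algebra_simps)
      moreover have "1 \<le> (?N+1) ^ (d+1)" by (rule one_le_power) simp
      moreover have "(C+4) * (?N+1) ^ (d+1) = (C+3) * (?N+1) ^ (d+1) + (?N+1) ^ (d+1)" by (simp add: algebra_simps)
      ultimately have "1 + ?N * (cost e ?N + 3) \<le> (C+4) * (?N+1) ^ (d+1)" by linarith
      moreover have "cost e ?N + (1+1) + 1 = cost e ?N + 3" by simp
      ultimately show "1 + ?N * (cost e ?N + (1+1) + 1) \<le> (C+4) * (?N+1) ^ (d+1)" by (simp only:)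
      fix s' assume "\<exists>i\<le>?N. I i s' \<and> eval_exp (Minus (Reg 2) (Reg 5)) s' = 0"
      then obtain i where i: "I i s'" "reg s' 2 \<le> reg s' 5" by auto
      then have "reg s' 5 = ?N" by (auto simp: I_def)
      then show "(\<forall>i<16. i \<noteq> 5 \<longrightarrow> reg s' i = reg s i) \<and> mem s' = tmem (\<lambda>i m. F (s\<lparr>reg := (reg s)(5 := i), mem := m\<rparr>)) (reg s 0) (mem s) ?N"
        using i unfolding I_def E_def by simp
    qed (auto simp: I_def)
  qed
  then show ?thesis by blast
qed

text \<open>The program evaluates this while its clock is only the word length plus
  \<open>k + 1\<close>, possibly too short for \<open>k * (k+1)\<close> rounds of one loop. Two
  nested loops need only \<open>k + 1\<close> rounds each, and they multiply by the constant
  \<open>b\<close> alone.\<close>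

definition expo :: "nat \<Rightarrow> nat \<Rightarrow> nat \<Rightarrow> nat" where
  "expo b k N = rec_nat 1 (\<lambda>t x. if t < k + 1 then rec_nat x (\<lambda>t y. if t < k then b * y else y) N else x) N"

lemma D_expo: "D OK (\<lambda>s c. expo b (reg s 1) (reg s 2))"
  unfolding expo_def by (intro D_loop D_if DP_less D_add D_cmul D_cst D_hd D_wk[OF D_hd] D_glb) auto

lemma expo: assumes "k + 1 \<le> N"
  shows "expo b k N = b ^ (k * (k+1))"
proof -
  have 1: "rec_nat x (\<lambda>t y. if t < k then b * y else y) M = b ^ min k M * x" for x M
    by (induction M) (auto simp: min_def le_Suc_eq)
  have 2: "rec_nat 1 (\<lambda>t x. if t < k + 1 then b ^ k * x else x) M = (b ^ k) ^ min (k+1) M" for M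
    by (induction M) (auto simp: min_def le_Suc_eq)
  have 3: "min k N = k" "min (k+1) N = k+1" using assms by auto
  show ?thesis unfolding expo_def 1 3 2 by (simp only: power_mult)
qed

lemma D_pow2: "D OK (\<lambda>s c. rec_nat 1 (\<lambda>t x. if t < reg s 1 then 2 * x else x) (reg s 2))"
  by (intro D_loop D_if DP_less D_cmul D_cst D_hd D_wk[OF D_hd] D_glb) auto

lemma pow2: "k \<le> N \<Longrightarrow> rec_nat 1 (\<lambda>t x. if t < k then 2 * x else x) N = (2::nat) ^ k"
proof -
  have "rec_nat 1 (\<lambda>t x. if t < k then 2 * x else x) M = (2::nat) ^ min k M" for M
    by (induction M) (auto simp: min_def le_Suc_eq)
  then show "k \<le> N \<Longrightarrow> ?thesis" by (simp add: min_absorb1)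
qed

text \<open>The exponent is a constant of the program, so the power is a fixed number of
  multiplications by register 9.\<close>

lemma D_bpow: "D (\<lambda>s. reg s 9 \<le> reg s 2) (\<lambda>s c. reg s 9 ^ a)"
proof (induction a)
  case (Suc a)
  have "D (\<lambda>s. reg s 9 \<le> reg s 2) (\<lambda>s c. reg s 9 * reg s 9 ^ a)" by (intro D_mult Suc D_glb) auto
  then show ?case by simp
qed (simp add: D_cst)

lemma computable_expo: "computable (\<lambda>k. a * b ^ (k * (k+1)))"
proof -
  have "D (\<lambda>_. True) (\<lambda>s c. a * expo b (reg s 1) (reg s 2))"
    by (intro D_cmul D_expo)
  from set_reg[OF this, of 0] obtain p C d where p: "\<And>s. runs p s (C * (reg s 2 + 1) ^ d)
    (setr 0 (a * expo b (reg s 1) (reg s 2)) s)"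
    by blast
  have "\<exists>t s. exec (Seq (Assign 2 (Plus (Reg 1) (Num 1))) p) (input_state [] k) t s \<and> reg s 0 = a * b ^ (k * (k+1))" for k
  proof -
    let ?s = "(input_state [] k)\<lparr>reg := (reg (input_state [] k))(2 := k + 1)\<rparr>"
    have "exec (Assign 2 (Plus (Reg 1) (Num 1))) (input_state [] k) 1 ?s"
      using exec.Assign[of 2 "Plus (Reg 1) (Num 1)" "input_state [] k"] by (simp add: input_state_def)
    moreover obtain t s' where "exec p ?s t s'" "reg s' 0 = a * b ^ (k * (k+1))"
      using p[of ?s] expo[of k "k+1" b] unfolding runs_def setr_def by (auto simp: input_state_def)
    ultimately show ?thesis using exec.Seq by blast
  qed
  then show ?thesis unfolding computable_def by blast
qed

text \<open>The code of a single zone with all positions and all letters.\<close>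

definition zfull :: "nat \<Rightarrow> nat \<Rightarrow> nat \<Rightarrow> nat" where
  "zfull B n k = B * (n + B * (B * (k - 1)))"

lemma zfull_less: assumes "n + k < B" shows "zfull B n k < B ^ 4"
proof -
  have "B * (k - 1) + B \<le> B * B" using assms mult_le_mono2[of "Suc (k-1)" B B] by (simp add: algebra_simps)
  then have "B * (k - 1) < B * B" using assms by linarith
  then have "B * (B * (k-1)) + B \<le> B * (B * B)" using mult_le_mono2[OF Suc_leI, of "B * (k-1)" "B*B" B] by (simp only: mult_Suc_right add.commute)
  then have "n + B * (B * (k-1)) < B * (B * B)" using assms by linarith
  then have "B * (n + B * (B * (k-1))) < B * (B * (B * B))" using assms by simp
  then show ?thesis by (simp add: zfull_def power4_eq_xxxx mult.assoc)
qed

lemma zfull_digit: assumes "n + k < B"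
  shows "zfull B n k div B ^ i mod B = (if i = 1 then n else if i = 3 then k - 1 else 0)"
proof -
  have B: "B > 0" "n < B" "k - 1 < B" using assms by auto
  consider "i = 0" | "i = 1" | "i = 2" | "i = 3" | "i \<ge> 4" by linarith
  then show ?thesis
  proof cases
    case 5
    then have "B ^ 4 \<le> B ^ i" using B by (intro power_increasing) auto
    then have "zfull B n k < B ^ i" using zfull_less[OF assms] by linarith
    then show ?thesis using 5 by simp
  qed (use B in \<open>auto simp: zfull_def numeral_2_eq_2 numeral_3_eq_3 div_mult2_eq\<close>)
qed

text \<open>When a cell is computed, the word and all earlier cells already have their final
  contents, and by \<open>entry_local\<close> no later cell influences the value.\<close>

lemma entry_table:
  assumes r: "reg s 0 = L" "reg s 1 = k" "reg s 2 = N" "reg s 7 = n" "reg s 9 = B" "reg s 10 = ZB" "reg s 11 = K0"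
    and m: "mem s = tmem (\<lambda>i mm. row Q (s\<lparr>reg := (reg s)(5 := i), mem := mm\<rparr>)) L m0 N"
    and L: "n+1+n*n+k+1+k*k \<le> L"
    and b: "B \<le> N" "ZB \<le> N" "B * ZB * B * K0 \<le> N"
    and x: "S < K0" "j < B" "z < ZB" "w < B"
  shows "tbs s S j z w = solver_base.entry n k (eGs s) (eHs s) (cps s) Q N B ZB K0 (tbs s) S j z w"
proof -
  define E where "E = (\<lambda>i mm. row Q (s\<lparr>reg := (reg s)(5 := i), mem := mm\<rparr>))"
  define ix where "ix = (\<lambda>S j z w. w + B * (z + ZB * (j + B * S)))"
  let ?i = "ix S j z w"
  have lexi: "b + a * Suc c \<le> a * d + b" if "c < d" for a b c d :: nat
    using mult_le_mono2[of "Suc c" d a] that by simp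
  have B0: "B > 0" "ZB > 0" using x by auto
  \<comment> \<open>The cells for one value of \<open>j + B * S\<close> are contiguous, so a smaller
    value puts a cell before all of them.\<close>
  have lt: "ix S' j' z' w' < B * ZB * (j0 + B * S0)"
    if "j' + B * S' < j0 + B * S0" "z' < ZB" "w' < B" for S' j' z' w' j0 S0
  proof -
    have "z' + ZB * (j' + B * S') < ZB * Suc (j' + B * S')" using that by simp
    also have "\<dots> \<le> ZB * (j0 + B * S0)" using that(1) by (intro mult_le_mono2) simp
    finally have 1: "z' + ZB * (j' + B * S') < ZB * (j0 + B * S0)" .
    have "ix S' j' z' w' < B * Suc (z' + ZB * (j' + B * S'))" using that unfolding ix_def by simp
    also have "\<dots> \<le> B * (ZB * (j0 + B * S0))" using 1 by (intro mult_le_mono2) simp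
    finally show ?thesis by (simp only: mult.assoc)
  qed
  have js: "j + B * S < 0 + B * K0" using x(1,2) mult_le_mono2[of "Suc S" K0 B] by simp
  have iN: "?i < N" using lt[OF js x(3,4)] b(3) by (simp add: mult.assoc)
  have dec: "dvc N ?i B = z + ZB * (j + B * S)" "mdc N ?i B = w"
    "dvc N (z + ZB * (j + B * S)) ZB = j + B * S" "mdc N (z + ZB * (j + B * S)) ZB = z"
    "dvc N (j + B * S) B = S" "mdc N (j + B * S) B = j"
  proof -
    have 1: "z + ZB * (j + B * S) \<le> ?i" unfolding ix_def using B0 by (simp add: trans_le_add2)
    have 2: "j + B * S \<le> z + ZB * (j + B * S)" using B0 by (simp add: trans_le_add2)
    show "dvc N ?i B = z + ZB * (j + B * S)" "mdc N ?i B = w" using dvc[OF iN B0(1)] mdc[OF iN B0(1)] x by (simp_all add: ix_def)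
    have 3: "z + ZB * (j + B * S) < N" using 1 iN by linarith
    show "dvc N (z + ZB * (j + B * S)) ZB = j + B * S" "mdc N (z + ZB * (j + B * S)) ZB = z"
      using dvc[OF 3 B0(2)] mdc[OF 3 B0(2)] x by simp_all
    have 4: "j + B * S < N" using 2 3 by linarith
    show "dvc N (j + B * S) B = S" "mdc N (j + B * S) B = j"
      using dvc[OF 4 B0(1)] mdc[OF 4 B0(1)] x by simp_all
  qed
  let ?s = "s\<lparr>reg := (reg s)(5 := ?i), mem := tmem E L m0 ?i\<rparr>"
  \<comment> \<open>The table starts at \<open>L\<close>, behind the word, so the encoded graphs
    look the same in every round.\<close>
  have low: "mem ?s a = mem s a" if "a < L" for a using that m by (simp add: tmem_low)
  have eG: "eGs ?s = eGs s"
  proof (intro ext)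
    fix u v
    have "mem ?s (n*u+v+n+1) = mem s (n*u+v+n+1)" if uv: "u < n" "v < n"
    proof (rule low)
      have "n * u + n \<le> n * n" using mult_le_mono2[of "Suc u" n n] uv by simp
      then show "n*u+v+n+1 < L" using L uv by linarith
    qed
    then show "eGs ?s u v = eGs s u v" unfolding eGs_def using r by auto
  qed
  have eH: "eHs ?s = eHs s"
  proof (intro ext)
    fix u v
    have "mem ?s (k*u+v+n+1+n*n+k+1) = mem s (k*u+v+n+1+n*n+k+1)" if uv: "u < k" "v < k"
    proof (rule low)
      have "k * u + k \<le> k * k" using mult_le_mono2[of "Suc u" k k] uv by simp
      then show "k*u+v+n+1+n*n+k+1 < L" using L uv by linarith
    qed
    then show "eHs ?s u v = eHs s u v" unfolding eHs_def using r by auto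
  qed
  have cp: "cps ?s = cps s" by (rule ext) (simp add: cps_def)
  have tb: "tbs ?s S' j' z' w' = tbs s S' j' z' w'" if o: "S' < S \<or> S' = S \<and> j' < j" for S' j' z' w'
  proof (cases "j' < B \<and> z' < ZB \<and> w' < B")
    case True
    have "j' + B * S' < j + B * S"
    proof (cases "S' < S")
      case True': True
      then show ?thesis using True mult_le_mono2[of "Suc S'" S B] by simp
    qed (use o in simp)
    then have "ix S' j' z' w' < B * ZB * (j + B * S)" using lt True by blast
    also have "\<dots> \<le> ?i" unfolding ix_def by (simp add: algebra_simps)
    finally have i: "ix S' j' z' w' < ?i" .
    have "mem ?s (L + ix S' j' z' w') = mem s (L + ix S' j' z' w')"
      using tmem_at[OF i, of E L m0] tmem_at[of "ix S' j' z' w'" N E L m0] i iN m by (simp add: E_def)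
    then show ?thesis using r True by (simp add: tbs_def ix_def)
  qed (use r in \<open>auto simp: tbs_def\<close>)
  have "tbs s S j z w = mem s (L + ?i)" using x r by (simp add: tbs_def ix_def)
  also have "\<dots> = E ?i (tmem E L m0 ?i)" using tmem_at[OF iN] m by (simp add: E_def)
  also have "\<dots> = row Q ?s" by (simp add: E_def)
  also have "\<dots> = solver_base.entry n k (eGs ?s) (eHs ?s) (cps ?s) Q N B ZB K0 (tbs ?s) S j z w"
    unfolding row_def Let_def using r by (simp add: dec)
  also have "\<dots> = solver_base.entry n k (eGs s) (eHs s) (cps s) Q N B ZB K0 (tbs s) S j z w"
    unfolding eG eH cp by (rule solver_base.entry_local) (rule tb)
  finally show ?thesis .
qed

section \<open>From the filled table to the existence of a homomorphism\<close>

lemma copies_size: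
  assumes "copies k e m R cp role"
  shows "card {h. h < k \<and> cp h = s} \<le> m"
proof -
  have "inj_on role {h. h < k \<and> cp h = s}"
  proof (rule inj_onI)
    fix a b assume a: "a \<in> {h. h < k \<and> cp h = s}" and b: "b \<in> {h. h < k \<and> cp h = s}" and e: "role a = role b"
    have "x < k \<Longrightarrow> y < k \<Longrightarrow> cp x = cp y \<Longrightarrow> x < y \<Longrightarrow> role x < role y" for x y using assms unfolding copies_def by blast
    from this[of a b] this[of b a] show "a = b" using a b e by (cases a b rule: linorder_cases) auto
  qed
  moreover have "role ` {h. h < k \<and> cp h = s} \<subseteq> {..<m}" using assms unfolding copies_def by auto
  ultimately show ?thesis using card_inj_on_le[of role _ "{..<m}"] by simp
qed

text \<open>The original problem is one instance of the table: \<open>K0 - 1\<close> is the code of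
  the set of all copies, \<open>n * n\<close> makes every edge count, and the single zone imposes no
  restriction.\<close>

lemma table_answer:
  assumes r: "reg s 0 = L" "reg s 1 = k" "reg s 2 = N" "reg s 7 = n" "reg s 9 = B" "reg s 10 = ZB" "reg s 11 = K0"
    and m: "mem s = tmem (\<lambda>i mm. row Q (s\<lparr>reg := (reg s)(5 := i), mem := mm\<rparr>)) L m0 N"
    and L: "n+1+n*n+k+1+k*k \<le> L"
    and Qm: "5 * m * ((1 + 10 * m) * m) \<le> Q" and Q0: "0 < Q"
    and B: "n + k < B" "2 ^ k \<le> B" "n * n < B" and ZB: "ZB = B ^ (4*Q)" and K0: "K0 = 2 ^ k"
    and N: "B * ZB * B ^ (3*Q) < N" "K0 ^ (10*k+10) < N" "10*k+10 \<le> N" "4*Q \<le> N" "B * ZB * B * K0 \<le> N"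
    and c: "copies k (eHs s) m R (cps s) role"
  shows "tbs s (K0 - 1) (n*n) (zfull B n k) 0 \<noteq> 0 \<longleftrightarrow> (\<exists>f. phom n k (eGs s) (eHs s) f)"
proof -
  note C = c[unfolded copies_def, rule_format]
  have NN: "B \<le> N" "ZB \<le> N"
  proof -
    have p: "1 \<le> B" "1 \<le> ZB" "1 \<le> B ^ (3*Q)" using B ZB by (simp_all add: Suc_leI)
    have "B * 1 * 1 \<le> B * ZB * B ^ (3*Q)" "1 * ZB * 1 \<le> B * ZB * B ^ (3*Q)" using p by (intro mult_le_mono; simp)+
    then show "B \<le> N" "ZB \<le> N" using N(1) by linarith+
  qed
  interpret solver n k "eGs s" "eHs s" "cps s" Q N B ZB K0 m "tbs s"
  proof (unfold_locales, goal_cases)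
    case (1 h h') then show ?case using C(1) c unfolding copies_def by blast
  next
    case (2 s') show ?case by (rule copies_size[OF c])
  next
    case 3 show ?case by (rule Qm)
  next
    case (4 h) then show ?case using c unfolding copies_def by blast
  next
    case (14 S j z w)
    then show ?case by (intro entry_table[OF r m L NN N(5)]) (use B K0 in auto)
  qed (use B ZB K0 N in auto)
  let ?z = "zfull B n k"
  let ?S = "K0 - 1"
  have S: "?S < 2 ^ k" by (simp add: K0)
  have "set_encode {..<k} = 2 ^ k - 1" unfolding set_encode_def by (simp add: mask_eq_sum_exp_nat[symmetric] lessThan_def)
  then have Sk: "Sset ?S = {..<k}" using Sset(1)[OF S] set_encode_inverse[of "{..<k}"] by (simp add: K0)
  have "B ^ 4 \<le> ZB" unfolding ZB using B Q0 by (intro power_increasing) auto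
  then have z: "?z < ZB" using zfull_less[OF B(1)] by linarith
  have za: "za ?z i = (if i = 1 then n else if i = 3 then k - 1 else 0)" if "i < 4*Q" for i
    unfolding za_def using digc[of ?z N B i] zfull_digit[OF B(1), of i] z NN B0 N(4) that by simp
  have iz: "inz (za ?z) i w \<longleftrightarrow> i = 0 \<and> w < n" if "i < Q" for i w
    using that by (auto simp: inz_def za)
  have ir: "inr (za ?z) 0 h \<longleftrightarrow> h \<le> k - 1" for h using Q0 by (simp add: inr_def za)
  have dm: "dom (za ?z) w \<longleftrightarrow> w < n" for w using iz Q0 unfolding dom_def by blast
  have al: "alw (Sset ?S) (za ?z) w h \<longleftrightarrow> h < k" if "w < n" for w h
    using iz ir Q0 cpk that unfolding alw_def Sk by fastforce
  have gd: "good (Sset ?S) (za ?z)"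
    unfolding good_def
  proof (intro allI impI)
    fix i i' assume i: "i < Q" "i' < Q" "za ?z (4*i) < za ?z (4*i+1)" "za ?z (4*i') < za ?z (4*i'+1)"
    then have "i = 0" "i' = 0" using za[of "4*i+1"] za[of "4*i'+1"] by (auto split: if_splits)
    then show "(\<forall>h<k. cps s h \<in> Sset ?S \<longrightarrow> inr (za ?z) i h \<longrightarrow> inr (za ?z) i' h \<longrightarrow> i = i') \<and>
       (\<forall>w. inz (za ?z) i w \<longrightarrow> inz (za ?z) i' w \<longrightarrow> i = i')" by simp
  qed
  have vl: "valid (n*n) (Sset ?S) (za ?z) f \<longleftrightarrow> phom n k (eGs s) (eHs s) f" for f
  proof -
    have "w * n + w' < n * n" if "w < n" "w' < n" for w w'
      using that mult_le_mono1[of "Suc w" n n] by simp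
    then show ?thesis unfolding valid_def phom_def using dm al by auto
  qed
  show ?thesis
  proof
    assume "tbs s ?S (n*n) ?z 0 \<noteq> 0"
    from sound[OF S order_refl z this] show "\<exists>f. phom n k (eGs s) (eHs s) f" using vl by blast
  next
    assume "\<exists>f. phom n k (eGs s) (eHs s) f"
    then show "tbs s ?S (n*n) ?z 0 \<noteq> 0" using complete[OF S order_refl z gd] vl by blast
  qed
qed

text \<open>The fixed graph \<open>H0\<close> enters the program here: its finite adjacency relation
  is hard-wired as a disjunction of cases.\<close>

lemma DP_member:
  assumes "finite A" "D OK F" "D OK G"
  shows "DP OK (\<lambda>s c. (F s c, G s c) \<in> A)"
  using assms(1)
proof (induction A)
  case empty show ?case using DP_const[of OK False] by simp
next
  case (insert p A)
  have "DP OK (\<lambda>s c. (F s c = fst p \<and> G s c = snd p) \<or> (F s c, G s c) \<in> A)"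
    by (intro DP_disj DP_conj DP_eq D_cst assms insert.IH)
  then show ?case by (rule DP_cong) (auto simp: prod_eq_iff)
qed

text \<open>The decomposition into copies is not part of the input and has to be found;
  \<open>X\<close> codes the names of the copies and \<open>Y\<close> the roles. Any decomposition
  will do, as the homomorphisms do not depend on it. The value of the clock signals failure.\<close>

definition cpcode :: "nat \<Rightarrow> (nat \<times> nat) set \<Rightarrow> state \<Rightarrow> nat" where
  "cpcode m A s = mu (reg s 2) (\<lambda>X. \<exists>Y<reg s 2. copies (reg s 1) (eHs s) m (\<lambda>i j. (i, j) \<in> A)
     (\<lambda>h. digc (reg s 2) (reg s 11) h X) (\<lambda>h. digc (reg s 2) (reg s 11) h Y))"

definition wf_flag :: "state \<Rightarrow> nat" where
  "wf_flag s = (if reg s 0 = reg s 7 + 1 + reg s 7 * reg s 7 + reg s 1 + 1 + reg s 1 * reg s 1 \<and>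
     (\<forall>i<reg s 1. mem s (reg s 7 + 1 + reg s 7 * reg s 7 + i) \<noteq> 0) \<and>
     mem s (reg s 7 + 1 + reg s 7 * reg s 7 + reg s 1) = 0 \<and>
     simple (reg s 7) (eGs s) \<and> simple (reg s 1) (eHs s) \<and> reg s 8 < reg s 2 then 1 else 0)"

definition answer :: "state \<Rightarrow> nat" where
  "answer s = (if reg s 12 \<noteq> 0 \<and> tbs s (reg s 11 - 1) (reg s 7 * reg s 7) (zfull (reg s 9) (reg s 7) (reg s 1)) 0 \<noteq> 0 then 1 else 0)"

lemma DP_copies:
  assumes "D (OKE Q) X" "D (OKE Q) Y" "finite A" "m \<le> Q"
  shows "DP (OKE Q) (\<lambda>s c. copies (reg s 1) (eHs s) m (\<lambda>i j. (i, j) \<in> A)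
     (\<lambda>h. digc (reg s 2) (reg s 11) h (X s c)) (\<lambda>h. digc (reg s 2) (reg s 11) h (Y s c)))"
proof -
  note wk = assms(1,2)[THEN D_wk]
  note wk2 = wk[THEN D_wk]
  note wk3 = wk2[THEN D_wk]
  have mQ: "OKE Q s \<Longrightarrow> m \<le> reg s 2" for s using assms(4) by (simp add: OKE_def)
  show ?thesis unfolding copies_def
    by (intro DP_all DP_conj DP_ex DP_imp DP_less DP_eq DP_iff DP_member[OF assms(3)] D_eHs D_digc glb D_cst D_hd D_wk[OF D_hd] D_wk[OF D_wk[OF D_hd]] wk wk2 wk3;
      (erule OKb | erule mQ))
qed

lemma D_cpcode: "finite A \<Longrightarrow> m \<le> Q \<Longrightarrow> D (OKE Q) (\<lambda>s c. cpcode m A s)"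
  unfolding cpcode_def by (intro D_mu DP_ex DP_copies glb D_hd D_wk[OF D_hd]; (assumption | erule OKb))

lemma D_wf_flag: "D (OKE Q) (\<lambda>s c. wf_flag s)"
  unfolding wf_flag_def simple_def
  by (intro D_if DP_conj DP_all DP_not DP_imp DP_eq DP_less D_mem D_add D_mult D_eGs D_eHs D_glb D_cst D_hd D_wk[OF D_hd];
    (erule OKb | simp))

lemma D_answer: "D (OKE Q) (\<lambda>s c. answer s)"
  unfolding answer_def zfull_def
  by (intro D_if DP_conj DP_not DP_eq D_tbs D_add D_sub D_mult D_glb D_cst; (erule OKb | simp))

section \<open>Decoding the input word\<close>

definition imem :: "bool list \<Rightarrow> nat \<Rightarrow> nat" where
  "imem x = (\<lambda>i. if i < length x \<and> x ! i then 1 else 0)"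

text \<open>The first separator determines the number of positions. If the word contains no zero,
  \<open>n\<close> is its whole length and the length equation fails.\<close>

lemma wf_word_iff:
  assumes "n = mu (length x) (\<lambda>i. imem x i = 0)"
  shows "wf_word x k n' \<longleftrightarrow> n' = n \<and> length x = n+1+n*n+k+1+k*k \<and>
    (\<forall>i<k. imem x (n+1+n*n+i) \<noteq> 0) \<and> imem x (n+1+n*n+k) = 0" (is "?l \<longleftrightarrow> ?r")
proof
  assume w: ?l
  have "n = n'" unfolding assms mu_def
  proof (rule Least_equality)
    show "n' < length x \<longrightarrow> imem x n' = 0" using w by (simp add: wf_word_def imem_def)
    fix y assume "y < length x \<longrightarrow> imem x y = 0"
    then show "n' \<le> y" using w by (auto simp: wf_word_def imem_def not_le[symmetric])
  qed
  then show ?r using w by (auto simp: wf_word_def imem_def)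
next
  assume r: ?r
  have "n < length x" using r by simp
  then have "imem x n = 0" using mu_P[of "length x" "\<lambda>i. imem x i = 0"] assms by simp
  moreover have "x ! i" if "i < n" for i
    using not_less_Least[of i "\<lambda>i. i < length x \<longrightarrow> imem x i = 0"] that assms unfolding mu_def imem_def
    by (auto split: if_splits)
  ultimately show ?l using r \<open>n < length x\<close> unfolding wf_word_def by (auto simp: imem_def split: if_splits)
qed

lemma imem_nz: "a < length x \<Longrightarrow> imem x a \<noteq> 0 \<longleftrightarrow> x ! a" by (simp add: imem_def)

lemma edges_word:
  assumes "reg t 1 = k" "reg t 7 = n" "\<And>a. a < length x \<Longrightarrow> mem t a = imem x a" "length x = n+1+n*n+k+1+k*k"
  shows "u < n \<Longrightarrow> v < n \<Longrightarrow> eGs t u v = eGx x n u v" "u < k \<Longrightarrow> v < k \<Longrightarrow> eHs t u v = eHx x n k u v"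
proof -
  show "eGs t u v = eGx x n u v" if uv: "u < n" "v < n"
  proof -
    have "n * u + n \<le> n * n" using mult_le_mono2[of "Suc u" n n] uv by simp
    then have a: "n*u+v+n+1 < length x" using assms(4) uv by linarith
    show ?thesis unfolding eGs_def assms(2) assms(3)[OF a] eGx_def using uv imem_nz[OF a] by blast
  qed
  show "eHs t u v = eHx x n k u v" if uv: "u < k" "v < k"
  proof -
    have "k * u + k \<le> k * k" using mult_le_mono2[of "Suc u" k k] uv by simp
    then have a: "k*u+v+n+1+n*n+k+1 < length x" using assms(4) uv by linarith
    show ?thesis unfolding eHs_def assms(1,2) assms(3)[OF a] eHx_def using uv imem_nz[OF a] by blast
  qed
qed

lemma copies_cong:
  assumes "\<And>h. h < k \<Longrightarrow> cp h = cp' h" "\<And>h. h < k \<Longrightarrow> role h = role' h" "copies k e m R cp role"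
  shows "copies k e m R cp' role'"
proof -
  have "copies k e m R cp' role' = copies k e m R cp role"
    unfolding copies_def
    by (intro all_cong1 ex_cong1 imp_cong conj_cong refl) (simp_all add: assms(1,2))
  then show ?thesis using assms(3) by simp
qed

text \<open>Roles are below \<open>m\<close>, so the relation may be cut down to a finite one that a
  program can contain.\<close>

lemma copies_restrict:
  "copies k e m (\<lambda>i j. (i, j) \<in> {(i, j). i < m \<and> j < m \<and> R i j}) cp role = copies k e m R cp role"
proof (cases "\<forall>h<k. role h < m")
  case True
  then have "h < k \<Longrightarrow> role h < m" for h by blast
  then show ?thesis unfolding copies_def by (intro all_cong1 imp_cong refl conj_cong) simp_all
next
  case False
  then show ?thesis unfolding copies_def by blast
qed

lemma copies_codes:
  assumes "copies k e m R cp role" "(2 ^ k) ^ k \<le> N" "k \<le> N"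
  shows "\<exists>X<N. \<exists>Y<N. copies k e m R (\<lambda>h. digc N (2^k) h X) (\<lambda>h. digc N (2^k) h Y)"
proof -
  note C = assms(1)[unfolded copies_def, rule_format]
  have k: "k < 2 ^ k" by simp
  have c: "h < k \<Longrightarrow> cp h < 2 ^ k" for h using C k by (meson less_trans)
  have "role h < 2 ^ k" if h: "h < k" for h
  proof -
    \<comment> \<open>As soon as there is a letter, all \<open>m\<close> roles occur among
      \<open>k\<close> letters, so \<open>m\<close> is at most \<open>k\<close> and roles fit into
      digits in base \<open>2 ^ k\<close>.\<close>
    have "{..<m} \<subseteq> role ` {..<k}"
    proof
      fix r assume "r \<in> {..<m}"
      then obtain h' where "h' < k" "role h' = r" using C[OF h] by blast
      then show "r \<in> role ` {..<k}" by blast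
    qed
    then have "m \<le> k" using card_mono[of "role ` {..<k}" "{..<m}"] card_image_le[of "{..<k}" role] by simp
    moreover have "role h < m" using C[OF h] by blast
    ultimately show ?thesis using k by linarith
  qed
  then obtain Y where Y: "Y < (2^k)^k" "\<forall>i<k. Y div (2^k)^i mod 2^k = role i" using digits_ex[of k role "2^k"] by blast
  obtain X where X: "X < (2^k)^k" "\<forall>i<k. X div (2^k)^i mod 2^k = cp i" using digits_ex[of k cp "2^k"] c by blast
  have "X < N" "Y < N" using X Y assms(2) by linarith+
  moreover have "copies k e m R (\<lambda>h. digc N (2^k) h X) (\<lambda>h. digc N (2^k) h Y)"
    by (rule copies_cong[OF _ _ assms(1)]) (use X Y \<open>X < N\<close> \<open>Y < N\<close> assms(3) in \<open>simp_all add: digc\<close>)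
  ultimately show ?thesis by blast
qed

text \<open>A triple with time polynomial in \<open>T x k\<close>. Program, constant and degree are
  chosen before the input, which is the uniformity needed in the end.\<close>

definition tri :: "(bool list \<Rightarrow> nat \<Rightarrow> nat) \<Rightarrow> (bool list \<Rightarrow> nat \<Rightarrow> state \<Rightarrow> bool) \<Rightarrow> (bool list \<Rightarrow> nat \<Rightarrow> state \<Rightarrow> bool) \<Rightarrow> bool" where
  "tri T A P \<longleftrightarrow> (\<exists>p C d. \<forall>x k s. A x k s \<longrightarrow> runs p s (C * (T x k + 1) ^ d) (P x k))"

section \<open>Assembling the program from stages\<close>

lemma tri_seq: assumes "tri T A P" "tri T P R" shows "tri T A R"
proof -
  obtain p C d where 1: "\<And>x k s. A x k s \<Longrightarrow> runs p s (C * (T x k + 1) ^ d) (P x k)" using assms(1) unfolding tri_def by blast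
  obtain p' C' d' where 2: "\<And>x k s. P x k s \<Longrightarrow> runs p' s (C' * (T x k + 1) ^ d') (R x k)" using assms(2) unfolding tri_def by blast
  have "runs (Seq p p') s ((C + C') * (T x k + 1) ^ (d + d')) (R x k)" if "A x k s" for x k s
    by (rule runs_mono[OF runs_Seq[OF 1[OF that] 2] poly_add])
  then show ?thesis unfolding tri_def by blast
qed

definition regs :: "bool list \<Rightarrow> (nat \<Rightarrow> nat) \<Rightarrow> state \<Rightarrow> bool" where
  "regs x V s \<longleftrightarrow> mem s = imem x \<and> (\<forall>i<16. reg s i = V i)"

definition st :: "bool list \<Rightarrow> (nat \<Rightarrow> nat) \<Rightarrow> state" where "st x V = \<lparr>reg = V, mem = imem x\<rparr>"

text \<open>Definable functions do not see the scratch registers, so their values carry over between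
  states that differ only there.\<close>

lemma D_same: assumes "D OK (\<lambda>s c. F s)" "OK s" "OK s'" "same 16 s s'" shows "F s' = F s"
proof -
  obtain e where "\<And>s c. OK s \<Longrightarrow> eval e s c = F s" using assms(1) unfolding D_def by blast
  then show ?thesis using eval_same[OF assms(4), of e "[]"] assms(2,3) by metis
qed

lemma tri_set:
  assumes "D OK (\<lambda>s c. F s)" "\<And>x k s. A x k s \<Longrightarrow> OK s \<and> reg s 2 \<le> T x k"
  shows "tri T A (\<lambda>x k s. \<exists>s'. A x k s' \<and> setr r (F s') s' s)"
proof -
  obtain p C d where p: "\<And>s. OK s \<Longrightarrow> runs p s (C * (reg s 2 + 1) ^ d) (setr r (F s) s)" using set_reg[OF assms(1)] by blast
  have "runs p s (C * (T x k + 1) ^ d) (\<lambda>s'. \<exists>s. A x k s \<and> setr r (F s) s s')" if "A x k s" for x k s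
  proof (rule runs_mono[OF p])
    show "OK s" using assms(2) that by blast
    show "C * (reg s 2 + 1) ^ d \<le> C * (T x k + 1) ^ d" using assms(2)[OF that] by (intro mult_le_mono power_mono) auto
  qed (use that in blast)
  then show ?thesis unfolding tri_def by blast
qed

lemma tri_weaken: "tri T A P \<Longrightarrow> (\<And>x k s. P x k s \<Longrightarrow> P' x k s) \<Longrightarrow> tri T A P'"
  unfolding tri_def by (elim exE) (intro exI allI impI, rule runs_mono[OF _ order_refl], blast+)

lemma tri_stage:
  assumes "D OK (\<lambda>s c. F s)" "\<And>x k s. regs x (V x k) s \<Longrightarrow> OK s" "\<And>x k. V x k 2 \<le> T x k"
    and "\<And>x k. F (st x (V x k)) = f x k"
  shows "tri T (\<lambda>x k. regs x (V x k)) (\<lambda>x k. regs x ((V x k)(r := f x k)))"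
proof (rule tri_weaken[OF tri_set[OF assms(1)]])
  show "OK s \<and> reg s 2 \<le> T x k" if "regs x (V x k) s" for x k s
    using assms(2,3) that by (simp add: regs_def)
  fix x k s assume "\<exists>s'. regs x (V x k) s' \<and> setr r (F s') s' s"
  then obtain s' where s: "regs x (V x k) s'" "setr r (F s') s' s" by blast
  have "regs x (V x k) (st x (V x k))" by (simp add: regs_def st_def)
  moreover have "same 16 s' (st x (V x k))" using s(1) by (simp add: regs_def st_def same_def)
  ultimately have "F s' = f x k" using D_same[OF assms(1), of s' "st x (V x k)"] assms(2,4) s(1) by metis
  then show "regs x ((V x k)(r := f x k)) s" using s by (auto simp: regs_def setr_def)
qed

text \<open>The successor in \<open>Q\<close> makes room for the single zone of the original
  instance even when \<open>m\<close> is 0.\<close>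

context
  fixes m Q :: nat and A :: "(nat \<times> nat) set"
  assumes Q_def: "Q = Suc (5 * m * ((1 + 10 * m) * m))" and fin: "finite A"
begin

text \<open>\<open>1024 ^ (k * (k+1))\<close> is \<open>(2 ^ k) ^ (10*k+10)\<close>, which bounds the number of guesses: there are at most
  \<open>5 k\<close> blocks, each with a least and a greatest letter.\<close>

definition Bv :: "bool list \<Rightarrow> nat \<Rightarrow> nat" where "Bv x k = length x + k + 1 + 1024 ^ (k * (k+1))"
text \<open>With \<open>Bv\<close> as base, guesses for a copy stay below the power
  \<open>7 * Q + 1\<close>, and the table has at most the power \<open>4 * Q + 3\<close> of cells.
  The summands 16 and \<open>4 * Q\<close> give slack for linear bounds such as
  \<open>10 * k + 10\<close> and for the digit positions of zone codes.\<close>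

definition Nv :: "bool list \<Rightarrow> nat \<Rightarrow> nat" where "Nv x k = (16 + 4 * Q) * Bv x k ^ (7 * Q + 2)"

text \<open>Register contents after each stage. The clock is raised in three steps, each enough to
  compute the next: word length plus \<open>k + 1\<close> for the exponential function,
  \<open>Bv\<close> for powers of \<open>Bv\<close> with constant exponent, \<open>Nv\<close> for
  all searches.\<close>

definition V0 :: "bool list \<Rightarrow> nat \<Rightarrow> nat \<Rightarrow> nat" where "V0 x k = (\<lambda>_. 0)(0 := length x, 1 := k)"
definition V1 where "V1 x k = (V0 x k)(2 := length x + k + 1)"
definition V2 where "V2 x k = (V1 x k)(11 := 2 ^ k)"
definition V3 where "V3 x k = (V2 x k)(9 := Bv x k)"
definition V4 where "V4 x k = (V3 x k)(2 := Bv x k)"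
definition V5 where "V5 x k = (V4 x k)(10 := Bv x k ^ (4*Q))"
definition V6 where "V6 x k = (V5 x k)(3 := Nv x k)"
definition V7 where "V7 x k = (V6 x k)(2 := Nv x k)"
definition V8 where "V8 x k = (V7 x k)(7 := mu (length x) (\<lambda>i. imem x i = 0))"
definition V9 where "V9 x k = (V8 x k)(8 := cpcode m A (st x (V8 x k)))"
definition V10 where "V10 x k = (V9 x k)(12 := wf_flag (st x (V9 x k)))"
lemmas V_defs = V0_def V1_def V2_def V3_def V4_def V5_def V6_def V7_def V8_def V9_def V10_def

lemma bounds:
  fixes x :: "bool list" and k :: nat
  defines "B \<equiv> Bv x k" and "N \<equiv> Nv x k"
  shows "16 * B \<le> N" "B ^ (4*Q) \<le> N" "B * B ^ (4*Q) * B ^ (3*Q) < N" "(2 ^ k) ^ (10*k+10) < N"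
    "10 * k + 10 \<le> N" "4 * Q \<le> N" "B * B ^ (4*Q) * B * 2 ^ k \<le> N" "2 ^ k \<le> B" "length x + k < B"
    "(2 ^ k) ^ k \<le> N" "k \<le> N" "length x \<le> N" "B \<le> N" "2 ^ k \<le> N" "Q \<le> N"
proof -
  have F: "(1::nat) \<le> 1024 ^ (k * (k+1))" by simp
  have B1: "length x + k + 1 < B" "1024 ^ (k * (k+1)) \<le> B" using F unfolding B_def Bv_def by linarith+
  then have B0: "1 \<le> B" by simp
  have NB: "(16 + 4 * Q) * B ^ i \<le> N" if "i \<le> 7 * Q + 2" for i
    unfolding N_def Nv_def B_def[symmetric] using power_increasing[OF that B0] by (rule mult_le_mono2)
  have N2: "16 * B ^ i \<le> N" "4 * Q * B ^ i \<le> N" if "i \<le> 7 * Q + 2" for i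
    using NB[OF that] by (simp_all add: add_mult_distrib)
  show n1: "16 * B \<le> N" using N2(1)[of 1] by simp
  have p: "B ^ i > 0" for i using B0 by simp
  show "B ^ (4*Q) \<le> N" using N2(1)[of "4*Q"] by simp
  have "7 * Q + 1 = Suc (4 * Q + 3 * Q)" by simp
  then have "B * B ^ (4*Q) * B ^ (3*Q) = B ^ (7*Q+1)" by (simp only: power_Suc power_add mult.assoc)
  then show "B * B ^ (4*Q) * B ^ (3*Q) < N" using N2(1)[of "7*Q+1"] p[of "7*Q+1"] by linarith
  have "k * (10*k+10) = 10 * (k * (k+1))" by (simp add: algebra_simps)
  then have e: "((2::nat) ^ k) ^ (10*k+10) = (2 ^ 10) ^ (k * (k+1))" by (simp only: power_mult[symmetric])
  moreover have t10: "(2::nat) ^ 10 = 1024" by simp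
  moreover have "(1024::nat) ^ (k * (k+1)) < N" using B1 n1 B0 by linarith
  ultimately show big: "((2::nat) ^ k) ^ (10*k+10) < N" by (simp only: e t10)
  show "10 * k + 10 \<le> N" using B1 n1 by linarith
  show q: "4 * Q \<le> N" using N2(2)[of 0] by simp
  have "(2::nat) ^ k \<le> (2 ^ k) ^ (10*k+10)" "((2::nat) ^ k) ^ k \<le> (2 ^ k) ^ (10*k+10)"
    using power_increasing[of 1 "10*k+10" "(2::nat)^k"] power_increasing[of k "10*k+10" "(2::nat)^k"] by simp_all
  moreover have "((2::nat) ^ k) ^ (10*k+10) \<le> B"
    using B1(2) by (simp only: e t10)
  ultimately show kB: "2 ^ k \<le> B" and "(2 ^ k) ^ k \<le> N" using n1 by linarith+
  have "B * B ^ (4*Q) * B * 2 ^ k \<le> B * B ^ (4*Q) * B * B" using kB by (rule mult_le_mono2)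
  also have "\<dots> = B ^ (4*Q) * B ^ 3" by (simp only: power3_eq_cube mult.assoc mult.left_commute)
  also have "\<dots> = B ^ (4*Q+3)" by (simp only: power_add)
  finally show "B * B ^ (4*Q) * B * 2 ^ k \<le> N" using N2(1)[of "4*Q+3"] by (simp add: Q_def)
  show "length x + k < B" "k \<le> N" "length x \<le> N" "B \<le> N" "2 ^ k \<le> N" "Q \<le> N" using B1 n1 kB q by linarith+
qed

lemma OK_regs:
  assumes "\<forall>i<16. i \<noteq> 5 \<longrightarrow> reg s i = V i" "V 2 = Nv x k" "V 1 = k" "V 7 \<le> length x" "V 9 = Bv x k"
    "V 10 = Bv x k ^ (4*Q)" "V 11 = 2 ^ k"
  shows "OKE Q s"
proof -
  have r: "reg s 1 = k" "reg s 2 = Nv x k" "reg s 7 \<le> length x" "reg s 9 = Bv x k" "reg s 10 = Bv x k ^ (4*Q)" "reg s 11 = 2 ^ k"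
    using assms by simp_all
  have "1 \<le> Bv x k" using bounds(9)[where x=x and k=k] by linarith
  then have "2 \<le> Nv x k" using bounds(1)[where x=x and k=k] by linarith
  then show ?thesis unfolding OKE_def using r bounds(2,11-15)[where x=x and k=k] by linarith
qed

lemma V_simps:
  "V1 x k 2 = length x + k + 1" "V1 x k 1 = k" "V1 x k (Suc 0) = k"
  "V2 x k 1 = k" "V2 x k (Suc 0) = k" "V2 x k 2 = length x + k + 1"
  "V3 x k 2 = length x + k + 1" "V3 x k 9 = Bv x k"
  "V4 x k 2 = Bv x k" "V4 x k 9 = Bv x k" "V5 x k 2 = Bv x k" "V5 x k 9 = Bv x k"
  "V6 x k 2 = Bv x k" "V6 x k 3 = Nv x k"
  "V7 x k 0 = length x" "V7 x k 2 = Nv x k"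
  by (simp_all add: V_defs)

lemma V8_simps:
  "V8 x k 0 = length x" "V8 x k 1 = k" "V8 x k (Suc 0) = k" "V8 x k 2 = Nv x k" "V8 x k 5 = 0" "V8 x k 7 = mu (length x) (\<lambda>i. imem x i = 0)"
  "V8 x k 9 = Bv x k" "V8 x k 10 = Bv x k ^ (4*Q)" "V8 x k 11 = 2 ^ k"
  by (simp_all add: V0_def V1_def V2_def V3_def V4_def V5_def V6_def V7_def V8_def)

lemma V9_simps:
  "V9 x k 0 = length x" "V9 x k 1 = k" "V9 x k (Suc 0) = k" "V9 x k 2 = Nv x k" "V9 x k 5 = 0" "V9 x k 7 = mu (length x) (\<lambda>i. imem x i = 0)"
  "V9 x k 9 = Bv x k" "V9 x k 10 = Bv x k ^ (4*Q)" "V9 x k 11 = 2 ^ k" "V9 x k 8 = cpcode m A (st x (V8 x k))"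
  by (simp_all add: V9_def V8_simps)

lemma V10_simps:
  "V10 x k 0 = length x" "V10 x k 1 = k" "V10 x k (Suc 0) = k" "V10 x k 2 = Nv x k" "V10 x k 5 = 0" "V10 x k 7 = mu (length x) (\<lambda>i. imem x i = 0)"
  "V10 x k 9 = Bv x k" "V10 x k 10 = Bv x k ^ (4*Q)" "V10 x k 11 = 2 ^ k" "V10 x k 8 = cpcode m A (st x (V8 x k))"
  "V10 x k 12 = wf_flag (st x (V9 x k))"
  by (simp_all add: V10_def V9_simps)

lemma OK_V8: "regs x (V8 x k) s \<Longrightarrow> OKE Q s"
  by (rule OK_regs[of s "V8 x k" x k]) (simp_all add: V8_simps mu_le regs_def)
lemma OK_V9: "regs x (V9 x k) s \<Longrightarrow> OKE Q s"
  by (rule OK_regs[of s "V9 x k" x k]) (simp_all add: V9_simps mu_le regs_def)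
lemma OK_V10: "\<forall>i<16. i \<noteq> 5 \<longrightarrow> reg s i = V10 x k i \<Longrightarrow> OKE Q s"
  by (rule OK_regs[of s "V10 x k" x k]) (simp_all add: V10_simps mu_le)

lemma stages: "tri Nv (\<lambda>x k. regs x (V0 x k)) (\<lambda>x k. regs x (V10 x k))"
proof -
  have l: "length x + k + 1 \<le> Nv x k" for x k using bounds(9,13)[where x=x and k=k] by linarith
  have s1: "tri Nv (\<lambda>x k. regs x (V0 x k)) (\<lambda>x k. regs x (V1 x k))"
    unfolding V1_def
    by (rule tri_stage[where OK="\<lambda>_. True" and F="\<lambda>s. reg s 0 + reg s 1 + 1"], intro D_add D_glb D_cst)
      (simp_all add: V0_def st_def)
  have s2: "tri Nv (\<lambda>x k. regs x (V1 x k)) (\<lambda>x k. regs x (V2 x k))"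
    unfolding V2_def by (rule tri_stage[OF D_pow2[of "\<lambda>_. True"]]) (rule TrueI, unfold V_simps, rule l, unfold st_def state.simps V_simps, rule pow2, simp)
  have s3: "tri Nv (\<lambda>x k. regs x (V2 x k)) (\<lambda>x k. regs x (V3 x k))"
    unfolding V3_def
    by (rule tri_stage[where OK="\<lambda>_. True" and F="\<lambda>s. reg s 2 + expo 1024 (reg s 1) (reg s 2)"], intro D_add D_glb D_expo)
      (use l in \<open>simp_all add: V_simps st_def expo Bv_def\<close>)
  have s4: "tri Nv (\<lambda>x k. regs x (V3 x k)) (\<lambda>x k. regs x (V4 x k))"
    unfolding V4_def by (rule tri_stage[where OK="\<lambda>_. True" and F="\<lambda>s. reg s 9"], intro D_glb)
      (use l in \<open>simp_all add: V_simps st_def\<close>)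
  have s5: "tri Nv (\<lambda>x k. regs x (V4 x k)) (\<lambda>x k. regs x (V5 x k))"
    unfolding V5_def by (rule tri_stage[OF D_bpow]) (simp_all add: V_simps st_def regs_def bounds(13))
  have s6: "tri Nv (\<lambda>x k. regs x (V5 x k)) (\<lambda>x k. regs x (V6 x k))"
    unfolding V6_def
    by (rule tri_stage[where OK="\<lambda>s. reg s 9 \<le> reg s 2" and F="\<lambda>s. (16 + 4*Q) * reg s 9 ^ (7*Q+2)"], rule D_cmul, rule D_bpow)
      (simp_all add: V_simps st_def regs_def bounds(13), simp add: Nv_def)
  have s7: "tri Nv (\<lambda>x k. regs x (V6 x k)) (\<lambda>x k. regs x (V7 x k))"
    unfolding V7_def by (rule tri_stage[where OK="\<lambda>_. True" and F="\<lambda>s. reg s 3"], intro D_glb)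
      (simp_all add: V_simps st_def bounds(13))
  have s8: "tri Nv (\<lambda>x k. regs x (V7 x k)) (\<lambda>x k. regs x (V8 x k))"
    unfolding V8_def
    by (rule tri_stage[where OK="\<lambda>s. reg s 0 \<le> reg s 2" and F="\<lambda>s. mu (reg s 0) (\<lambda>i. mem s i = 0)"],
        intro D_mu DP_eq D_mem D_glb D_hd D_cst)
      (simp_all add: V_simps st_def regs_def bounds(12))
  have mQ: "m \<le> Q" unfolding Q_def using mult_le_mono2[of 1 "5 * ((1 + 10 * m) * m)" m] by (cases "m = 0") (simp_all add: algebra_simps)
  have s9: "tri Nv (\<lambda>x k. regs x (V8 x k)) (\<lambda>x k. regs x (V9 x k))"
    unfolding V9_def by (rule tri_stage[OF D_cpcode[OF fin mQ]]) (simp_all add: V8_simps OK_V8)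
  have s10: "tri Nv (\<lambda>x k. regs x (V9 x k)) (\<lambda>x k. regs x (V10 x k))"
    unfolding V10_def by (rule tri_stage[OF D_wf_flag[of Q]]) (simp_all add: V9_simps OK_V9)
  show ?thesis by (rule tri_seq[OF s1 tri_seq[OF s2 tri_seq[OF s3 tri_seq[OF s4 tri_seq[OF s5 tri_seq[OF s6 tri_seq[OF s7 tri_seq[OF s8 tri_seq[OF s9 s10]]]]]]]]])
qed

definition tabled :: "bool list \<Rightarrow> nat \<Rightarrow> state \<Rightarrow> bool" where
  "tabled x k s \<longleftrightarrow> (\<forall>i<16. i \<noteq> 5 \<longrightarrow> reg s i = V10 x k i) \<and>
     mem s = tmem (\<lambda>i mm. row Q (s\<lparr>reg := (reg s)(5 := i), mem := mm\<rparr>)) (length x) (imem x) (Nv x k)"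

lemma table_stage: "tri Nv (\<lambda>x k. regs x (V10 x k)) tabled"
proof -
  obtain p C d where p: "\<And>s. reg s 5 = 0 \<Longrightarrow> (\<And>s'. (\<forall>i<16. i \<noteq> 5 \<longrightarrow> reg s' i = reg s i) \<Longrightarrow> OKE Q s') \<Longrightarrow>
    runs p s (C * (reg s 2 + 1) ^ d) (\<lambda>s'. (\<forall>i<16. i \<noteq> 5 \<longrightarrow> reg s' i = reg s i) \<and>
      mem s' = tmem (\<lambda>i m. row Q (s\<lparr>reg := (reg s)(5 := i), mem := m\<rparr>)) (reg s 0) (mem s) (reg s 2))"
    using table_loop[OF D_row[of Q]] by blast
  have "runs p s (C * (Nv x k + 1) ^ d) (tabled x k)" if s: "regs x (V10 x k) s" for x k s
  proof -
    have r: "\<forall>i<16. reg s i = V10 x k i" and m: "mem s = imem x" using s by (auto simp: regs_def)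
    have r': "reg s 0 = length x" "reg s 2 = Nv x k" "reg s 5 = 0" using r by (simp_all add: V10_simps)
    show ?thesis
    proof (rule runs_mono[OF p])
      show "reg s 5 = 0" by (rule r')
      show "OKE Q s'" if "\<forall>i<16. i \<noteq> 5 \<longrightarrow> reg s' i = reg s i" for s'
        by (rule OK_V10[of s' x k]) (use that r in simp)
      show "C * (reg s 2 + 1) ^ d \<le> C * (Nv x k + 1) ^ d" using r' by simp
      fix s' :: state assume s': "(\<forall>i<16. i \<noteq> 5 \<longrightarrow> reg s' i = reg s i) \<and>
        mem s' = tmem (\<lambda>i m. row Q (s\<lparr>reg := (reg s)(5 := i), mem := m\<rparr>)) (reg s 0) (mem s) (reg s 2)"
      \<comment> \<open>The loop describes the memory through its initial state,
        \<open>tabled\<close> through the final one; \<open>row\<close> cannot tell them apart once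
        register 5 and the memory are overwritten.\<close>
      have "row Q (s\<lparr>reg := (reg s)(5 := i), mem := mm\<rparr>) = row Q (s'\<lparr>reg := (reg s')(5 := i), mem := mm\<rparr>)" for i mm
        by (rule D_same[OF D_row[of Q]]; (rule OK_V10[of _ x k])?) (use s' r in \<open>auto simp: same_def\<close>)
      then show "tabled x k s'" unfolding tabled_def using s' r r' m by simp
    qed
  qed
  then show ?thesis unfolding tri_def by blast
qed

text \<open>The table is filled for malformed words too, and the flag discards the result. Memory
  cells stand for edges only if the length is right, so the comparisons below are made under that
  condition, which both sides imply.\<close>

lemma answer_correct:
  assumes s: "tabled x k s" and A: "A = {(i, j). i < m \<and> j < m \<and> R i j}"
  shows "answer s \<noteq> 0 \<longleftrightarrow> (\<exists>n. wf_word x k n \<and> simple n (eGx x n) \<and> simple k (eHx x n k) \<and>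
    (\<exists>cp role. copies k (eHx x n k) m R cp role) \<and> (\<exists>f. phom n k (eGx x n) (eHx x n k) f))"
proof -
  define n where "n = mu (length x) (\<lambda>i. imem x i = 0)"
  let ?u = "st x (V9 x k)" and ?v = "st x (V8 x k)"
  let ?len = "length x = n+1+n*n+k+1+k*k"
  let ?N = "Nv x k"
  let ?code = "\<lambda>X h. digc ?N (2 ^ k) h X"
  have r: "\<forall>i<16. i \<noteq> 5 \<longrightarrow> reg s i = V10 x k i"
    and mm: "mem s = tmem (\<lambda>i mm. row Q (s\<lparr>reg := (reg s)(5 := i), mem := mm\<rparr>)) (length x) (imem x) ?N"
    using s by (simp_all add: tabled_def)
  have rs: "reg s 0 = length x" "reg s 1 = k" "reg s 2 = ?N" "reg s 7 = n" "reg s 9 = Bv x k" "reg s 10 = Bv x k ^ (4*Q)"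
    "reg s 11 = 2 ^ k" "reg s 8 = cpcode m A ?v" "reg s 12 = wf_flag ?u"
    using r by (simp_all add: V10_simps n_def)
  have low: "a < length x \<Longrightarrow> mem s a = imem x a" for a using mm by (simp add: tmem_low)
  note wf = wf_word_iff[OF n_def, of k]
  have ust: "reg ?u 0 = length x" "reg ?u 1 = k" "reg ?u 2 = ?N" "reg ?u 7 = n" "reg ?u 8 = cpcode m A ?v" "mem ?u = imem x"
    by (simp_all add: st_def V9_simps n_def)
  have vst: "reg ?v 1 = k" "reg ?v 7 = n" "mem ?v = imem x" by (simp_all add: st_def V8_simps n_def)
  have eu: "eGs t u v = eGx x n u v" if l: "?len" and uv: "u < n" "v < n" and t: "t \<in> {?u, ?v, s}" for t u v
  proof (rule edges_word(1)[OF _ _ _ l uv])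
    show "reg t 1 = k" "reg t 7 = n" using t ust vst rs by blast+
    show "mem t a = imem x a" if "a < length x" for a using t ust(6) vst(3) low[OF that] by auto
  qed
  have ev: "eHs t u v = eHx x n k u v" if l: "?len" and uv: "u < k" "v < k" and t: "t \<in> {?u, ?v, s}" for t u v
  proof (rule edges_word(2)[OF _ _ _ l uv])
    show "reg t 1 = k" "reg t 7 = n" using t ust vst rs by blast+
    show "mem t a = imem x a" if "a < length x" for a using t ust(6) vst(3) low[OF that] by auto
  qed
  have code: "cpcode m A ?v = mu ?N (\<lambda>X. \<exists>Y<?N. copies k (eHs ?v) m R (?code X) (?code Y))"
    unfolding cpcode_def A copies_restrict by (simp add: st_def V8_simps)
  have cpc: "cpcode m A ?v < ?N \<longleftrightarrow> (\<exists>cp role. copies k (eHx x n k) m R cp role)" if l: "?len"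
  proof
    assume "cpcode m A ?v < ?N"
    then obtain X Y where "copies k (eHs ?v) m R (?code X) (?code Y)" unfolding code mu_iff by blast
    from copies_mono[OF _ this, of "eHx x n k"] show "\<exists>cp role. copies k (eHx x n k) m R cp role" using ev[OF l] by blast
  next
    assume "\<exists>cp role. copies k (eHx x n k) m R cp role"
    then obtain cp role where "copies k (eHx x n k) m R cp role" by blast
    then have "copies k (eHs ?v) m R cp role" by (rule copies_mono[rotated]) (use ev[OF l] in simp)
    from copies_codes[OF this bounds(10,11)[where x=x and k=k]]
    show "cpcode m A ?v < ?N" unfolding code mu_iff by blast
  qed
  have flag: "wf_flag ?u \<noteq> 0 \<longleftrightarrow> wf_word x k n \<and> simple n (eGx x n) \<and> simple k (eHx x n k) \<and> cpcode m A ?v < ?N"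
  proof -
    have "simple n (eGs ?u) = simple n (eGx x n)" "simple k (eHs ?u) = simple k (eHx x n k)" if l: "?len"
      by (rule simple_cong, simp add: eu[OF l] ev[OF l])+
    moreover have "wf_flag ?u \<noteq> 0 \<longleftrightarrow> ?len \<and> (\<forall>i<k. imem x (n+1+n*n+i) \<noteq> 0) \<and> imem x (n+1+n*n+k) = 0 \<and>
      simple n (eGs ?u) \<and> simple k (eHs ?u) \<and> cpcode m A ?v < ?N"
      unfolding wf_flag_def ust by (simp split: if_split)
    ultimately show ?thesis unfolding wf by blast
  qed
  have tab: "tbs s (2 ^ k - 1) (n*n) (zfull (Bv x k) n k) 0 \<noteq> 0 \<longleftrightarrow> (\<exists>f. phom n k (eGx x n) (eHx x n k) f)"
    if "wf_word x k n" and c: "cpcode m A ?v < ?N"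
  proof -
    have l: "?len" using that wf by blast
    have nn: "n + k < Bv x k" "n * n < Bv x k" using bounds(9)[where x=x and k=k] l by linarith+
    from mu_P[OF c[unfolded code]] obtain Y where "copies k (eHs ?v) m R (?code (cpcode m A ?v)) (?code Y)" unfolding code by blast
    then have "copies k (eHs s) m R (?code (cpcode m A ?v)) (?code Y)"
      by (rule copies_mono[rotated]) (use ev[OF l] in simp)
    moreover have "cps s = ?code (cpcode m A ?v)" by (rule ext) (simp add: cps_def rs)
    ultimately have c: "copies k (eHs s) m R (cps s) (?code Y)" by simp
    have "tbs s (2 ^ k - 1) (n*n) (zfull (Bv x k) n k) 0 \<noteq> 0 \<longleftrightarrow> (\<exists>f. phom n k (eGs s) (eHs s) f)"
      by (rule table_answer[OF rs(1-7) mm _ _ _ nn(1) bounds(8)[where x=x and k=k] nn(2) refl refl bounds(3,4,5,6,7)[where x=x and k=k] c])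
        (use l in \<open>simp_all add: Q_def\<close>)
    also have "\<dots> \<longleftrightarrow> (\<exists>f. phom n k (eGx x n) (eHx x n k) f)"
      by (rule iff_exI, rule iffI; erule phom_cong) (use eu[OF l] ev[OF l] in simp_all)
    finally show ?thesis .
  qed
  have len: "?len" and uniq: "n' = n" if "wf_word x k n'" for n'
    using iffD1[OF wf that] by blast+
  have "answer s \<noteq> 0 \<longleftrightarrow> wf_flag ?u \<noteq> 0 \<and> tbs s (2 ^ k - 1) (n*n) (zfull (Bv x k) n k) 0 \<noteq> 0"
    unfolding answer_def rs by simp
  also have "\<dots> \<longleftrightarrow> wf_word x k n \<and> simple n (eGx x n) \<and> simple k (eHx x n k) \<and>
    (\<exists>cp role. copies k (eHx x n k) m R cp role) \<and> (\<exists>f. phom n k (eGx x n) (eHx x n k) f)"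
    unfolding flag using tab cpc[OF len] by blast
  also have "\<dots> \<longleftrightarrow> (\<exists>n. wf_word x k n \<and> simple n (eGx x n) \<and> simple k (eHx x n k) \<and>
    (\<exists>cp role. copies k (eHx x n k) m R cp role) \<and> (\<exists>f. phom n k (eGx x n) (eHx x n k) f))"
    using uniq by metis
  finally show ?thesis .
qed

text \<open>The clock is a fixed power of \<open>Bv\<close>, up to a constant. Since
  \<open>Bv\<close> is at most a function of \<open>k\<close> times the input size, a fixed power of
  it splits in the same way.\<close>

lemma time_bound:
  obtains a b c where "\<And>x k. C * (Nv x k + 1) ^ d \<le> a * b ^ (k * (k+1)) * (length x + 1 + k) ^ c"
proof
  fix x :: "bool list" and k :: nat
  define e where "e = (7 * Q + 2) * d"
  let ?F = "1024 ^ (k * (k+1)) :: nat" and ?y = "length x + 1 + k"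
  have F: "1 \<le> ?F" by simp
  \<comment> \<open>This turns the sum in \<open>Bv\<close> into a product, so that the two factors
    can be raised to a power separately.\<close>
  have g: "y + F \<le> 2 * F * y" if "1 \<le> y" "1 \<le> F" for y F :: nat
  proof -
    have "y \<le> F * y" "F \<le> F * y" using that by simp_all
    moreover have "2 * F * y = F * y + F * y" by simp
    ultimately show ?thesis by linarith
  qed
  have "?y + ?F \<le> 2 * ?F * ?y" by (rule g[OF _ F]) simp
  then have B: "Bv x k \<le> 2 * ?F * ?y" unfolding Bv_def by (simp only: add.commute add.left_commute)
  have "1 \<le> Nv x k" using bounds(5)[where x=x and k=k] by linarith
  then have "(Nv x k + 1) ^ d \<le> (2 * Nv x k) ^ d" by (intro power_mono) auto
  also have "\<dots> = (2 * (16 + 4 * Q)) ^ d * Bv x k ^ e"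
    unfolding Nv_def e_def by (simp only: power_mult_distrib power_mult mult.assoc)
  also have "\<dots> \<le> (2 * (16 + 4 * Q)) ^ d * (2 * ?F * ?y) ^ e" by (intro mult_le_mono2 power_mono B) simp
  also have "(2 * ?F * ?y) ^ e = 2 ^ e * (1024 ^ e) ^ (k * (k+1)) * ?y ^ e"
    by (simp only: power_mult_distrib power_mult[symmetric] mult.commute[of e])
  finally have "C * (Nv x k + 1) ^ d \<le> C * ((2 * (16 + 4 * Q)) ^ d * (2 ^ e * (1024 ^ e) ^ (k * (k+1)) * ?y ^ e))"
    by (rule mult_le_mono2)
  then show "C * (Nv x k + 1) ^ d \<le> (C * (2 * (16 + 4 * Q)) ^ d * 2 ^ ((7 * Q + 2) * d)) * (1024 ^ ((7 * Q + 2) * d)) ^ (k * (k+1)) * ?y ^ ((7 * Q + 2) * d)"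
    unfolding e_def by (simp only: mult.assoc)
qed

lemma tractable:
  assumes A: "A = {(i, j). i < m \<and> j < m \<and> R i j}"
    and L: "\<And>x k. (x, k) \<in> L \<longleftrightarrow> (\<exists>n. wf_word x k n \<and> simple n (eGx x n) \<and> simple k (eHx x n k) \<and>
    (\<exists>cp role. copies k (eHx x n k) m R cp role) \<and> (\<exists>f. phom n k (eGx x n) (eHx x n k) f))"
  shows "fixed_parameter_tractable L"
proof -
  have "tri Nv tabled (\<lambda>x k s. \<exists>s'. tabled x k s' \<and> setr 0 (answer s') s' s)"
  proof (rule tri_set[OF D_answer[of Q]])
    fix x k s assume "tabled x k s"
    then have r: "\<forall>i<16. i \<noteq> 5 \<longrightarrow> reg s i = V10 x k i" by (simp add: tabled_def)
    show "OKE Q s \<and> reg s 2 \<le> Nv x k" using OK_V10[OF r] r by (simp add: V10_simps)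
  qed
  from tri_seq[OF stages tri_seq[OF table_stage this]]
  obtain p C d where p: "\<And>x k s. regs x (V0 x k) s \<Longrightarrow>
    runs p s (C * (Nv x k + 1) ^ d) (\<lambda>s. \<exists>s'. tabled x k s' \<and> setr 0 (answer s') s' s)" unfolding tri_def by blast
  obtain a b c where t: "\<And>x k. C * (Nv x k + 1) ^ d \<le> a * b ^ (k * (k+1)) * (length x + 1 + k) ^ c" using time_bound[of C d] by metis
  show ?thesis unfolding fixed_parameter_tractable_def
  proof (rule exI[of _ p], rule exI[of _ "\<lambda>k. a * b ^ (k * (k+1))"], rule exI[of _ c], intro conjI allI)
    show "computable (\<lambda>k. a * b ^ (k * (k+1)))" by (rule computable_expo)
    fix x k
    have "regs x (V0 x k) (input_state x k)" by (simp add: regs_def V0_def input_state_def imem_def)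
    from p[OF this] obtain t s s' where e: "exec p (input_state x k) t s" "t \<le> C * (Nv x k + 1) ^ d" "tabled x k s'" "setr 0 (answer s') s' s"
      unfolding runs_def by blast
    have "reg s 0 = answer s'" using e(4) by (simp add: setr_def)
    then have "reg s 0 \<noteq> 0 \<longleftrightarrow> (x, k) \<in> L" unfolding L using answer_correct[OF e(3) A] by simp
    then show "\<exists>t s. exec p (input_state x k) t s \<and> t \<le> a * b ^ (k * (k+1)) * (length x + 1 + k) ^ c \<and> (reg s 0 \<noteq> 0 \<longleftrightarrow> (x, k) \<in> L)"
      using e(1,2) t[of x k] le_trans by blast
  qed
qed

end

theorem theorem4:
  fixes H\<^sub>0 :: "'a::linorder ograph"
  assumes "ordered_graph H\<^sub>0"
    and "connected_graph H\<^sub>0"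
    and "ordered_core H\<^sub>0"
  shows "fixed_parameter_tractable (ordered_hom_factor_problem H\<^sub>0)"
proof -
  let ?m = "card (verts H\<^sub>0)"
  have "finite {(i, j). i < ?m \<and> j < ?m \<and> padj H\<^sub>0 i j}" by (rule finite_subset[of _ "{..<?m} \<times> {..<?m}"]) auto
  from tractable[OF refl this refl problem_iff[OF assms(1)]] show ?thesis .
qed

end
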